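(* Let $r>0$, $s>1$, $t>0$, and assume that $(\psi_j)_{j\in\mathbb{N}}$ is a Riesz basis of $\mathcal{X}$. Let $\mathcal{G}$ be a map from a subset of $\mathcal{X}$ containing $\tilde C_r^s(\mathcal{X})$ into $\mathcal{Y}$, and assume that there exist $M<\infty$ and an open set $O_{\mathbb{C}}\subseteq\mathcal{X}_{\mathbb{C}}$ containing $\tilde C_r^{s}(\mathcal{X})$ such that $\mathcal{G}$ extends to a holomorphic map $\mathcal{G}:O_{\mathbb{C}}\to\mathcal{Y}_{\mathbb{C}}$ with $\sup_{a\in O_{\mathbb{C}}}\|\mathcal{G}(a)\|_{\mathcal{Y}^t_{\mathbb{C}}}\le M$. Fix $\delta>0$ (arbitrarily small). Then there exists a constant $C>0$ such that for every $N\in\mathbb{N}$ there exists a ReLU neural network $\tilde{\boldsymbol G}_N$ of size $O(N)$ (implied constant independent of $N$) such that $$\big\|\mathcal{G}-\mathcal{D}\circ\tilde{\boldsymbol G}_N\circ\mathcal{E}\big\|_{L^2(C_r^s(\mathcal{X}),(\sigma_r^s)_\sharp\mu;\mathcal{Y})}\le C N^{-\min\{s-\frac12,t\}+\delta}.$$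
   Context: $\mathbb{N}=\{1,2,\dots\}$. $\mathcal{X},\mathcal{Y}$ are separable real Hilbert spaces; the subscript $\mathbb{C}$ denotes complexification. $(\psi_j)_{j\in\mathbb{N}}$ is a Riesz basis of $\mathcal{X}$ (the image of an orthonormal basis under a bounded bijective operator) with dual (biorthogonal) basis $(\tilde\psi_j)_{j\in\mathbb{N}}$, and $(\eta_j)_{j\in\mathbb{N}}$ is a frame of $\mathcal{Y}$ with canonical dual frame $(\tilde\eta_j)_{j\in\mathbb{N}}$. (A sequence $(\eta_j)$ is a frame of $\mathcal{Y}$ if the analysis operator $F:\mathcal{Y}\to\ell^2(\mathbb{N})$, $v\mapsto(\langle v,\eta_j\rangle)_j$, is bounded and boundedly invertible onto its range; the canonical dual frame is $\tilde\eta_j=(F'F)^{-1}\eta_j$ with $F'$ the adjoint of $F$.) Encoder and decoder: $\mathcal{E}:\mathcal{X}\to\ell^2(\mathbb{N})$, $\mathcal{E}(x)=(\langle x,\tilde\psi_j\rangle)_{j\in\mathbb{N}}$; $\mathcal{D}:\ell^2(\mathbb{N})\to\mathcal{Y}$, $\mathcal{D}((y_j)_j)=\sum_{j\in\mathbb{N}}y_j\eta_j$. $(w_j)_{j\in\mathbb{N}}$ is a fixed strictly positive, monotonically decreasing sequence with $(w_j^{1+\epsilon})_j\in\ell^1(\mathbb{N})$ for all $\epsilon>0$. For $t\ge0$, $\|y\|_{\mathcal{Y}^t}^2=\sum_j|\langle y,\tilde\eta_j\rangle|^2w_j^{-2t}$, $\mathcal{Y}^t=\{y\in\mathcal{Y}:\|y\|_{\mathcal{Y}^t}<\infty\}$,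 and $\mathcal{Y}^t_{\mathbb{C}}$ is its complexification (same norm formula). With $U=[-1,1]^{\mathbb{N}}$ and $\sigma_r^s:U\to\mathcal{X}$, $\sigma_r^s(\boldsymbol y)=r\sum_{j\in\mathbb{N}}w_j^sy_j\psi_j$, set $\tilde C_r^s(\mathcal{X})=\{\sigma_r^s(\boldsymbol y):\boldsymbol y\in U\}$ and $C_r^s(\mathcal{X})=\{a\in\mathcal{X}:\sup_{j}|\langle a,\tilde\psi_j\rangle|w_j^{-s}\le r\}$; for a Riesz basis these two sets coincide. $\mu=\bigotimes_{j\in\mathbb{N}}\frac{\lambda}{2}$ is the uniform probability measure on $U$ with the product Borel $\sigma$-algebra ($\lambda$ the Lebesgue measure), and $(\sigma_r^s)_\sharp\mu$ is its pushforward under $\sigma_r^s$, a measure on $C_r^s(\mathcal{X})$. A ReLU neural network is a map $A_L\circ\mathrm{ReLU}\circ A_{L-1}\circ\cdots\circ\mathrm{ReLU}\circ A_0:\mathbb{R}^{n_0}\to\mathbb{R}^{n_{L+1}}$, where $\mathrm{ReLU}(x)=\max\{0,x\}$ acts componentwise and $A_j(x)=W_jx+b_j$ with $W_j\in\mathbb{R}^{n_{j+1}\times n_j}$, $b_j\in\mathbb{R}^{n_{j+1}}$. Its size is the number of nonzero entries of all $W_j$ and $b_j$, $0\le j\le L$. It is viewed as a map $\ell^2(\mathbb{N})\to\ell^2(\mathbb{N})$ by applying it to the first $n_0$ components of the input and padding the output with zeros. *)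

theory Defs
  imports "HOL-Probability.Probability" "Jordan_Normal_Form.Matrix"
begin

text \<open>
  Sequences indexed by \<open>{1,2,...}\<close> are rendered as functions on \<^typ>\<open>nat\<close>, so the entry with index
  \<open>j\<close> here is the entry with index \<open>j + 1\<close> there; no formula below uses the numerical value of an
  index.  Separable real Hilbert spaces are types of sort
  \<open>{real_inner, complete_space, second_countable_topology}\<close>.
\<close>

section \<open>The space of square summable real sequences\<close>

typedef ell2 = "{f :: nat \<Rightarrow> real. summable (\<lambda>j. (f j)\<^sup>2)}"
  morphisms ell2_nth Abs_ell2
  by (rule exI[of _ "\<lambda>_. 0"]) simp

setup_lifting type_definition_ell2

lemma summable_mult_of_squares:
  fixes f g :: "nat \<Rightarrow> real"
  assumes "summable (\<lambda>j. (f j)\<^sup>2)" "summable (\<lambda>j. (g j)\<^sup>2)"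
  shows "summable (\<lambda>j. f j * g j)"
proof (rule summable_comparison_test'[of "\<lambda>j. (f j)\<^sup>2 + (g j)\<^sup>2" 0])
  show "summable (\<lambda>j. (f j)\<^sup>2 + (g j)\<^sup>2)"
    using assms by (rule summable_add)
  fix j
  have "2 * (\<bar>f j\<bar> * \<bar>g j\<bar>) \<le> (f j)\<^sup>2 + (g j)\<^sup>2"
    using sum_squares_bound[of "\<bar>f j\<bar>" "\<bar>g j\<bar>"] by simp
  moreover have "0 \<le> \<bar>f j\<bar> * \<bar>g j\<bar>"
    by simp
  ultimately show "norm (f j * g j) \<le> (f j)\<^sup>2 + (g j)\<^sup>2"
    unfolding real_norm_def abs_mult by linarith
qed

lemma summable_square_add:
  fixes f g :: "nat \<Rightarrow> real"
  assumes "summable (\<lambda>j. (f j)\<^sup>2)" "summable (\<lambda>j. (g j)\<^sup>2)"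
  shows "summable (\<lambda>j. (f j + g j)\<^sup>2)"
  using summable_add[OF summable_add[OF assms]
      summable_mult[OF summable_mult_of_squares[OF assms], of 2]]
  by (simp add: power2_sum algebra_simps)

instantiation ell2 :: real_vector
begin

lift_definition zero_ell2 :: ell2 is "\<lambda>_. 0" by simp

lift_definition plus_ell2 :: "ell2 \<Rightarrow> ell2 \<Rightarrow> ell2" is "\<lambda>f g j. f j + g j"
  by (rule summable_square_add)

lift_definition uminus_ell2 :: "ell2 \<Rightarrow> ell2" is "\<lambda>f j. - f j" by simp

lift_definition minus_ell2 :: "ell2 \<Rightarrow> ell2 \<Rightarrow> ell2" is "\<lambda>f g j. f j - g j"
proof -
  fix f g :: "nat \<Rightarrow> real"
  assume "summable (\<lambda>j. (f j)\<^sup>2)" "summable (\<lambda>j. (g j)\<^sup>2)"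
  then show "summable (\<lambda>j. (f j - g j)\<^sup>2)"
    using summable_square_add[of f "\<lambda>j. - g j"] by simp
qed

lift_definition scaleR_ell2 :: "real \<Rightarrow> ell2 \<Rightarrow> ell2" is "\<lambda>c f j. c * f j"
  by (simp add: power_mult_distrib summable_mult)

instance
proof
  fix x y z :: ell2 and c d :: real
  show "x + y + z = x + (y + z)" by transfer (simp add: algebra_simps)
  show "x + y = y + x" by transfer (simp add: algebra_simps)
  show "0 + x = x" by transfer simp
  show "- x + x = 0" by transfer simp
  show "x - y = x + - y" by transfer simp
  show "c *\<^sub>R (x + y) = c *\<^sub>R x + c *\<^sub>R y" by transfer (simp add: algebra_simps)
  show "(c + d) *\<^sub>R x = c *\<^sub>R x + d *\<^sub>R x" by transfer (simp add: algebra_simps)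
  show "c *\<^sub>R d *\<^sub>R x = (c * d) *\<^sub>R x" by transfer (simp add: algebra_simps)
  show "1 *\<^sub>R x = x" by transfer simp
qed

end

instantiation ell2 :: real_inner
begin

lift_definition inner_ell2 :: "ell2 \<Rightarrow> ell2 \<Rightarrow> real" is "\<lambda>f g. \<Sum>j. f j * g j" .

definition norm_ell2 :: "ell2 \<Rightarrow> real" where
  "norm_ell2 x = sqrt (inner x x)"

definition sgn_ell2 :: "ell2 \<Rightarrow> ell2" where
  "sgn_ell2 x = x /\<^sub>R norm x"

definition dist_ell2 :: "ell2 \<Rightarrow> ell2 \<Rightarrow> real" where
  "dist_ell2 x y = norm (x - y)"

definition uniformity_ell2 :: "(ell2 \<times> ell2) filter" where
  "uniformity_ell2 = (INF e\<in>{0<..}. principal {(x, y). dist x y < e})"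

definition open_ell2 :: "ell2 set \<Rightarrow> bool" where
  "open_ell2 S = (\<forall>x\<in>S. \<forall>\<^sub>F (x', y) in uniformity. x' = x \<longrightarrow> y \<in> S)"

instance
proof
  fix x y z :: ell2 and c :: real
  show "sgn x = x /\<^sub>R norm x" by (rule sgn_ell2_def)
  show "dist x y = norm (x - y)" by (rule dist_ell2_def)
  show "uniformity = (INF e\<in>{0<..}. principal {(x, y :: ell2). dist x y < e})"
    by (rule uniformity_ell2_def)
  show "open U = (\<forall>x\<in>U. \<forall>\<^sub>F (x', y) in uniformity. x' = x \<longrightarrow> y \<in> U)" for U :: "ell2 set"
    by (rule open_ell2_def)
  show "inner x y = inner y x" by transfer (simp add: mult.commute)
  show "inner (x + y) z = inner x z + inner y z"
    by transfer (simp add: distrib_right suminf_add summable_mult_of_squares)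
  show "inner (c *\<^sub>R x) y = c * inner x y"
    by transfer (simp add: mult.assoc suminf_mult summable_mult_of_squares)
  show "0 \<le> inner x x"
    by transfer (auto intro!: suminf_nonneg simp: power2_eq_square)
  show "inner x x = 0 \<longleftrightarrow> x = 0"
    by transfer (auto simp: power2_eq_square suminf_eq_zero_iff fun_eq_iff)
  show "norm x = sqrt (inner x x)" by (rule norm_ell2_def)
qed

end

section \<open>Riesz bases and frames\<close>

definition orthonormal_basis :: "(nat \<Rightarrow> 'a::real_inner) \<Rightarrow> bool" where
  "orthonormal_basis e \<longleftrightarrow>
     (\<forall>i j. inner (e i) (e j) = (if i = j then 1 else 0)) \<and> closure (span (range e)) = UNIV"

definition riesz_basis :: "(nat \<Rightarrow> 'a::real_inner) \<Rightarrow> bool" where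
  "riesz_basis \<psi> \<longleftrightarrow>
     (\<exists>e (T :: 'a \<Rightarrow> 'a). orthonormal_basis e \<and> bounded_linear T \<and> bij T \<and> (\<forall>j. \<psi> j = T (e j)))"

text \<open>For a Riesz basis \<open>\<psi>\<close> there is exactly one such \<open>\<psi>d\<close>, since the span of \<open>\<psi>\<close> is dense.\<close>

definition dual_basis :: "(nat \<Rightarrow> 'a::real_inner) \<Rightarrow> (nat \<Rightarrow> 'a) \<Rightarrow> bool" where
  "dual_basis \<psi> \<psi>d \<longleftrightarrow> (\<forall>i j. inner (\<psi> i) (\<psi>d j) = (if i = j then 1 else 0))"

text \<open>
  \<^const>\<open>Abs_ell2\<close> is unspecified outside the square summable sequences.  The
  first conjunct of \<open>is_frame\<close> excludes this case; for the dual of a Riesz basis (\<open>encoder\<close> below) it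
  does not arise.
\<close>

definition analysis_op :: "(nat \<Rightarrow> 'a::real_inner) \<Rightarrow> 'a \<Rightarrow> ell2" where
  "analysis_op \<eta> v = Abs_ell2 (\<lambda>j. inner v (\<eta> j))"

definition is_frame :: "(nat \<Rightarrow> 'a::real_inner) \<Rightarrow> bool" where
  "is_frame \<eta> \<longleftrightarrow>
     (\<forall>v. summable (\<lambda>j. (inner v (\<eta> j))\<^sup>2)) \<and>
     bounded_linear (analysis_op \<eta>) \<and>
     inj (analysis_op \<eta>) \<and>
     (\<exists>K. \<forall>y\<in>range (analysis_op \<eta>). norm (inv_into UNIV (analysis_op \<eta>) y) \<le> K * norm y)"

definition canonical_dual_frame :: "(nat \<Rightarrow> 'a::real_inner) \<Rightarrow> nat \<Rightarrow> 'a" where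
  "canonical_dual_frame \<eta> j = inv_into UNIV (adjoint (analysis_op \<eta>) \<circ> analysis_op \<eta>) (\<eta> j)"

definition encoder :: "(nat \<Rightarrow> 'a::real_inner) \<Rightarrow> 'a \<Rightarrow> ell2" where
  "encoder \<psi>d x = Abs_ell2 (\<lambda>j. inner x (\<psi>d j))"

definition decoder :: "(nat \<Rightarrow> 'b::real_inner) \<Rightarrow> ell2 \<Rightarrow> 'b" where
  "decoder \<eta> y = (\<Sum>j. ell2_nth y j *\<^sub>R \<eta> j)"

section \<open>Complexification and holomorphy\<close>

text \<open>
  The complexification of \<open>'a\<close> is \<^typ>\<open>'a \<times> 'a\<close>, with \<open>(x, y)\<close> standing for \<open>x + i y\<close>; the norm of
  the product type is the Hilbert norm of the complexification.
\<close>

definition cscale :: "complex \<Rightarrow> 'a::real_vector \<times> 'a \<Rightarrow> 'a \<times> 'a" where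
  "cscale c z =
     (Re c *\<^sub>R fst z - Im c *\<^sub>R snd z, Im c *\<^sub>R fst z + Re c *\<^sub>R snd z)"

text \<open>Complex Frechet differentiability: the real derivative is complex linear.\<close>

definition holomorphic_map_on ::
    "('a::real_normed_vector \<times> 'a \<Rightarrow> 'b::real_normed_vector \<times> 'b) \<Rightarrow> ('a \<times> 'a) set \<Rightarrow> bool" where
  "holomorphic_map_on H S \<longleftrightarrow>
     (\<forall>a\<in>S. \<exists>D. (H has_derivative D) (at a) \<and> (\<forall>c h. D (cscale c h) = cscale c (D h)))"

definition complex_coeff :: "'b::real_inner \<times> 'b \<Rightarrow> 'b \<Rightarrow> complex" where
  "complex_coeff z v = Complex (inner (fst z) v) (inner (snd z) v)"

definition Yt_space_C ::
    "(nat \<Rightarrow> real) \<Rightarrow> (nat \<Rightarrow> 'b::real_inner) \<Rightarrow> real \<Rightarrow> ('b \<times> 'b) set" where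
  "Yt_space_C w \<eta> t =
     {z. summable (\<lambda>j. (cmod (complex_coeff z (canonical_dual_frame \<eta> j)))\<^sup>2 * w j powr (-2 * t))}"

definition Yt_norm_C ::
    "(nat \<Rightarrow> real) \<Rightarrow> (nat \<Rightarrow> 'b::real_inner) \<Rightarrow> real \<Rightarrow> 'b \<times> 'b \<Rightarrow> real" where
  "Yt_norm_C w \<eta> t z =
     sqrt (\<Sum>j. (cmod (complex_coeff z (canonical_dual_frame \<eta> j)))\<^sup>2 * w j powr (-2 * t))"

section \<open>Input sets and measures\<close>

definition param_cube :: "(nat \<Rightarrow> real) set" where
  "param_cube = {y. \<forall>j. y j \<in> {-1..1}}"

definition param_map ::
    "(nat \<Rightarrow> real) \<Rightarrow> (nat \<Rightarrow> 'a::real_inner) \<Rightarrow> real \<Rightarrow> real \<Rightarrow> (nat \<Rightarrow> real) \<Rightarrow> 'a" where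
  "param_map w \<psi> r s y = r *\<^sub>R (\<Sum>j. (w j powr s * y j) *\<^sub>R \<psi> j)"

definition C_tilde :: "(nat \<Rightarrow> real) \<Rightarrow> (nat \<Rightarrow> 'a::real_inner) \<Rightarrow> real \<Rightarrow> real \<Rightarrow> 'a set" where
  "C_tilde w \<psi> r s = param_map w \<psi> r s ` param_cube"

definition C_set :: "(nat \<Rightarrow> real) \<Rightarrow> (nat \<Rightarrow> 'a::real_inner) \<Rightarrow> real \<Rightarrow> real \<Rightarrow> 'a set" where
  "C_set w \<psi>d r s = {a. \<forall>j. \<bar>inner a (\<psi>d j)\<bar> * w j powr (-s) \<le> r}"

text \<open>The space of this measure is \<^const>\<open>param_cube\<close>.\<close>

definition uniform_cube :: "(nat \<Rightarrow> real) measure" where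
  "uniform_cube = Pi\<^sub>M UNIV (\<lambda>_. scale_measure (1/2) (restrict_space lborel {-1..1}))"

definition input_measure ::
    "(nat \<Rightarrow> real) \<Rightarrow> (nat \<Rightarrow> 'a::real_inner) \<Rightarrow> (nat \<Rightarrow> 'a) \<Rightarrow> real \<Rightarrow> real \<Rightarrow> 'a measure" where
  "input_measure w \<psi> \<psi>d r s =
     distr uniform_cube (restrict_space borel (C_set w \<psi>d r s)) (param_map w \<psi> r s)"

definition L2_space :: "'a measure \<Rightarrow> ('a \<Rightarrow> 'b::real_inner) set" where
  "L2_space M = {f \<in> borel_measurable M. integrable M (\<lambda>x. (norm (f x))\<^sup>2)}"

definition L2_norm :: "'a measure \<Rightarrow> ('a \<Rightarrow> 'b::real_inner) \<Rightarrow> real" where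
  "L2_norm M f = sqrt (\<integral>x. (norm (f x))\<^sup>2 \<partial>M)"

section \<open>ReLU neural networks\<close>

text \<open>
  A network is the list \<open>[(W\<^sub>0, b\<^sub>0), ..., (W\<^sub>L, b\<^sub>L)]\<close> of weight matrices and bias vectors; all
  dimensions are at least 1.
\<close>

type_synonym network = "(real Matrix.mat \<times> real Matrix.vec) list"

definition is_network :: "network \<Rightarrow> bool" where
  "is_network net \<longleftrightarrow>
     net \<noteq> [] \<and>
     (\<forall>(W, b)\<in>set net. 0 < dim_row W \<and> 0 < dim_col W \<and> dim_vec b = dim_row W) \<and>
     (\<forall>j. Suc j < length net \<longrightarrow> dim_col (fst (net ! Suc j)) = dim_row (fst (net ! j)))"

definition input_dim :: "network \<Rightarrow> nat" where
  "input_dim net = dim_col (fst (hd net))"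

definition output_dim :: "network \<Rightarrow> nat" where
  "output_dim net = dim_row (fst (last net))"

definition affine_layer :: "real Matrix.mat \<times> real Matrix.vec \<Rightarrow> real Matrix.vec \<Rightarrow> real Matrix.vec" where
  "affine_layer A x = fst A *\<^sub>v x + snd A"

definition relu_vec :: "real Matrix.vec \<Rightarrow> real Matrix.vec" where
  "relu_vec = map_vec (max 0)"

fun realization :: "network \<Rightarrow> real Matrix.vec \<Rightarrow> real Matrix.vec" where
  "realization [] x = x"
| "realization [A] x = affine_layer A x"
| "realization (A # B # net) x = realization (B # net) (relu_vec (affine_layer A x))"

definition network_size :: "network \<Rightarrow> nat" where
  "network_size net =
     (\<Sum>(W, b)\<leftarrow>net.
        card {(i, k). i < dim_row W \<and> k < dim_col W \<and> index_mat W (i, k) \<noteq> 0} +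
        card {i. i < dim_vec b \<and> vec_index b i \<noteq> 0})"

definition network_map :: "network \<Rightarrow> ell2 \<Rightarrow> ell2" where
  "network_map net y =
     Abs_ell2 (\<lambda>j. if j < output_dim net
       then vec_index (realization net (Matrix.vec (input_dim net) (ell2_nth y))) j else 0)"

end

theory Submission
  imports Defs "HOL-Complex_Analysis.Complex_Analysis"
begin

text \<open>
  With \<open>\<rho>\<^sub>i = 1 + c w\<^sub>i\<^bsup>-a\<^esup>\<close> and \<open>a\<close> slightly below \<open>s - 1/2\<close>, the parametrisation \<open>\<sigma>\<close> maps the product of the
  Bernstein ellipses of radii \<open>\<rho>\<^sub>i\<close> into the domain of holomorphy; here compactness of the input set
  and the Riesz property are used.  On this product the frame coefficients of the output, weighted
  by \<open>w\<^sub>j\<^bsup>-t\<^esup>\<close>, are bounded in \<open>\<ell>\<^sup>2\<close>.  A Parseval identity on the boundary of the ellipses (discretised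
  by roots of unity) turns this into an \<open>\<ell>\<^sup>2\<close> bound on the tensor Chebyshev coefficients, the
  coefficient of index \<open>(\<kappa>, j)\<close> being weighted by \<open>V\<^sub>\<kappa> w\<^sub>j\<^bsup>-t\<^esup>\<close> with \<open>V\<^sub>\<kappa>\<close> comparable to a product of powers
  of the \<open>\<rho>\<^sub>i\<close>.  Keeping the indices with \<open>V\<^sub>\<kappa> \<le> R w\<^sub>j\<^sup>t\<close> leaves a mean square error of order \<open>1/R\<close>, and
  since \<open>V\<^bsup>-p\<^esup>\<close> and \<open>w\<^bsup>tp\<^esup>\<close> are summable, the number of kept indices is of order \<open>R\<^sup>p\<close> with \<open>p\<close> just above
  \<open>1 / min (s - 1/2) t\<close>.  The kept Chebyshev products have total degree of order \<open>ln R\<close>, so that a ReLU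
  network realises each of them up to a negligible error with polylogarithmic size; the
  approximate multiplication rests on the sawtooth expansion of the square function.  The
  dimensions of the inputs and outputs are truncated in advance, and no constant depends on them.
\<close>

subsection \<open>Chebyshev polynomials\<close>

fun cheb :: "nat \<Rightarrow> 'a::comm_ring_1 \<Rightarrow> 'a" where
  "cheb 0 x = 1"
| "cheb (Suc 0) x = x"
| "cheb (Suc (Suc n)) x = 2 * x * cheb (Suc n) x - cheb n x"

definition jouk :: "complex \<Rightarrow> complex" where
  "jouk u = (u + inverse u) / 2"

lemma cheb_jouk:
  assumes "u \<noteq> 0"
  shows "cheb n (jouk u) = (u ^ n + inverse u ^ n) / 2"
proof (induction n rule: induct_nat_012)
  case (ge2 n)
  have "2 * jouk u * ((u ^ Suc n + inverse u ^ Suc n) / 2) - (u ^ n + inverse u ^ n) / 2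
      = (u ^ Suc (Suc n) + inverse u ^ Suc (Suc n)) / 2"
    using assms by (simp add: jouk_def field_simps)
  with ge2 show ?case by (simp only: cheb.simps)
qed (simp_all add: jouk_def)

lemma cheb_of_real:
  "cheb n (of_real x :: 'a::{real_algebra_1,comm_ring_1}) = of_real (cheb n x)"
  by (induction n x rule: cheb.induct) simp_all

lemma cheb_cos: "cheb n (cos \<theta>) = cos (real n * \<theta>)"
proof (induction n rule: induct_nat_012)
  case (ge2 n)
  have "cos ((real n + 1) * \<theta> + \<theta>) + cos ((real n + 1) * \<theta> - \<theta>) = 2 * cos \<theta> * cos ((real n + 1) * \<theta>)"
    by (simp only: cos_add cos_diff) simp
  then have "cos (real (Suc (Suc n)) * \<theta>) = 2 * cos \<theta> * cos (real (Suc n) * \<theta>) - cos (real n * \<theta>)"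
    by (simp add: algebra_simps)
  with ge2 show ?case by (simp only: cheb.simps)
qed simp_all

lemma abs_cheb_le_1:
  fixes x :: real
  assumes "\<bar>x\<bar> \<le> 1"
  shows "\<bar>cheb n x\<bar> \<le> 1"
  using cheb_cos[of n "arccos x"] assms by (simp add: abs_le_iff)

lemma continuous_on_cheb [continuous_intros]:
  "continuous_on S (cheb n :: real \<Rightarrow> real)"
  by (induction n "0::real" rule: cheb.induct) (auto intro!: continuous_intros)

subsection \<open>Factorisation over the Chebyshev nodes\<close>

lemma poly_cheb: "poly (cheb n p) x = cheb n (poly p x)"
  by (induction n p rule: cheb.induct) simp_all

lemma coeff_cheb:
  fixes X :: "'a::comm_ring_1 poly"
  assumes X: "X = [:0, 1:]"
  shows "coeff (cheb (Suc n) X) (Suc n) = 2 ^ n \<and> (\<forall>m > Suc n. coeff (cheb (Suc n) X) m = 0)"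
proof (induction n rule: less_induct)
  case (less n)
  have two: "coeff (2 * X * q) (Suc m) = 2 * coeff q m" for q m
  proof -
    have "2 * X * q = X * q + X * q" by (simp only: mult_2 distrib_right)
    moreover have "X * q = pCons 0 q" unfolding X by simp
    ultimately show ?thesis by (simp only: coeff_add coeff_pCons_Suc mult_2)
  qed
  consider "n = 0" | "n = 1" | k where "n = Suc (Suc k)"
    using that by (cases n rule: nat.exhaust[case_names zero suc], blast, rename_tac m, case_tac m) auto
  then show ?case
  proof cases
    case 1
    then show ?thesis by (auto simp: X coeff_pCons split: nat.split)
  next
    case 2
    have "cheb (Suc n) X = 2 * X * X - 1" using 2 by simp
    moreover have "2 * X * X = X * X + X * X" by (simp only: mult_2 distrib_right)
    moreover have "X * X = [:0, 0, 1:]" unfolding X by simp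
    ultimately have "cheb (Suc n) X = [:-1, 0, 2:]" by (simp add: one_pCons)
    then show ?thesis using 2 by (auto simp: coeff_pCons split: nat.split)
  next
    case 3
    have e: "cheb (Suc n) X = 2 * X * cheb (Suc (Suc k)) X - cheb (Suc k) X" using 3 by simp
    have "coeff (cheb (Suc n) X) (Suc m) = 2 * coeff (cheb (Suc (Suc k)) X) m - coeff (cheb (Suc k) X) (Suc m)" for m
      unfolding e coeff_diff two ..
    note step = this
    have k: "coeff (cheb (Suc k) X) m = 0" if "m > Suc k" for m
      using less.IH[of k] 3 that by simp
    have k2: "coeff (cheb (Suc (Suc k)) X) (Suc (Suc k)) = 2 ^ Suc k"
      "\<And>m. m > Suc (Suc k) \<Longrightarrow> coeff (cheb (Suc (Suc k)) X) m = 0"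
      using less.IH[of "Suc k"] 3 by (simp_all del: cheb.simps)
    show ?thesis
    proof (intro conjI allI impI)
      show "coeff (cheb (Suc n) X) (Suc n) = 2 ^ n"
        unfolding step unfolding 3 k2(1) by (subst k) simp_all
      fix m assume m: "m > Suc n"
      then obtain l where l: "m = Suc l" by (cases m) auto
      show "coeff (cheb (Suc n) X) m = 0"
        unfolding l step using m l 3 by (subst k, simp, subst k2(2)) simp_all
    qed
  qed
qed

lemma poly_eq_prod_roots:
  fixes p :: "'a::idom poly"
  assumes A: "finite A" "\<And>a. a \<in> A \<Longrightarrow> poly p a = 0"
    and p: "\<And>m. m > card A \<Longrightarrow> coeff p m = 0"
  shows "poly p x = coeff p (card A) * (\<Prod>a\<in>A. x - a)"
proof (rule ccontr)
  define r where "r = (\<Prod>a\<in>A. [:- a, 1:])"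
  define q where "q = p - Polynomial.smult (coeff p (card A)) r"
  assume ne: "\<not> ?thesis"
  have deg: "degree r = card A"
    unfolding r_def by (subst degree_prod_eq_sum_degree) auto
  have lc: "coeff r (card A) = 1"
    using lead_coeff_prod[of "\<lambda>a. [:- a, 1:]" A] unfolding deg[symmetric] by (simp add: r_def)
  have pr: "poly r y = (\<Prod>a\<in>A. y - a)" for y
    by (simp add: r_def poly_prod)
  have "q \<noteq> 0"
  proof
    assume "q = 0"
    then have "poly p x = poly (Polynomial.smult (coeff p (card A)) r) x" by (simp add: q_def)
    then show False using ne pr[of x] by simp
  qed
  have c0: "coeff q m = 0" if "m \<ge> card A" for m
  proof (cases "m = card A")
    case True then show ?thesis by (simp add: q_def lc)
  next
    case False
    then have "coeff r m = 0" "coeff p m = 0" using that deg p by (auto intro: coeff_eq_0)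
    then show ?thesis by (simp add: q_def)
  qed
  have dq: "degree q < card A"
    using c0[of "degree q"] \<open>q \<noteq> 0\<close> by (metis leading_coeff_0_iff not_le)
  have "A \<subseteq> {y. poly q y = 0}"
    using A by (auto simp: q_def pr)
  then have "card A \<le> card {y. poly q y = 0}"
    by (intro card_mono poly_roots_finite \<open>q \<noteq> 0\<close>)
  also have "\<dots> \<le> degree q" by (rule card_poly_roots_bound[OF \<open>q \<noteq> 0\<close>])
  finally show False using dq by simp
qed

definition cheb_node :: "nat \<Rightarrow> nat \<Rightarrow> real" where
  "cheb_node n k = cos ((2 * real k + 1) * pi / (2 * real n))"

lemma cheb_node_bounds: "\<bar>cheb_node n k\<bar> \<le> 1"
  by (simp add: cheb_node_def)

lemma cheb_node_inj: "inj_on (cheb_node n) {..<n}"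
proof (rule inj_onI)
  fix k l assume kl: "k \<in> {..<n}" "l \<in> {..<n}" and e: "cheb_node n k = cheb_node n l"
  have b: "0 \<le> (2 * real k + 1) * pi / (2 * real n) \<and> (2 * real k + 1) * pi / (2 * real n) \<le> pi" if "k < n" for k
  proof -
    have "(2 * real k + 1) * pi \<le> (2 * real n) * pi"
      by (intro mult_right_mono) (use that in auto)
    then show ?thesis using that by (simp add: divide_le_eq mult.commute)
  qed
  have "(2 * real k + 1) * pi / (2 * real n) = (2 * real l + 1) * pi / (2 * real n)"
    using e b kl unfolding cheb_node_def by (metis arccos_cos lessThan_iff)
  then show "k = l" using kl by (auto simp: field_simps)
qed

lemma cheb_node_root:
  assumes "k < n" shows "cheb n (cheb_node n k) = 0"
proof -
  have "real n * ((2 * real k + 1) * pi / (2 * real n)) = real_of_int (2 * int k + 1) * (pi / 2)"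
    using assms by (cases "n = 0") (simp_all add: field_simps)
  moreover have "cos (real_of_int (2 * int k + 1) * (pi / 2)) = 0"
    using cos_zero_iff_int[of "real_of_int (2 * int k + 1) * (pi / 2)"] by (auto intro!: exI[of _ "2 * int k + 1"])
  ultimately show ?thesis by (simp only: cheb_node_def cheb_cos)
qed

lemma cheb_factor:
  fixes x :: "'a::{real_algebra_1,idom}"
  shows "cheb (Suc n) x = 2 ^ n * (\<Prod>k<Suc n. x - of_real (cheb_node (Suc n) k))"
proof -
  let ?X = "[:0, 1:] :: 'a poly"
  let ?A = "(\<lambda>k. of_real (cheb_node (Suc n) k) :: 'a) ` {..<Suc n}"
  have inj: "inj_on (\<lambda>k. of_real (cheb_node (Suc n) k) :: 'a) {..<Suc n}"
    using cheb_node_inj[of "Suc n"] by (auto simp: inj_on_def)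
  then have card: "card ?A = Suc n" by (simp add: card_image)
  have "cheb (Suc n) x = poly (cheb (Suc n) ?X) x" by (simp add: poly_cheb del: cheb.simps)
  also have "\<dots> = coeff (cheb (Suc n) ?X) (card ?A) * (\<Prod>a\<in>?A. x - a)"
  proof (rule poly_eq_prod_roots)
    fix a assume "a \<in> ?A"
    then show "poly (cheb (Suc n) ?X) a = 0"
      by (auto simp: poly_cheb cheb_of_real cheb_node_root simp del: cheb.simps)
  qed (use coeff_cheb[of ?X n] card in auto)
  also have "(\<Prod>a\<in>?A. x - a) = (\<Prod>k<Suc n. x - of_real (cheb_node (Suc n) k))"
    using inj by (subst prod.reindex) auto
  finally show ?thesis using coeff_cheb[of ?X n] card by (simp del: cheb.simps)
qed

lemma cheb_span_prod:
  assumes "finite A"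
  shows "\<exists>c. \<forall>z::complex. (\<Prod>a\<in>A. z - g a) = (\<Sum>k\<le>card A. c k * cheb k z)"
  using assms
proof (induction A)
  case empty
  show ?case by (intro exI[of _ "\<lambda>_. 1"]) simp
next
  case (insert a A)
  then obtain c where c: "\<And>z. (\<Prod>a\<in>A. z - g a) = (\<Sum>k\<le>card A. c k * cheb k z)" by auto
  let ?n = "card A"
  have mult: "\<exists>e. \<forall>z::complex. z * cheb k z = (\<Sum>l\<le>Suc ?n. e l * cheb l z)" if "k \<le> ?n" for k
  proof (cases k)
    case 0
    show ?thesis unfolding 0
      by (intro exI[of _ "\<lambda>l. if l = 1 then 1 else 0"]) (simp add: if_distrib[of "\<lambda>x. x * _"] sum.delta cong: if_cong)
  next
    case (Suc j)
    have "z * cheb k z = (\<Sum>l\<le>Suc ?n. ((if l = Suc k then 1/2 else 0) + (if l = j then 1/2 else 0)) * cheb l z)" for z :: complex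
    proof -
      have "(\<Sum>l\<le>Suc ?n. ((if l = Suc k then 1/2 else 0) + (if l = j then 1/2 else 0)) * cheb l z)
        = (\<Sum>l\<le>Suc ?n. (if l = Suc k then 1/2 * cheb l z else 0)) + (\<Sum>l\<le>Suc ?n. (if l = j then 1/2 * cheb l z else 0))"
        unfolding sum.distrib[symmetric] by (intro sum.cong) (auto simp: algebra_simps)
      also have "\<dots> = 1/2 * cheb (Suc k) z + 1/2 * cheb j z"
        using that Suc by (subst (1 2) sum.delta) auto
      also have "\<dots> = z * cheb k z" using Suc by (simp add: field_simps)
      finally show ?thesis by simp
    qed
    then have "\<forall>z::complex. z * cheb k z = (\<Sum>l\<le>Suc ?n. ((if l = Suc k then 1/2 else 0) + (if l = j then 1/2 else 0)) * cheb l z)"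
      by (rule allI)
    then show ?thesis by - (rule exI, assumption)
  qed
  then have "\<forall>k. \<exists>e. k \<le> ?n \<longrightarrow> (\<forall>z::complex. z * cheb k z = (\<Sum>l\<le>Suc ?n. e l * cheb l z))"
    by (intro allI, rename_tac k, case_tac "k \<le> ?n") (simp_all del: sum.atMost_Suc)
  from choice[OF this] obtain e where e: "\<And>k z. k \<le> ?n \<Longrightarrow> z * cheb k z = (\<Sum>l\<le>Suc ?n. e k l * cheb l (z::complex))"
    by (elim exE) (simp del: sum.atMost_Suc)
  have "(\<Prod>b\<in>insert a A. z - g b) = (\<Sum>l\<le>Suc ?n. ((\<Sum>k\<le>?n. c k * e k l) - g a * (if l \<le> ?n then c l else 0)) * cheb l z)" for z
  proof -
    have "(\<Prod>b\<in>insert a A. z - g b) = z * (\<Prod>a\<in>A. z - g a) - g a * (\<Prod>a\<in>A. z - g a)"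
      using insert by (simp add: algebra_simps)
    also have "z * (\<Prod>a\<in>A. z - g a) = (\<Sum>k\<le>?n. c k * (\<Sum>l\<le>Suc ?n. e k l * cheb l z))"
      unfolding c sum_distrib_left by (intro sum.cong refl) (simp add: e[symmetric] sum_distrib_left[symmetric] del: sum.atMost_Suc)
    also have "\<dots> = (\<Sum>l\<le>Suc ?n. (\<Sum>k\<le>?n. c k * e k l) * cheb l z)"
      unfolding sum_distrib_left sum_distrib_right by (subst sum.swap) (simp add: mult.assoc del: sum.atMost_Suc)
    also have "g a * (\<Prod>a\<in>A. z - g a) = (\<Sum>l\<le>Suc ?n. g a * (if l \<le> ?n then c l else 0) * cheb l z)"
      unfolding c sum_distrib_left by (simp add: mult.assoc)
    finally show ?thesis by (simp only: left_diff_distrib sum_subtractf)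
  qed
  moreover have "card (insert a A) = Suc ?n" using insert by simp
  ultimately have "\<forall>z. (\<Prod>b\<in>insert a A. z - g b) = (\<Sum>l\<le>card (insert a A). ((\<Sum>k\<le>?n. c k * e k l) - g a * (if l \<le> ?n then c l else 0)) * cheb l z)"
    by (simp only: simp_thms)
  then show ?case by - (rule exI, assumption)
qed

lemma lagrange_remainder:
  fixes x :: "'i \<Rightarrow> complex"
  assumes "finite A" "inj_on x A" "\<zeta> \<notin> x ` A" "\<zeta> \<noteq> z"
  shows "(\<Sum>a\<in>A. (\<Prod>b\<in>A - {a}. (z - x b) / (x a - x b)) / (\<zeta> - x a))
       = (1 - (\<Prod>a\<in>A. z - x a) / (\<Prod>a\<in>A. \<zeta> - x a)) / (\<zeta> - z)"
  using assms
proof (induction A arbitrary: \<zeta>)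
  case empty
  then show ?case by simp
next
  case (insert c A)
  let ?l = "\<lambda>a. (\<Prod>b\<in>A - {a}. (z - x b) / (x a - x b))"
  let ?w = "\<lambda>z. \<Prod>a\<in>A. z - x a"
  have xc: "x c \<notin> x ` A" and inj: "inj_on x A" using insert.prems(1) insert.hyps by (auto simp: inj_on_def)
  have zc: "\<zeta> \<noteq> x c" using insert.prems by auto
  have wz: "?w \<zeta> \<noteq> 0" "?w (x c) \<noteq> 0" using insert.prems insert.hyps xc by auto
  have la: "(\<Prod>b\<in>insert c A - {a}. (z - x b) / (x a - x b)) = ?l a * ((z - x c) / (x a - x c))" if "a \<in> A" for a
  proof -
    have "insert c A - {a} = insert c (A - {a})" using that insert.hyps by auto
    then show ?thesis using insert.hyps that by (simp add: mult.commute)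
  qed
  have lc: "(\<Prod>b\<in>insert c A - {c}. (z - x b) / (x c - x b)) = ?w z / ?w (x c)"
    using insert.hyps by (simp add: prod_dividef)
  have S: "(\<Sum>a\<in>insert c A. (\<Prod>b\<in>insert c A - {a}. (z - x b) / (x a - x b)) / (\<zeta> - x a))
      = (\<Sum>a\<in>A. ?l a * ((z - x c) / (x a - x c)) / (\<zeta> - x a)) + ?w z / ?w (x c) / (\<zeta> - x c)"
    unfolding sum.insert[OF insert.hyps] lc using la by (simp add: add.commute cong: sum.cong)
  show ?case
  proof (cases "z = x c")
    case True
    then show ?thesis unfolding S using insert.hyps wz by (simp add: prod_dividef)
  next
    case False
    have frac: "L * (D / E) / F = D / G * (L / F - L / K)" if "1 / (E * F) = (1 / F - 1 / K) / G" for D E F G K L :: complex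
    proof -
      have "L * (D / E) / F = L * D * (1 / (E * F))" by simp
      also have "\<dots> = D / G * (L / F - L / K)" unfolding that by (simp add: algebra_simps diff_divide_distrib)
      finally show ?thesis .
    qed
    have frac2: "X / Y * ((1 - W) / Z - (1 - V) / (- X)) + V / Y = (1 - X * W / Y) / Z"
      if "X \<noteq> 0" "Y \<noteq> 0" "Z \<noteq> 0" "Y = X + Z" for X Y Z W V :: complex
    proof -
      have "X / Y * ((1 - W) / Z - (1 - V) / (- X)) + V / Y = X * (1 - W) / (Y * Z) + 1 / Y"
        using that(1-3) by (simp add: algebra_simps diff_divide_distrib add_divide_distrib)
      also have "1 / Y = Z / (Y * Z)" using that by simp
      also have "X * (1 - W) / (Y * Z) + Z / (Y * Z) = (Y - X * W) / (Y * Z)"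
        unfolding add_divide_distrib[symmetric] using that(4) by (simp add: algebra_simps)
      also have "\<dots> = (1 - X * W / Y) / Z" using that(1-3) by (simp add: diff_divide_distrib)
      finally show ?thesis .
    qed
    have pf: "?l a * ((z - x c) / (x a - x c)) / (\<zeta> - x a) = (z - x c) / (\<zeta> - x c) * (?l a / (\<zeta> - x a) - ?l a / (x c - x a))" if "a \<in> A" for a
    proof -
      have "x a \<noteq> x c" using xc that by (metis image_eqI)
      moreover have "\<zeta> \<noteq> x a" using that insert.prems by auto
      ultimately have "1 / ((x a - x c) * (\<zeta> - x a)) = (1 / (\<zeta> - x a) - 1 / (x c - x a)) / (\<zeta> - x c)"
        using zc by (simp add: divide_simps) (simp add: algebra_simps)
      from frac[OF this] show ?thesis .
    qed
    have "(\<Sum>a\<in>A. ?l a * ((z - x c) / (x a - x c)) / (\<zeta> - x a))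
       = (z - x c) / (\<zeta> - x c) * ((\<Sum>a\<in>A. ?l a / (\<zeta> - x a)) - (\<Sum>a\<in>A. ?l a / (x c - x a)))"
      unfolding sum_subtractf[symmetric] sum_distrib_left by (rule sum.cong[OF refl pf])
    also have "(\<Sum>a\<in>A. ?l a / (\<zeta> - x a)) = (1 - ?w z / ?w \<zeta>) / (\<zeta> - z)"
      using insert.prems inj by (intro insert.IH) auto
    also have "(\<Sum>a\<in>A. ?l a / (x c - x a)) = (1 - ?w z / ?w (x c)) / (x c - z)"
      using False xc inj by (intro insert.IH) auto
    finally have E: "(\<Sum>a\<in>A. ?l a * ((z - x c) / (x a - x c)) / (\<zeta> - x a))
      = (z - x c) / (\<zeta> - x c) * ((1 - ?w z / ?w \<zeta>) / (\<zeta> - z) - (1 - ?w z / ?w (x c)) / (x c - z))" .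
    define W V where "W = ?w z / ?w \<zeta>" and "V = ?w z / ?w (x c)"
    have "(z - x c) / (\<zeta> - x c) * ((1 - W) / (\<zeta> - z) - (1 - V) / (x c - z)) + V / (\<zeta> - x c)
        = (1 - (z - x c) * W / (\<zeta> - x c)) / (\<zeta> - z)"
      unfolding minus_diff_eq[of z "x c", symmetric]
      by (rule frac2) (use zc False insert.prems(3) in simp_all)
    moreover have "(\<Prod>a\<in>insert c A. z - x a) / (\<Prod>a\<in>insert c A. \<zeta> - x a) = (z - x c) * W / (\<zeta> - x c)"
      using insert.hyps by (simp add: W_def)
    ultimately show ?thesis unfolding S E by (simp add: W_def V_def)
  qed
qed

subsection \<open>Bernstein ellipses\<close>

definition ell :: "real \<Rightarrow> complex set" where
  "ell \<rho> = {z. cmod (z - 1) + cmod (z + 1) < \<rho> + 1 / \<rho>}"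

definition cell :: "real \<Rightarrow> complex set" where
  "cell \<rho> = jouk ` {v. 1 \<le> cmod v \<and> cmod v \<le> \<rho>}"

lemma convex_ell: "convex (ell \<rho>)"
proof -
  have "convex_on UNIV (\<lambda>z. cmod (z - 1) + cmod (z + 1))"
  proof (rule convex_on_add)
    have *: "cmod (z - 1) = dist 1 z" "cmod (z + 1) = dist (- 1) z" for z
      by (simp_all add: dist_norm norm_minus_commute add.commute)
    show "convex_on UNIV (\<lambda>z. cmod (z - 1))" "convex_on UNIV (\<lambda>z. cmod (z + 1))"
      unfolding * by (rule convex_on_dist, simp)+
  qed
  have "cmod (u *\<^sub>R x + v *\<^sub>R y - 1) + cmod (u *\<^sub>R x + v *\<^sub>R y + 1) < c"
    if "cmod (x - 1) + cmod (x + 1) < c" "cmod (y - 1) + cmod (y + 1) < c" "0 \<le> u" "0 \<le> v" "u + v = 1" for x y u v c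
  proof -
    have "cmod (u *\<^sub>R x + v *\<^sub>R y - 1) + cmod (u *\<^sub>R x + v *\<^sub>R y + 1)
       \<le> u * (cmod (x - 1) + cmod (x + 1)) + v * (cmod (y - 1) + cmod (y + 1))"
      using that \<open>convex_on UNIV _\<close> unfolding convex_on_def by blast
    also have "\<dots> < c" by (rule convex_bound_lt) (use that in auto)
    finally show ?thesis .
  qed
  then show ?thesis unfolding ell_def convex_def by blast
qed

lemma open_ell: "open (ell \<rho>)"
  unfolding ell_def by (intro open_Collect_less continuous_intros)

lemma jouk_focal:
  assumes "u \<noteq> 0"
  shows "cmod (jouk u - 1) + cmod (jouk u + 1) = cmod u + 1 / cmod u"
proof -
  have "jouk u - 1 = (u - 1)\<^sup>2 / (2 * u)" "jouk u + 1 = (u + 1)\<^sup>2 / (2 * u)"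
    using assms by (simp_all add: jouk_def field_simps power2_eq_square)
  then have "cmod (jouk u - 1) + cmod (jouk u + 1) = ((cmod (u - 1))\<^sup>2 + (cmod (u + 1))\<^sup>2) / (2 * cmod u)"
    by (simp add: norm_divide norm_mult norm_power add_divide_distrib)
  also have "(cmod (u - 1))\<^sup>2 + (cmod (u + 1))\<^sup>2 = 2 * (cmod u)\<^sup>2 + 2"
    unfolding cmod_power2 by (simp add: power2_eq_square algebra_simps)
  also have "(2 * (cmod u)\<^sup>2 + 2) / (2 * cmod u) = cmod u + 1 / cmod u"
    using assms by (simp add: field_simps power2_eq_square)
  finally show ?thesis .
qed

lemma plus_inverse_mono:
  fixes a b :: real
  assumes "1 \<le> a" "a < b" shows "a + 1 / a < b + 1 / b"
proof -
  have "b + 1/b - (a + 1/a) = (b - a) * (a * b - 1) / (a * b)"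
    using assms by (simp add: field_simps)
  moreover have "1 < a * b" using assms by (metis less_1_mult mult.commute mult_1 order_le_less order_less_le_trans)
  ultimately have "0 < b + 1/b - (a + 1/a)" using assms by simp
  then show ?thesis by simp
qed

lemma jouk_in_ell:
  assumes "1 \<le> cmod u" "cmod u < \<rho>" shows "jouk u \<in> ell \<rho>"
  using plus_inverse_mono[OF assms] jouk_focal[of u] assms by (cases "u = 0") (auto simp: ell_def)

lemma jouk_surj: "\<exists>v. 1 \<le> cmod v \<and> z = jouk v"
proof -
  define u where "u = z + csqrt (z\<^sup>2 - 1)"
  have p: "u * (z - csqrt (z\<^sup>2 - 1)) = 1"
    by (simp add: u_def algebra_simps power2_eq_square[symmetric])
  then have u0: "u \<noteq> 0" by auto
  have "inverse u = z - csqrt (z\<^sup>2 - 1)" using p by (metis inverse_unique)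
  then have j: "z = jouk u" by (simp add: jouk_def u_def)
  show ?thesis
  proof (cases "1 \<le> cmod u")
    case True with j show ?thesis by blast
  next
    case False
    then have "1 \<le> cmod (inverse u)" using u0 by (simp add: norm_inverse one_le_inverse)
    moreover have "z = jouk (inverse u)" using j by (simp add: jouk_def add.commute)
    ultimately show ?thesis by blast
  qed
qed

lemma ell_obtain:
  assumes "z \<in> ell \<rho>" "1 \<le> \<rho>"
  obtains v where "1 \<le> cmod v" "cmod v < \<rho>" "z = jouk v"
proof -
  obtain v where v: "1 \<le> cmod v" "z = jouk v" using jouk_surj by blast
  have "cmod v < \<rho>"
  proof (rule ccontr)
    assume "\<not> cmod v < \<rho>"
    then have "\<rho> + 1/\<rho> \<le> cmod v + 1 / cmod v"
      using plus_inverse_mono[of \<rho> "cmod v"] assms(2) by (cases "\<rho> = cmod v") auto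
    with assms v jouk_focal[of v] show False by (cases "v = 0") (auto simp: ell_def)
  qed
  with v that show ?thesis by blast
qed

lemma cell_subset_ell: "\<rho> < \<sigma> \<Longrightarrow> cell \<rho> \<subseteq> ell \<sigma>"
  by (auto simp: cell_def intro!: jouk_in_ell)

lemma of_real_in_cell:
  assumes "\<bar>x\<bar> \<le> 1" "1 \<le> \<rho>" shows "complex_of_real x \<in> cell \<rho>"
proof -
  have "jouk (cis (arccos x)) = of_real x"
    using assms by (simp add: jouk_def cis_inverse complex_eq_iff)
  then show ?thesis unfolding cell_def using assms by (intro image_eqI[of _ _ "cis (arccos x)"]) auto
qed

lemma dist_cell_interval:
  assumes "1 \<le> cmod v"
  obtains x :: real where "\<bar>x\<bar> \<le> 1" "cmod (jouk v - of_real x) \<le> cmod v - 1"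
proof -
  define e where "e = v / of_real (cmod v)"
  have v0: "v \<noteq> 0" using assms by auto
  have e1: "cmod e = 1" using v0 by (simp add: e_def norm_divide)
  have ve: "v = of_real (cmod v) * e" using v0 by (simp add: e_def)
  have ie: "inverse e = cnj e" using e1 by (simp add: inverse_complex_def complex_eq_iff cmod_power2[symmetric])
  have J1: "jouk e = of_real (Re e)" unfolding jouk_def ie by (simp add: complex_eq_iff)
  have J2: "jouk v - jouk e = (of_real (cmod v - 1) * e + of_real (1 / cmod v - 1) * inverse e) / 2"
  proof -
    have "inverse v = of_real (1 / cmod v) * inverse e"
      by (subst ve) (simp add: inverse_eq_divide)
    then show ?thesis unfolding jouk_def by (subst ve) (simp add: algebra_simps diff_divide_distrib add_divide_distrib)
  qed
  have "cmod (of_real (cmod v - 1) * e + of_real (1 / cmod v - 1) * inverse e) \<le> (cmod v - 1) + (cmod v - 1)"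
  proof (rule norm_triangle_le, rule add_mono)
    show "cmod (of_real (cmod v - 1) * e) \<le> cmod v - 1"
      using assms by (simp only: norm_mult norm_of_real e1) simp
    have "\<bar>1 / cmod v - 1\<bar> = (cmod v - 1) / cmod v" using assms v0 by (simp add: abs_if field_simps)
    also have "\<dots> \<le> cmod v - 1" using assms v0 using mult_left_mono[of 1 "cmod v" "cmod v - 1"] by (simp add: divide_le_eq)
    finally show "cmod (of_real (1 / cmod v - 1) * inverse e) \<le> cmod v - 1"
      by (simp only: norm_mult norm_of_real norm_inverse e1) simp
  qed
  then have "cmod (jouk v - of_real (Re e)) \<le> cmod v - 1"
    unfolding J1[symmetric] J2 norm_divide by simp
  moreover have "\<bar>Re e\<bar> \<le> 1" using abs_Re_le_cmod[of e] e1 by simp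
  ultimately show ?thesis using that by blast
qed

definition jouk_path :: "real \<Rightarrow> real \<Rightarrow> complex" where
  "jouk_path \<tau> = jouk \<circ> circlepath 0 \<tau>"

lemma circlepath_0_eq: "circlepath 0 \<tau> x = of_real \<tau> * exp (2 * of_real pi * \<i> * of_real x)"
  by (simp add: circlepath)

lemma jouk_path_derivative:
  assumes "0 < \<tau>"
  defines "u \<equiv> circlepath 0 \<tau>"
  shows "(jouk_path \<tau> has_vector_derivative (1 - inverse ((u x)\<^sup>2)) / 2 * (2 * of_real pi * \<i> * u x)) (at x within S)"
proof -
  have u0: "u x \<noteq> 0" using assms by (simp add: circlepath_0_eq)
  have J: "(jouk has_field_derivative (1 - inverse ((u x)\<^sup>2)) / 2) (at (u x))"
    unfolding jouk_def[abs_def] using u0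
    by (auto intro!: derivative_eq_intros simp: field_simps power2_eq_square)
  have U: "(u has_vector_derivative (2 * of_real pi * \<i> * u x)) (at x within S)"
    unfolding u_def circlepath_0_eq[abs_def]
    by (rule has_vector_derivative_real_field) (auto intro!: derivative_eq_intros)
  show ?thesis unfolding jouk_path_def u_def[symmetric]
    using field_vector_diff_chain_within[OF U has_field_derivative_at_within[OF J]] by (simp add: mult.commute)
qed


lemma jouk_path_props:
  assumes "0 < \<tau>"
  shows "valid_path (jouk_path \<tau>)" "pathfinish (jouk_path \<tau>) = pathstart (jouk_path \<tau>)"
    "path_image (jouk_path \<tau>) = jouk ` {u. cmod u = \<tau>}"
proof -
  have "jouk holomorphic_on - {0}"
    unfolding jouk_def[abs_def] by (intro holomorphic_intros) auto
  moreover have "path_image (circlepath 0 \<tau>) \<subseteq> - {0}" using assms by auto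
  ultimately show "valid_path (jouk_path \<tau>)"
    unfolding jouk_path_def by (intro valid_path_compose_holomorphic[where S = "- {0}"]) auto
  show "pathfinish (jouk_path \<tau>) = pathstart (jouk_path \<tau>)"
    by (simp add: jouk_path_def pathfinish_compose pathstart_compose)
  show "path_image (jouk_path \<tau>) = jouk ` {u. cmod u = \<tau>}"
    using assms by (auto simp: jouk_path_def path_image_compose sphere_def)
qed

lemma jouk_path_vector_derivative:
  assumes "0 < \<tau>" "x \<in> {0..1}"
  defines "u \<equiv> circlepath 0 \<tau>"
  shows "vector_derivative (jouk_path \<tau>) (at x within {0..1})
    = (1 - inverse ((u x)\<^sup>2)) / 2 * (2 * of_real pi * \<i> * u x)"
  unfolding u_def
  by (rule vector_derivative_within_closed_interval[OF _ _ jouk_path_derivative]) (use assms in auto)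

lemma circlepath_vector_derivative:
  assumes "x \<in> {0..1}"
  shows "vector_derivative (circlepath 0 \<tau>) (at x within {0..1}) = 2 * of_real pi * \<i> * circlepath 0 \<tau> x"
proof -
  have "(circlepath 0 \<tau> has_vector_derivative (2 * of_real pi * \<i> * circlepath 0 \<tau> x)) (at x within {0..1})"
    unfolding circlepath_0_eq[abs_def]
    by (rule has_vector_derivative_real_field) (auto intro!: derivative_eq_intros)
  then show ?thesis
    by (rule vector_derivative_within_closed_interval[rotated 2]) (use assms in auto)
qed

lemma has_contour_integral_jouk_path:
  assumes "0 < \<tau>"
    and "((\<lambda>u. f (jouk u) * ((1 - inverse (u\<^sup>2)) / 2)) has_contour_integral I) (circlepath 0 \<tau>)"
  shows "(f has_contour_integral I) (jouk_path \<tau>)"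
  using assms(2) unfolding has_contour_integral_def
proof (rule has_integral_eq[rotated])
  fix x :: real assume "x \<in> {0..1}"
  then show "f (jouk (circlepath 0 \<tau> x)) * ((1 - inverse ((circlepath 0 \<tau> x)\<^sup>2)) / 2) *
      vector_derivative (circlepath 0 \<tau>) (at x within {0..1}) =
      f (jouk_path \<tau> x) * vector_derivative (jouk_path \<tau>) (at x within {0..1})"
    by (simp only: jouk_path_vector_derivative[OF assms(1)] circlepath_vector_derivative)
       (simp add: jouk_path_def)
qed

lemma has_contour_integral_jouk_path_bound:
  assumes "1 \<le> \<tau>" "(f has_contour_integral I) (jouk_path \<tau>)" "0 \<le> B"
    and "\<And>u. cmod u = \<tau> \<Longrightarrow> cmod (f (jouk u)) \<le> B"
  shows "cmod I \<le> B * (2 * pi * \<tau>)"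
proof -
  have "norm (f (jouk_path \<tau> x) * vector_derivative (jouk_path \<tau>) (at x within {0..1})) \<le> B * (2 * pi * \<tau>)"
    if x: "x \<in> {0..1}" for x
  proof -
    define u where "u = circlepath 0 \<tau> x"
    have u: "cmod u = \<tau>" using assms(1) by (simp add: u_def circlepath_0_eq norm_mult)
    have "cmod ((1 - inverse (u\<^sup>2)) / 2) \<le> (1 + inverse (\<tau>\<^sup>2)) / 2"
      using norm_triangle_ineq4[of 1 "inverse (u\<^sup>2)"] u by (simp add: norm_inverse norm_power norm_divide)
    also have "\<dots> \<le> 1" using assms(1) by (simp add: inverse_le_1_iff)
    finally have d: "cmod ((1 - inverse (u\<^sup>2)) / 2) \<le> 1" .
    have tau0: "0 < \<tau>" using assms(1) by simp
    have "norm (f (jouk_path \<tau> x) * vector_derivative (jouk_path \<tau>) (at x within {0..1}))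
       = cmod (f (jouk u)) * (cmod ((1 - inverse (u\<^sup>2)) / 2) * (2 * pi * \<tau>))"
      unfolding jouk_path_vector_derivative[OF tau0 x] u_def[symmetric]
      using u assms(1) by (simp add: norm_mult norm_divide jouk_path_def flip: u_def)
    also have "\<dots> \<le> B * (1 * (2 * pi * \<tau>))"
      using assms d u by (intro mult_mono) auto
    finally show ?thesis by simp
  qed
  from has_integral_bound_real[OF _ _ assms(2)[unfolded has_contour_integral_def], of "B * (2 * pi * \<tau>)" "{}"] this assms
  show ?thesis by simp
qed

lemma jouk_diff:
  assumes "u \<noteq> 0" "v \<noteq> 0"
  shows "jouk u - jouk v = (u - v) * (1 - inverse (u * v)) / 2"
  using assms by (simp add: jouk_def field_simps)

lemma winding_number_jouk_path:
  assumes v: "1 \<le> cmod v" "cmod v < \<tau>"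
  shows "winding_number (jouk_path \<tau>) (jouk v) = 1" "jouk v \<notin> path_image (jouk_path \<tau>)"
proof -
  have t0: "0 < \<tau>" and v0: "v \<noteq> 0" using v by auto
  have iv: "cmod (inverse v) < \<tau>"
    using v v0 by (simp add: norm_inverse) (metis inverse_le_1_iff le_less_trans order_trans v(2))
  have ne: "u \<noteq> 0 \<and> u \<noteq> v \<and> u \<noteq> inverse v" if "cmod u = \<tau>" for u
    using that v iv t0 by auto
  have jne: "jouk u \<noteq> jouk v" if "cmod u = \<tau>" for u
  proof -
    have "u * v \<noteq> 1" using ne[OF that] by (metis inverse_unique mult.commute)
    then have "inverse (u * v) \<noteq> 1" by (metis inverse_1 inverse_inverse_eq)
    then show ?thesis using jouk_diff[of u v] ne[OF that] v0 by auto
  qed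
  show nin: "jouk v \<notin> path_image (jouk_path \<tau>)"
  proof
    assume "jouk v \<in> path_image (jouk_path \<tau>)"
    then obtain u where "cmod u = \<tau>" "jouk v = jouk u" unfolding jouk_path_props(3)[OF t0] by auto
    with jne[of u] show False by simp
  qed
  have c: "((\<lambda>u. 1 / (u - w)) has_contour_integral 2 * of_real pi * \<i>) (circlepath 0 \<tau>)" if "cmod w < \<tau>" for w
    using Cauchy_integral_circlepath_simple[of "\<lambda>_. 1" 0 \<tau> w] that by simp
  have "((\<lambda>u. 1 / (u - v) + 1 / (u - inverse v) - 1 / (u - 0)) has_contour_integral
       (2 * of_real pi * \<i> + 2 * of_real pi * \<i> - 2 * of_real pi * \<i>)) (circlepath 0 \<tau>)"
    using v iv t0 by (intro has_contour_integral_add has_contour_integral_diff c) auto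
  then have "((\<lambda>u. 1 / (jouk u - jouk v) * ((1 - inverse (u\<^sup>2)) / 2)) has_contour_integral 2 * of_real pi * \<i>) (circlepath 0 \<tau>)"
  proof (subst has_contour_integral_cong)
    fix u assume "u \<in> path_image (circlepath 0 \<tau>)"
    then have u: "cmod u = \<tau>" using t0 by auto
    define i where "i = inverse v"
    have iv1: "v * i = 1" "i \<noteq> 0" using v0 by (simp_all add: i_def)
    have n: "u \<noteq> 0" "u - v \<noteq> 0" "u - i \<noteq> 0" using ne[OF u] by (auto simp: i_def)
    have jd: "jouk u - jouk v = (u - v) * (u - i) / (2 * u)"
      using n v0 by (simp add: jouk_def i_def field_simps)
    have "1 / (jouk u - jouk v) * ((1 - inverse (u\<^sup>2)) / 2) = (u - inverse u) / ((u - v) * (u - i))"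
    proof -
      have "1 / (A / (2 * u)) * ((1 - inverse (u\<^sup>2)) / 2) = (u - inverse u) / A" if "A \<noteq> 0" for A
        using n(1) that by (simp add: field_simps power2_eq_square)
      from this[of "(u - v) * (u - i)"] n show ?thesis unfolding jd by simp
    qed
    also have "\<dots> = 1 / (u - v) + 1 / (u - i) - 1 / u"
    proof -
      have "(u\<^sup>2 - 1) = (u - i) * u + (u - v) * u - (u - v) * (u - i)"
        using iv1 by (simp add: algebra_simps power2_eq_square)
      then have "(u\<^sup>2 - 1) / (u * ((u - v) * (u - i))) = ((u - i) * u + (u - v) * u - (u - v) * (u - i)) / (u * ((u - v) * (u - i)))"
        by simp
      also have "\<dots> = 1 / (u - v) + 1 / (u - i) - 1 / u"
        by (simp only: add_divide_distrib diff_divide_distrib) (use n in simp)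
      finally show ?thesis using n by (simp add: power2_eq_square diff_divide_distrib inverse_eq_divide)
    qed
    finally show "1 / (jouk u - jouk v) * ((1 - inverse (u\<^sup>2)) / 2) = 1 / (u - v) + 1 / (u - inverse v) - 1 / (u - 0)"
      by (simp add: i_def)
  qed (simp_all)
  then have "((\<lambda>w. 1 / (w - jouk v)) has_contour_integral 2 * of_real pi * \<i>) (jouk_path \<tau>)"
    by (rule has_contour_integral_jouk_path[OF t0])
  then show "winding_number (jouk_path \<tau>) (jouk v) = 1"
    using winding_number_valid_path[OF jouk_path_props(1)[OF t0] nin] by (simp add: contour_integral_unique)
qed

definition cheb_lagrange :: "nat \<Rightarrow> nat \<Rightarrow> complex \<Rightarrow> complex" where
  "cheb_lagrange n m z = (\<Prod>b\<in>{..<n} - {m}. (z - cheb_node n b) / (cheb_node n m - cheb_node n b))"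

lemma cheb_lagrange_span: "m < n \<Longrightarrow> \<exists>c. \<forall>z. cheb_lagrange n m z = (\<Sum>k<n. c k * cheb k z)"
proof -
  assume m: "m < n"
  obtain c where c: "\<And>z::complex. (\<Prod>b\<in>{..<n} - {m}. z - cheb_node n b) = (\<Sum>k\<le>card ({..<n} - {m}). c k * cheb k z)"
    using cheb_span_prod[of "{..<n} - {m}" "\<lambda>b. of_real (cheb_node n b)"] by auto
  have s: "{..card ({..<n} - {m})} = {..<n}" using m by (auto simp: card_Diff_singleton)
  show ?thesis
    by (rule exI[of _ "\<lambda>k. c k / (\<Prod>b\<in>{..<n} - {m}. (cheb_node n m - cheb_node n b))"])
       (simp add: cheb_lagrange_def prod_dividef c s sum_divide_distrib)
qed

theorem cheb_interpolation:
  assumes \<rho>: "1 < \<rho>" "\<rho> < \<sigma>" and "0 < \<epsilon>" "0 \<le> B"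
  shows "\<exists>n. \<forall>f. f holomorphic_on ell \<sigma> \<longrightarrow> (\<forall>z\<in>ell \<sigma>. cmod (f z) \<le> B) \<longrightarrow>
    (\<forall>z\<in>cell \<rho>. cmod (f z - (\<Sum>m<n. f (of_real (cheb_node n m)) * cheb_lagrange n m z)) \<le> \<epsilon>)"
proof -
  obtain \<tau> where \<tau>: "\<rho> < \<tau>" "\<tau> < \<sigma>" using dense[OF \<rho>(2)] by auto
  define d where "d = (\<tau> - \<rho>) * (1 - 1 / \<tau>) / 2"
  have d0: "0 < d" using \<rho> \<tau> by (simp add: d_def)
  have "(\<lambda>n. B * (2 * \<rho> ^ n / (\<tau> ^ n - 1)) / d * (2 * pi * \<tau>)) \<longlonglongrightarrow> B * 0 / d * (2 * pi * \<tau>)"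
  proof (intro tendsto_intros)
    have "(\<lambda>n. 2 * (\<rho> / \<tau>) ^ n / (1 - (1 / \<tau>) ^ n)) \<longlonglongrightarrow> 2 * 0 / (1 - 0)"
      using \<rho> \<tau> by (intro tendsto_intros LIMSEQ_realpow_zero) auto
    moreover have "2 * (\<rho> / \<tau>) ^ n / (1 - (1 / \<tau>) ^ n) = 2 * \<rho> ^ n / (\<tau> ^ n - 1)" for n
    proof -
      have "\<tau> ^ n \<noteq> 0" using \<rho> \<tau> by simp
      then have "2 * (\<rho> / \<tau>) ^ n / (1 - (1 / \<tau>) ^ n) = (2 * (\<rho> / \<tau>) ^ n * \<tau> ^ n) / ((1 - (1 / \<tau>) ^ n) * \<tau> ^ n)" by simp
      also have "\<dots> = 2 * \<rho> ^ n / (\<tau> ^ n - 1)"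
        using \<open>\<tau> ^ n \<noteq> 0\<close> by (simp add: power_divide left_diff_distrib)
      finally show ?thesis .
    qed
    ultimately show "(\<lambda>n. 2 * \<rho> ^ n / (\<tau> ^ n - 1)) \<longlonglongrightarrow> 0" by simp
  qed (use d0 in auto)
  then have "eventually (\<lambda>n. B * (2 * \<rho> ^ n / (\<tau> ^ n - 1)) / d * (2 * pi * \<tau>) < 2 * pi * \<epsilon>) sequentially"
    by (rule order_tendstoD) (use assms in simp)
  then have "eventually (\<lambda>n. B * (2 * \<rho> ^ n / (\<tau> ^ n - 1)) / d * (2 * pi * \<tau>) < 2 * pi * \<epsilon> \<and> 0 < n) sequentially"
    by (intro eventually_conj eventually_gt_at_top)
  then obtain n where n: "B * (2 * \<rho> ^ n / (\<tau> ^ n - 1)) / d * (2 * pi * \<tau>) < 2 * pi * \<epsilon>" "0 < n"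
    by (auto simp: eventually_sequentially)
  define x where "x = (\<lambda>m. complex_of_real (cheb_node n m))"
  define w where "w = (\<lambda>z. \<Prod>m<n. z - x m)"
  have w: "cheb n z = 2 ^ (n - 1) * w z" for z
    using cheb_factor[of "n - 1" z] n(2) by (simp add: w_def x_def del: cheb.simps)
  have xinj: "inj_on x {..<n}" using cheb_node_inj[of n] by (auto simp: inj_on_def x_def)
  have "cmod (f z - (\<Sum>m<n. f (x m) * cheb_lagrange n m z)) \<le> \<epsilon>"
    if hol: "f holomorphic_on ell \<sigma>" and fB: "\<And>z. z \<in> ell \<sigma> \<Longrightarrow> cmod (f z) \<le> B" and z: "z \<in> cell \<rho>" for f z
  proof -
    have t0: "0 < \<tau>" using \<rho> \<tau> by simp
    obtain v where v: "1 \<le> cmod v" "cmod v \<le> \<rho>" "z = jouk v" using z by (auto simp: cell_def)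
    have cf: "((\<lambda>\<zeta>. f \<zeta> / (\<zeta> - y)) has_contour_integral 2 * of_real pi * \<i> * f y) (jouk_path \<tau>)"
      and yn: "y \<notin> path_image (jouk_path \<tau>)"
      if y: "y \<in> cell \<rho>" for y
    proof -
      obtain v where v: "1 \<le> cmod v" "cmod v \<le> \<rho>" "y = jouk v" using y by (auto simp: cell_def)
      have wn: "winding_number (jouk_path \<tau>) y = 1" and nin: "y \<notin> path_image (jouk_path \<tau>)"
        using winding_number_jouk_path[of v \<tau>] v \<tau> by auto
      show "y \<notin> path_image (jouk_path \<tau>)" by fact
      have sub: "path_image (jouk_path \<tau>) \<subseteq> ell \<sigma>"
        unfolding jouk_path_props(3)[OF t0] using \<rho> \<tau> by (auto intro!: jouk_in_ell)
      have "y \<in> interior (ell \<sigma>)"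
        using cell_subset_ell[OF \<rho>(2)] y by (auto simp: interior_open[OF open_ell])
      from Cauchy_integral_formula_convex_simple[OF convex_ell hol this jouk_path_props(1)[OF t0] _ jouk_path_props(2)[OF t0]]
      show "((\<lambda>\<zeta>. f \<zeta> / (\<zeta> - y)) has_contour_integral 2 * of_real pi * \<i> * f y) (jouk_path \<tau>)"
        using wn sub nin by auto
    qed
    have xc: "x m \<in> cell \<rho>" for m
      unfolding x_def using cheb_node_bounds \<rho> by (intro of_real_in_cell) auto
    have "((\<lambda>\<zeta>. f \<zeta> / (\<zeta> - z) - (\<Sum>m<n. cheb_lagrange n m z * (f \<zeta> / (\<zeta> - x m)))) has_contour_integral
        2 * of_real pi * \<i> * f z - (\<Sum>m<n. cheb_lagrange n m z * (2 * of_real pi * \<i> * f (x m)))) (jouk_path \<tau>)"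
      by (intro has_contour_integral_diff has_contour_integral_sum has_contour_integral_lmul cf xc z) auto
    then have "cmod (2 * of_real pi * \<i> * f z - (\<Sum>m<n. cheb_lagrange n m z * (2 * of_real pi * \<i> * f (x m))))
       \<le> B * (2 * \<rho> ^ n / (\<tau> ^ n - 1)) / d * (2 * pi * \<tau>)"
    proof (rule has_contour_integral_jouk_path_bound[rotated])
      show "1 \<le> \<tau>" using \<rho> \<tau> by simp
      have tn: "1 < \<tau> ^ n" using \<rho> \<tau> n by (intro one_less_power) auto
      then show "0 \<le> B * (2 * \<rho> ^ n / (\<tau> ^ n - 1)) / d" using assms d0 by simp
      fix u :: complex assume u: "cmod u = \<tau>"
      have u0: "u \<noteq> 0" and v0: "v \<noteq> 0" using u \<rho> \<tau> v by auto
      define \<zeta> where "\<zeta> = jouk u"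
      have zi: "\<zeta> \<in> path_image (jouk_path \<tau>)" unfolding jouk_path_props(3)[OF t0] using u by (auto simp: \<zeta>_def)
      have zne: "\<zeta> \<noteq> z" "\<zeta> \<notin> x ` {..<n}" using yn[OF z] yn[OF xc] zi by auto
      have "(\<Sum>m<n. cheb_lagrange n m z * (f \<zeta> / (\<zeta> - x m))) = f \<zeta> * (\<Sum>m<n. cheb_lagrange n m z / (\<zeta> - x m))"
        by (simp add: sum_distrib_left mult_ac)
      also have "(\<Sum>m<n. cheb_lagrange n m z / (\<zeta> - x m)) = (1 - w z / w \<zeta>) / (\<zeta> - z)"
        using lagrange_remainder[OF _ xinj zne(2,1)] by (simp add: cheb_lagrange_def x_def w_def)
      finally have "f \<zeta> / (\<zeta> - z) - (\<Sum>m<n. cheb_lagrange n m z * (f \<zeta> / (\<zeta> - x m))) = f \<zeta> * (w z / w \<zeta>) / (\<zeta> - z)"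
        using zne by (simp add: diff_divide_distrib algebra_simps)
      moreover have "cmod (f \<zeta> * (w z / w \<zeta>) / (\<zeta> - z)) \<le> B * (2 * \<rho> ^ n / (\<tau> ^ n - 1)) / d"
        unfolding norm_mult norm_divide
      proof -
        have f1: "cmod (f \<zeta>) \<le> B"
          unfolding \<zeta>_def using u \<rho> \<tau> by (intro fB jouk_in_ell) auto
        have ww: "w z / w \<zeta> = cheb n z / cheb n \<zeta>" unfolding w by simp
        have "cmod (cheb n z) \<le> \<rho> ^ n"
        proof -
          have "cmod (cheb n z) \<le> (cmod v ^ n + inverse (cmod v) ^ n) / 2"
            unfolding v(3) cheb_jouk[OF v0] using norm_triangle_ineq[of "v ^ n" "inverse v ^ n"]
            by (simp add: norm_divide norm_power norm_inverse)
          also have "inverse (cmod v) ^ n \<le> 1" using v by (intro power_le_one) (auto simp: inverse_le_1_iff)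
          then have "inverse (cmod v) ^ n \<le> cmod v ^ n" using one_le_power[OF v(1), of n] by linarith
          then have "(cmod v ^ n + inverse (cmod v) ^ n) / 2 \<le> cmod v ^ n" by simp
          also have "cmod v ^ n \<le> \<rho> ^ n" using v by (intro power_mono) auto
          finally show ?thesis .
        qed
        moreover have "(\<tau> ^ n - 1) / 2 \<le> cmod (cheb n \<zeta>)"
        proof -
          have "cmod (u ^ n) - cmod (inverse u ^ n) \<le> cmod (u ^ n + inverse u ^ n)"
            by (metis add.commute norm_diff_ineq)
          moreover have "cmod (inverse u ^ n) \<le> 1"
            unfolding norm_power norm_inverse using u \<rho> \<tau> by (intro power_le_one) (auto simp: inverse_le_1_iff)
          ultimately show ?thesis unfolding \<zeta>_def cheb_jouk[OF u0] using u
            by (simp add: norm_divide norm_power)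
        qed
        ultimately have "cmod (cheb n z) / cmod (cheb n \<zeta>) \<le> \<rho> ^ n / ((\<tau> ^ n - 1) / 2)"
          using tn \<rho> by (intro frac_le) auto
        then have q1: "cmod (w z) / cmod (w \<zeta>) \<le> 2 * \<rho> ^ n / (\<tau> ^ n - 1)"
          unfolding norm_divide[symmetric] ww by (simp add: mult.commute)
        have d1: "d \<le> cmod (\<zeta> - z)"
        proof -
          have "\<tau> - \<rho> \<le> cmod (u - v)" using norm_triangle_ineq2[of u v] u v by linarith
          moreover have "1 - 1 / \<tau> \<le> cmod (1 - inverse (u * v))"
          proof -
            have "cmod (inverse (u * v)) \<le> 1 / \<tau>"
            proof -
              have "cmod (inverse (u * v)) = 1 / (\<tau> * cmod v)"
                by (simp add: norm_inverse norm_mult u inverse_eq_divide norm_divide)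
              also have "\<dots> \<le> 1 / \<tau>" using v t0 v0 by (intro divide_left_mono) auto
              finally show ?thesis .
            qed
            then show ?thesis using norm_triangle_ineq2[of 1 "inverse (u * v)"] by simp
          qed
          ultimately show ?thesis unfolding \<zeta>_def v(3) jouk_diff[OF u0 v0] d_def norm_divide norm_mult
            using \<tau> \<rho> by (simp add: mult_mono)
        qed
        show "cmod (f \<zeta>) * (cmod (w z) / cmod (w \<zeta>)) / cmod (\<zeta> - z) \<le> B * (2 * \<rho> ^ n / (\<tau> ^ n - 1)) / d"
          by (rule frac_le[OF _ mult_mono[OF f1 q1] d0 d1]) (use assms d0 tn in auto)
      qed
      ultimately show "cmod (f (jouk u) / (jouk u - z) - (\<Sum>m<n. cheb_lagrange n m z * (f (jouk u) / (jouk u - x m))))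
         \<le> B * (2 * \<rho> ^ n / (\<tau> ^ n - 1)) / d"
        by (simp add: \<zeta>_def)
    qed
    also have "2 * of_real pi * \<i> * f z - (\<Sum>m<n. cheb_lagrange n m z * (2 * of_real pi * \<i> * f (x m)))
       = 2 * of_real pi * \<i> * (f z - (\<Sum>m<n. f (x m) * cheb_lagrange n m z))"
      by (simp add: right_diff_distrib sum_distrib_left mult_ac)
    finally have "cmod (2 * of_real pi * \<i> * (f z - (\<Sum>m<n. f (x m) * cheb_lagrange n m z))) < 2 * pi * \<epsilon>"
      using n(1) by (rule order_le_less_trans)
    then show ?thesis by (simp add: norm_mult)
  qed
  then show ?thesis unfolding x_def by blast
qed

subsection \<open>Tensor product interpolation\<close>

lemma sum_PiE_Suc:
  fixes F :: "(nat \<Rightarrow> 'b) \<Rightarrow> 'c::comm_monoid_add"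
  shows "(\<Sum>\<kappa>\<in>PiE {..<Suc d} (\<lambda>_. S). F \<kappa>) = (\<Sum>\<kappa>\<in>PiE {..<d} (\<lambda>_. S). \<Sum>k\<in>S. F (\<kappa>(d := k)))"
proof -
  have "(\<Sum>\<kappa>\<in>PiE {..<Suc d} (\<lambda>_. S). F \<kappa>) = (\<Sum>(k, \<kappa>)\<in>S \<times> PiE {..<d} (\<lambda>_. S). F (\<kappa>(d := k)))"
    unfolding lessThan_Suc PiE_insert_eq
    using inj_combinator[of d "{..<d}" "\<lambda>_. S"]
    by (subst sum.reindex) (auto simp: case_prod_unfold)
  also have "\<dots> = (\<Sum>k\<in>S. \<Sum>\<kappa>\<in>PiE {..<d} (\<lambda>_. S). F (\<kappa>(d := k)))"
    by (simp add: sum.cartesian_product)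
  finally show ?thesis by (subst sum.swap) simp
qed

lemma cell_norm_bound: "z \<in> cell \<rho> \<Longrightarrow> cmod z \<le> \<rho>"
proof -
  assume "z \<in> cell \<rho>"
  then obtain v where v: "1 \<le> cmod v" "cmod v \<le> \<rho>" "z = jouk v" by (auto simp: cell_def)
  have "cmod (v + inverse v) \<le> cmod v + inverse (cmod v)"
    using norm_triangle_ineq[of v "inverse v"] by (simp add: norm_inverse)
  also have "inverse (cmod v) \<le> cmod v" using v by (metis inverse_le_1_iff order_trans)
  finally show ?thesis unfolding v(3) jouk_def norm_divide using v(2) by simp
qed

lemma cheb_lagrange_bound:
  "\<exists>L\<ge>0. \<forall>z\<in>cell \<rho>. cmod (cheb_lagrange n m z) \<le> L"
proof (intro exI conjI ballI)
  let ?L = "\<Prod>b\<in>{..<n} - {m}. (\<bar>\<rho>\<bar> + 1) / cmod (cheb_node n m - cheb_node n b)"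
  show "0 \<le> ?L" by (intro prod_nonneg) auto
  fix z assume z: "z \<in> cell \<rho>"
  show "cmod (cheb_lagrange n m z) \<le> ?L"
    unfolding cheb_lagrange_def prod_norm[symmetric]
  proof (intro prod_mono conjI norm_ge_zero)
    fix b
    have "cmod (z - cheb_node n b) \<le> \<bar>\<rho>\<bar> + 1"
      using norm_triangle_ineq4[of z "cheb_node n b"] cell_norm_bound[OF z] cheb_node_bounds[of n b] by simp
    then show "cmod ((z - cheb_node n b) / (cheb_node n m - cheb_node n b)) \<le> (\<bar>\<rho>\<bar> + 1) / cmod (cheb_node n m - cheb_node n b)"
      by (simp add: norm_divide divide_right_mono)
  qed
qed

definition polyell :: "(nat \<Rightarrow> real) \<Rightarrow> nat \<Rightarrow> (nat \<Rightarrow> complex) set" where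
  "polyell \<sigma> d = {z. (\<forall>i<d. z i \<in> ell (\<sigma> i)) \<and> (\<forall>i\<ge>d. z i = 0)}"

definition polycell :: "(nat \<Rightarrow> real) \<Rightarrow> nat \<Rightarrow> (nat \<Rightarrow> complex) set" where
  "polycell \<rho> d = {z. (\<forall>i<d. z i \<in> cell (\<rho> i)) \<and> (\<forall>i\<ge>d. z i = 0)}"

theorem cheb_tensor_approx:
  fixes f :: "(nat \<Rightarrow> complex) \<Rightarrow> complex"
  assumes \<rho>: "\<And>i. 1 < \<rho> i" "\<And>i. \<rho> i < \<sigma> i"
    and "0 \<le> B" "\<And>z. z \<in> polyell \<sigma> d \<Longrightarrow> cmod (f z) \<le> B"
    and "\<And>z i. z \<in> polyell \<sigma> d \<Longrightarrow> i < d \<Longrightarrow> (\<lambda>x. f (z(i := x))) holomorphic_on ell (\<sigma> i)"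
    and "0 < \<epsilon>"
  shows "\<exists>n0. \<forall>n\<ge>n0. \<exists>c. \<forall>z\<in>polycell \<rho> d.
    cmod (f z - (\<Sum>\<kappa>\<in>PiE {..<d} (\<lambda>_. {..n}). c \<kappa> * (\<Prod>i<d. cheb (\<kappa> i) (z i)))) \<le> \<epsilon>"
  using assms(3-)
proof (induction d arbitrary: f \<epsilon>)
  case 0
  have "polycell \<rho> 0 = {\<lambda>_. 0}" by (auto simp: polycell_def)
  then show ?case using 0 by (intro exI[of _ 0] allI impI exI[of _ "\<lambda>_. f (\<lambda>_. 0)"]) simp
next
  case (Suc d)
  obtain N where N: "\<And>f. f holomorphic_on ell (\<sigma> d) \<Longrightarrow> (\<And>z. z \<in> ell (\<sigma> d) \<Longrightarrow> cmod (f z) \<le> B) \<Longrightarrow>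
    (\<forall>z\<in>cell (\<rho> d). cmod (f z - (\<Sum>m<N. f (of_real (cheb_node N m)) * cheb_lagrange N m z)) \<le> \<epsilon> / 2)"
    using cheb_interpolation[OF \<rho>(1) \<rho>(2), of "\<epsilon> / 2" B d] Suc.prems by force
  let ?x = "\<lambda>m. complex_of_real (cheb_node N m)"
  have "\<forall>m. \<exists>L\<ge>0. \<forall>z\<in>cell (\<rho> d). cmod (cheb_lagrange N m z) \<le> L"
    using cheb_lagrange_bound by blast
  then obtain L where L: "\<And>m. 0 \<le> L m" "\<And>m z. z \<in> cell (\<rho> d) \<Longrightarrow> cmod (cheb_lagrange N m z) \<le> L m"
    by (metis (no_types))
  have "\<forall>m. \<exists>l. m < N \<longrightarrow> (\<forall>z. cheb_lagrange N m z = (\<Sum>k<N. l k * cheb k z))"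
    using cheb_lagrange_span by blast
  from choice[OF this] obtain l where l: "\<And>m z. m < N \<Longrightarrow> cheb_lagrange N m z = (\<Sum>k<N. l m k * cheb k z)"
    by auto
  define e where "e = \<epsilon> / (2 * (1 + (\<Sum>m<N. L m)))"
  have sL: "0 \<le> (\<Sum>m<N. L m)" using L by (intro sum_nonneg) auto
  then have e0: "0 < e" using Suc.prems by (simp add: e_def)
  have xe: "?x m \<in> ell (\<sigma> i)" for m i
    using of_real_in_cell[of "cheb_node N m" "\<rho> i"] cell_subset_ell[OF \<rho>(2)[of i]] cheb_node_bounds[of N m] \<rho>(1)[of i]
    by auto
  have up: "z(d := x) \<in> polyell \<sigma> (Suc d)" if "z \<in> polyell \<sigma> d" "x \<in> ell (\<sigma> d)" for z x
    using that by (auto simp: polyell_def less_Suc_eq)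
  have "\<exists>n0. \<forall>n\<ge>n0. \<exists>c. \<forall>z\<in>polycell \<rho> d.
    cmod (f (z(d := ?x m)) - (\<Sum>\<kappa>\<in>PiE {..<d} (\<lambda>_. {..n}). c \<kappa> * (\<Prod>i<d. cheb (\<kappa> i) (z i)))) \<le> e" for m
  proof (rule Suc.IH)
    show "0 \<le> B" "0 < e" by fact+
    show "cmod (f (z(d := ?x m))) \<le> B" if "z \<in> polyell \<sigma> d" for z
      using up[OF that xe] by (rule Suc.prems)
    show "(\<lambda>x. f ((z(i := x))(d := ?x m))) holomorphic_on ell (\<sigma> i)" if "z \<in> polyell \<sigma> d" "i < d" for z i
    proof -
      have "(z(i := x))(d := ?x m) = (z(d := ?x m))(i := x)" for x using that(2) by (auto simp: fun_eq_iff)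
      then show ?thesis using Suc.prems(3)[OF up[OF that(1) xe[of m]], of i] that(2) by (simp only: less_SucI)
    qed
  qed
  then have "\<forall>m. \<exists>n0. \<forall>n\<ge>n0. \<exists>c. \<forall>z\<in>polycell \<rho> d.
    cmod (f (z(d := ?x m)) - (\<Sum>\<kappa>\<in>PiE {..<d} (\<lambda>_. {..n}). c \<kappa> * (\<Prod>i<d. cheb (\<kappa> i) (z i)))) \<le> e" by blast
  from choice[OF this] obtain n0 where n0: "\<And>m n. n0 m \<le> n \<Longrightarrow> \<exists>c. \<forall>z\<in>polycell \<rho> d.
    cmod (f (z(d := ?x m)) - (\<Sum>\<kappa>\<in>PiE {..<d} (\<lambda>_. {..n}). c \<kappa> * (\<Prod>i<d. cheb (\<kappa> i) (z i)))) \<le> e" by blast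
  show ?case
  proof (intro exI[of _ "N + (\<Sum>m<N. n0 m)"] allI impI)
    fix n assume n: "N + (\<Sum>m<N. n0 m) \<le> n"
    have "n0 m \<le> n" if "m < N" for m
      using member_le_sum[of m "{..<N}" n0] that n by simp
    then have "\<forall>m. \<exists>c. m < N \<longrightarrow> (\<forall>z\<in>polycell \<rho> d.
      cmod (f (z(d := ?x m)) - (\<Sum>\<kappa>\<in>PiE {..<d} (\<lambda>_. {..n}). c \<kappa> * (\<Prod>i<d. cheb (\<kappa> i) (z i)))) \<le> e)"
      using n0 by blast
    from choice[OF this] obtain c where c: "\<And>m z. m < N \<Longrightarrow> z \<in> polycell \<rho> d \<Longrightarrow>
      cmod (f (z(d := ?x m)) - (\<Sum>\<kappa>\<in>PiE {..<d} (\<lambda>_. {..n}). c m \<kappa> * (\<Prod>i<d. cheb (\<kappa> i) (z i)))) \<le> e"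
      by blast
    define C where "C = (\<lambda>\<kappa>. \<Sum>m<N. c m (\<kappa>(d := undefined)) * (if \<kappa> d < N then l m (\<kappa> d) else 0))"
    show "\<exists>c. \<forall>z\<in>polycell \<rho> (Suc d).
      cmod (f z - (\<Sum>\<kappa>\<in>PiE {..<Suc d} (\<lambda>_. {..n}). c \<kappa> * (\<Prod>i<Suc d. cheb (\<kappa> i) (z i)))) \<le> \<epsilon>"
    proof (intro exI[of _ C] ballI)
      fix z assume z: "z \<in> polycell \<rho> (Suc d)"
      define z' where "z' = z(d := 0)"
      have z': "z' \<in> polycell \<rho> d" using z by (auto simp: z'_def polycell_def)
      have zd: "z d \<in> cell (\<rho> d)" using z by (auto simp: polycell_def)
      have zc: "z \<in> polyell \<sigma> (Suc d)"
        using z cell_subset_ell[OF \<rho>(2)] unfolding polycell_def polyell_def by blast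
      let ?P = "\<lambda>m. \<Sum>\<kappa>\<in>PiE {..<d} (\<lambda>_. {..n}). c m \<kappa> * (\<Prod>i<d. cheb (\<kappa> i) (z' i))"
      have upz: "z(d := x) = z'(d := x)" for x by (simp add: z'_def)
      have 1: "cmod (f z - (\<Sum>m<N. f (z(d := ?x m)) * cheb_lagrange N m (z d))) \<le> \<epsilon> / 2"
      proof -
        have "\<forall>y\<in>cell (\<rho> d). cmod (f (z(d := y)) - (\<Sum>m<N. f (z(d := ?x m)) * cheb_lagrange N m y)) \<le> \<epsilon> / 2"
        proof (rule N)
          show "(\<lambda>x. f (z(d := x))) holomorphic_on ell (\<sigma> d)" by (rule Suc.prems(3)[OF zc]) simp
          show "cmod (f (z(d := y))) \<le> B" if "y \<in> ell (\<sigma> d)" for y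
            using zc that by (intro Suc.prems(2)) (auto simp: polyell_def)
        qed
        from bspec[OF this zd] show ?thesis by simp
      qed
      have 2: "cmod ((\<Sum>m<N. f (z(d := ?x m)) * cheb_lagrange N m (z d)) - (\<Sum>m<N. ?P m * cheb_lagrange N m (z d))) \<le> \<epsilon> / 2"
      proof -
        have "cmod ((\<Sum>m<N. f (z(d := ?x m)) * cheb_lagrange N m (z d)) - (\<Sum>m<N. ?P m * cheb_lagrange N m (z d)))
          \<le> (\<Sum>m<N. cmod ((f (z(d := ?x m)) - ?P m) * cheb_lagrange N m (z d)))"
          unfolding sum_subtractf[symmetric] left_diff_distrib[symmetric] by (rule norm_sum)
        also have "\<dots> \<le> (\<Sum>m<N. e * L m)"
          unfolding norm_mult using c[OF _ z'] L zd e0 by (intro sum_mono mult_mono) (auto simp: upz)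
        also have "\<dots> = e * (\<Sum>m<N. L m)" by (simp add: sum_distrib_left)
        also have "\<dots> \<le> e * (1 + (\<Sum>m<N. L m))" using e0 by simp
        also have "\<dots> = \<epsilon> / 2"
        proof -
          have "1 + (\<Sum>m<N. L m) \<noteq> 0" using sL by linarith
          then show ?thesis unfolding e_def by (simp only: times_divide_eq_left nonzero_mult_divide_mult_cancel_right simp_thms)
        qed
        finally show ?thesis .
      qed
      have 3: "(\<Sum>m<N. ?P m * cheb_lagrange N m (z d)) = (\<Sum>\<kappa>\<in>PiE {..<Suc d} (\<lambda>_. {..n}). C \<kappa> * (\<Prod>i<Suc d. cheb (\<kappa> i) (z i)))"
      proof -
        have "(\<Sum>\<kappa>\<in>PiE {..<Suc d} (\<lambda>_. {..n}). C \<kappa> * (\<Prod>i<Suc d. cheb (\<kappa> i) (z i)))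
            = (\<Sum>\<kappa>\<in>PiE {..<d} (\<lambda>_. {..n}). \<Sum>k\<le>n. (\<Sum>m<N. c m \<kappa> * (if k < N then l m k else 0)) * ((\<Prod>i<d. cheb (\<kappa> i) (z i)) * cheb k (z d)))"
          unfolding sum_PiE_Suc
        proof (intro sum.cong refl)
          fix \<kappa> k assume k: "\<kappa> \<in> PiE {..<d} (\<lambda>_. {..n})"
          then have "\<kappa>(d := undefined) = \<kappa>" by (auto simp: PiE_def extensional_def)
          then show "C (\<kappa>(d := k)) * (\<Prod>i<Suc d. cheb ((\<kappa>(d := k)) i) (z i)) =
              (\<Sum>m<N. c m \<kappa> * (if k < N then l m k else 0)) * ((\<Prod>i<d. cheb (\<kappa> i) (z i)) * cheb k (z d))"
            by (simp add: C_def cong: if_cong)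
        qed
        also have "\<dots> = (\<Sum>\<kappa>\<in>PiE {..<d} (\<lambda>_. {..n}). \<Sum>m<N. c m \<kappa> * (\<Prod>i<d. cheb (\<kappa> i) (z i)) * (\<Sum>k\<le>n. (if k < N then l m k else 0) * cheb k (z d)))"
          unfolding sum_distrib_right sum_distrib_left
          by (rule sum.cong[OF refl], subst sum.swap) (simp add: mult_ac)
        also have "\<dots> = (\<Sum>\<kappa>\<in>PiE {..<d} (\<lambda>_. {..n}). \<Sum>m<N. c m \<kappa> * (\<Prod>i<d. cheb (\<kappa> i) (z i)) * cheb_lagrange N m (z d))"
        proof (intro sum.cong refl arg_cong2[of _ _ _ _ "(*)"])
          fix m assume m: "m \<in> {..<N}"
          have "{..<N} \<subseteq> {..n}" using n by auto
          then show "(\<Sum>k\<le>n. (if k < N then l m k else 0) * cheb k (z d)) = cheb_lagrange N m (z d)"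
            using m by (subst l) (auto intro!: sum.mono_neutral_cong_right split: if_splits)
        qed
        also have "\<dots> = (\<Sum>m<N. ?P m * cheb_lagrange N m (z d))"
          by (subst sum.swap) (simp add: sum_distrib_right z'_def)
        finally show ?thesis by simp
      qed
      show "cmod (f z - (\<Sum>\<kappa>\<in>PiE {..<Suc d} (\<lambda>_. {..n}). C \<kappa> * (\<Prod>i<Suc d. cheb (\<kappa> i) (z i)))) \<le> \<epsilon>"
        using norm_triangle_ineq[of "f z - (\<Sum>m<N. f (z(d := ?x m)) * cheb_lagrange N m (z d))"
            "(\<Sum>m<N. f (z(d := ?x m)) * cheb_lagrange N m (z d)) - (\<Sum>m<N. ?P m * cheb_lagrange N m (z d))"] 1 2
        unfolding 3 by simp
    qed
  qed
qed

subsection \<open>Discrete Parseval identity on a polyellipse\<close>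

definition ell_weight :: "real \<Rightarrow> nat \<Rightarrow> real" where
  "ell_weight \<rho> k = (if k = 0 then 1 else (\<rho> ^ (2 * k) + inverse \<rho> ^ (2 * k)) / 4)"

lemma sum_cis_roots:
  fixes j :: int
  assumes "0 < Q" "\<bar>j\<bar> < int Q"
  shows "(\<Sum>m<Q. cis (2 * pi * real m * of_int j / real Q)) = (if j = 0 then of_nat Q else 0)"
proof (cases "j = 0")
  case False
  define q where "q = cis (2 * pi * of_int j / real Q)"
  have "q \<noteq> 1"
  proof
    assume "q = 1"
    then have "cos (2 * pi * of_int j / real Q) = 1" by (simp add: q_def complex_eq_iff)
    then obtain n :: int where "2 * pi * of_int j / real Q = of_int n * 2 * pi"
      using cos_one_2pi_int[of "2 * pi * of_int j / real Q"] by auto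
    then have "real_of_int j = of_int n * real Q" using assms by (simp add: field_simps)
    then have "j = n * int Q" by (metis of_int_eq_iff of_int_mult of_int_of_nat_eq)
    then have "\<bar>j\<bar> = \<bar>n\<bar> * int Q" by (simp add: abs_mult)
    moreover have "\<bar>n\<bar> \<ge> 1" using False \<open>j = n * int Q\<close> by auto
    ultimately show False using assms by (simp add: mult_le_cancel_right2 flip: not_less)
  qed
  have "cis (2 * pi * real m * of_int j / real Q) = q ^ m" for m
    by (simp add: q_def Complex.DeMoivre mult_ac)
  moreover have "q ^ Q = 1"
  proof -
    have "q ^ Q = cis (2 * pi * of_int j)" using assms by (simp add: q_def Complex.DeMoivre)
    then show ?thesis by (simp add: cis_multiple_2pi)
  qed
  ultimately show ?thesis using False \<open>q \<noteq> 1\<close> by (simp add: geometric_sum)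
qed simp

lemma cheb_discrete_orthogonality:
  assumes "0 < \<rho>" "k \<le> n" "l \<le> n"
  defines "Q \<equiv> 2 * n + 1"
  defines "t \<equiv> \<lambda>k m. cheb k (jouk (of_real \<rho> * cis (2 * pi * real m / real Q)))"
  shows "(\<Sum>m<Q. t k m * cnj (t l m)) = (if k = l then of_real (real Q * ell_weight \<rho> k) else 0)"
proof -
  let ?c = "\<lambda>j m. cis (2 * pi * real m * of_int j / real Q)"
  let ?r = "of_real \<rho> :: complex"
  have pw: "(of_real \<rho> * cis (2 * pi * real m / real Q)) ^ k = ?r ^ k * ?c (int k) m" for k m
    by (simp add: power_mult_distrib Complex.DeMoivre mult_ac)
  have ipw: "inverse (of_real \<rho> * cis (2 * pi * real m / real Q)) ^ k = inverse ?r ^ k * ?c (- int k) m" for k m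
    by (simp add: power_mult_distrib Complex.DeMoivre cis_inverse mult_ac)
  have t: "t k m = (?r ^ k * ?c (int k) m + inverse ?r ^ k * ?c (- int k) m) / 2" for k m
    unfolding t_def by (subst cheb_jouk) (use assms(1) in \<open>simp_all only: pw ipw, simp\<close>)
  have tc: "cnj (t k m) = (?r ^ k * ?c (- int k) m + inverse ?r ^ k * ?c (int k) m) / 2" for k m
    unfolding t by (simp add: cis_cnj)
  have cc: "?c a m * ?c b m = ?c (a + b) m" for a b m
    by (simp add: cis_mult add_divide_distrib distrib_left)
  have "t k m * cnj (t l m) = (?r ^ k * ?r ^ l * ?c (int k - int l) m + ?r ^ k * inverse ?r ^ l * ?c (int k + int l) m
      + inverse ?r ^ k * ?r ^ l * ?c (- int k - int l) m + inverse ?r ^ k * inverse ?r ^ l * ?c (int l - int k) m) / 4" for m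
  proof -
    have e: "(a * p + b * q) / 2 * ((a' * p' + b' * q') / 2) = (a * a' * (p * p') + a * b' * (p * q') + b * a' * (q * p') + b * b' * (q * q')) / 4"
      for a b a' b' p q p' q' :: complex by (simp add: field_simps)
    show ?thesis unfolding t tc[unfolded t] unfolding tc e cc by simp
  qed
  then have "(\<Sum>m<Q. t k m * cnj (t l m)) = (?r ^ k * ?r ^ l * (\<Sum>m<Q. ?c (int k - int l) m) + ?r ^ k * inverse ?r ^ l * (\<Sum>m<Q. ?c (int k + int l) m)
      + inverse ?r ^ k * ?r ^ l * (\<Sum>m<Q. ?c (- int k - int l) m) + inverse ?r ^ k * inverse ?r ^ l * (\<Sum>m<Q. ?c (int l - int k) m)) / 4"
    by (simp only: sum_divide_distrib[symmetric] sum.distrib sum_distrib_left)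
  moreover have "0 < Q" "\<bar>int k - int l\<bar> < int Q" "\<bar>int k + int l\<bar> < int Q" "\<bar>- int k - int l\<bar> < int Q" "\<bar>int l - int k\<bar> < int Q"
    using assms(2,3) by (auto simp: Q_def)
  ultimately have S: "(\<Sum>m<Q. t k m * cnj (t l m)) = (?r ^ k * ?r ^ l * (if int k - int l = 0 then of_nat Q else 0) + ?r ^ k * inverse ?r ^ l * (if int k + int l = 0 then of_nat Q else 0)
      + inverse ?r ^ k * ?r ^ l * (if - int k - int l = 0 then of_nat Q else 0) + inverse ?r ^ k * inverse ?r ^ l * (if int l - int k = 0 then of_nat Q else 0)) / 4"
    by (simp only: sum_cis_roots)
  show ?thesis
  proof (cases "k = l")
    case True
    show ?thesis
    proof (cases "k = 0")
      case False
      have "(?r ^ k * ?r ^ k * of_nat Q + inverse ?r ^ k * inverse ?r ^ k * of_nat Q) / 4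
        = of_real (real Q * ((\<rho> ^ (2 * k) + inverse \<rho> ^ (2 * k)) / 4))"
        unfolding mult_2 power_add by (simp add: distrib_left mult.commute)
      with True False show ?thesis unfolding S by (simp add: ell_weight_def)
    next
      case k0: True
      show ?thesis unfolding S using True k0 by (simp add: ell_weight_def)
    qed
  qed (auto simp: S)
qed

theorem cheb_discrete_parseval:
  fixes \<rho> :: "nat \<Rightarrow> real" and c :: "(nat \<Rightarrow> nat) \<Rightarrow> complex" and d n :: nat
  assumes "\<And>i. 0 < \<rho> i"
  defines "Q \<equiv> 2 * n + 1"
  defines "K \<equiv> PiE {..<d} (\<lambda>_. {..n})"
  defines "x \<equiv> \<lambda>m i. jouk (of_real (\<rho> i) * cis (2 * pi * real (m i) / real Q))"
  shows "(\<Sum>m\<in>PiE {..<d} (\<lambda>_. {..<Q}). (cmod (\<Sum>\<kappa>\<in>K. c \<kappa> * (\<Prod>i<d. cheb (\<kappa> i) (x m i))))\<^sup>2)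
    = real (Q ^ d) * (\<Sum>\<kappa>\<in>K. (cmod (c \<kappa>))\<^sup>2 * (\<Prod>i<d. ell_weight (\<rho> i) (\<kappa> i)))"
proof -
  let ?M = "PiE {..<d} (\<lambda>_. {..<Q})"
  let ?t = "\<lambda>i k m. cheb k (jouk (of_real (\<rho> i) * cis (2 * pi * real m / real Q)))"
  have finK: "finite K" unfolding K_def by (intro finite_PiE) auto
  have "complex_of_real (\<Sum>m\<in>?M. (cmod (\<Sum>\<kappa>\<in>K. c \<kappa> * (\<Prod>i<d. cheb (\<kappa> i) (x m i))))\<^sup>2)
     = (\<Sum>m\<in>?M. (\<Sum>\<kappa>\<in>K. c \<kappa> * (\<Prod>i<d. ?t i (\<kappa> i) (m i))) * cnj (\<Sum>\<kappa>\<in>K. c \<kappa> * (\<Prod>i<d. ?t i (\<kappa> i) (m i))))"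
    by (simp only: of_real_sum complex_norm_square x_def)
  also have "\<dots> = (\<Sum>m\<in>?M. \<Sum>\<kappa>\<in>K. \<Sum>\<kappa>'\<in>K. c \<kappa> * cnj (c \<kappa>') * (\<Prod>i<d. ?t i (\<kappa> i) (m i) * cnj (?t i (\<kappa>' i) (m i))))"
    unfolding cnj_sum sum_product
    by (intro sum.cong refl) (simp only: complex_cnj_mult cnj_prod prod.distrib mult_ac)
  also have "\<dots> = (\<Sum>\<kappa>\<in>K. \<Sum>\<kappa>'\<in>K. c \<kappa> * cnj (c \<kappa>') * (\<Sum>m\<in>?M. \<Prod>i<d. ?t i (\<kappa> i) (m i) * cnj (?t i (\<kappa>' i) (m i))))"
    unfolding sum_distrib_left by (subst sum.swap, rule sum.cong[OF refl], subst sum.swap) simp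
  also have "\<dots> = (\<Sum>\<kappa>\<in>K. \<Sum>\<kappa>'\<in>K. if \<kappa>' = \<kappa> then of_real ((cmod (c \<kappa>))\<^sup>2 * (real (Q ^ d) * (\<Prod>i<d. ell_weight (\<rho> i) (\<kappa> i)))) else 0)"
  proof (intro sum.cong refl)
    fix \<kappa> \<kappa>' assume k: "\<kappa> \<in> K" "\<kappa>' \<in> K"
    have "(\<Sum>m\<in>?M. \<Prod>i<d. ?t i (\<kappa> i) (m i) * cnj (?t i (\<kappa>' i) (m i))) = (\<Prod>i<d. \<Sum>m<Q. ?t i (\<kappa> i) m * cnj (?t i (\<kappa>' i) m))"
      by (subst prod_sum_PiE) auto
    also have "\<dots> = (\<Prod>i<d. if \<kappa> i = \<kappa>' i then of_real (real Q * ell_weight (\<rho> i) (\<kappa> i)) else 0)"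
      unfolding Q_def using k assms(1) by (intro prod.cong refl cheb_discrete_orthogonality) (auto simp: K_def)
    also have "\<dots> = (if \<kappa>' = \<kappa> then of_real (real (Q ^ d) * (\<Prod>i<d. ell_weight (\<rho> i) (\<kappa> i))) else 0)"
    proof (cases "\<kappa>' = \<kappa>")
      case False
      then obtain i where "i < d" "\<kappa> i \<noteq> \<kappa>' i" using k PiE_ext[of \<kappa> "{..<d}" "\<lambda>_. {..n}" \<kappa>'] unfolding K_def by auto
      then show ?thesis using False by (auto intro!: prod_zero bexI[of _ i])
    qed (simp add: prod.distrib)
    finally show "c \<kappa> * cnj (c \<kappa>') * (\<Sum>m\<in>?M. \<Prod>i<d. ?t i (\<kappa> i) (m i) * cnj (?t i (\<kappa>' i) (m i)))
        = (if \<kappa>' = \<kappa> then of_real ((cmod (c \<kappa>))\<^sup>2 * (real (Q ^ d) * (\<Prod>i<d. ell_weight (\<rho> i) (\<kappa> i)))) else 0)"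
      by (cases "\<kappa>' = \<kappa>") (simp_all only: complex_norm_square[symmetric] of_real_mult[symmetric] if_True if_False mult_zero_right simp_thms)
  qed
  also have "\<dots> = of_real (real (Q ^ d) * (\<Sum>\<kappa>\<in>K. (cmod (c \<kappa>))\<^sup>2 * (\<Prod>i<d. ell_weight (\<rho> i) (\<kappa> i))))"
  proof -
    have "(\<Sum>\<kappa>'\<in>K. if \<kappa>' = \<kappa> then F else 0) = F" if "\<kappa> \<in> K" for \<kappa> and F :: complex
      using that finK by simp
    then show ?thesis by (simp add: sum_distrib_left mult_ac cong: sum.cong)
  qed
  finally show ?thesis by (simp only: of_real_eq_iff)
qed

subsection \<open>Register programs and block diagonal networks\<close>

type_synonym register_layer = "nat \<Rightarrow> (nat \<times> real) list \<times> real"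

definition lin_form :: "(nat \<times> real) list \<Rightarrow> (nat \<Rightarrow> real) \<Rightarrow> real" where
  "lin_form r x = (\<Sum>(l, c)\<leftarrow>r. c * x l)"

definition lin_coef :: "(nat \<times> real) list \<Rightarrow> nat \<Rightarrow> real" where
  "lin_coef r k = (\<Sum>(l, c)\<leftarrow>r. if l = k then c else 0)"

definition run_layer :: "register_layer \<Rightarrow> (nat \<Rightarrow> real) \<Rightarrow> nat \<Rightarrow> real" where
  "run_layer L x i = max 0 (lin_form (fst (L i)) x + snd (L i))"

abbreviation run_program :: "register_layer list \<Rightarrow> (nat \<Rightarrow> real) \<Rightarrow> nat \<Rightarrow> real" where
  "run_program p \<equiv> fold run_layer p"

definition layer_wf :: "nat \<Rightarrow> register_layer \<Rightarrow> bool" where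
  "layer_wf D L \<longleftrightarrow> (\<forall>i<D. length (fst (L i)) \<le> 5 \<and> (\<forall>(l, c)\<in>set (fst (L i)). l < D))"

lemma lin_form_coef:
  assumes "\<forall>(l, c)\<in>set r. l < D"
  shows "(\<Sum>k<D. lin_coef r k * x k) = lin_form r x"
  using assms
proof (induction r)
  case (Cons a r)
  obtain l c where a: "a = (l, c)" by (cases a)
  have "(\<Sum>k<D. lin_coef (a # r) k * x k) = (\<Sum>k<D. (if l = k then c * x k else 0) + lin_coef r k * x k)"
    by (intro sum.cong) (auto simp: lin_coef_def a algebra_simps)
  also have "\<dots> = c * x l + lin_form r x"
    using Cons by (simp add: sum.distrib a)
  finally show ?case by (simp add: lin_form_def a)
qed (simp add: lin_coef_def lin_form_def)

lemma lin_coef_nonzero: "lin_coef r k \<noteq> 0 \<Longrightarrow> k \<in> fst ` set r"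
  by (induction r) (auto simp: lin_coef_def split: if_splits)

lemma finite_lin_coef: "finite {k. lin_coef r k \<noteq> 0}"
  by (rule finite_subset[of _ "fst ` set r"]) (auto dest: lin_coef_nonzero)

lemma card_lin_coef: "card {k. lin_coef r k \<noteq> 0} \<le> length r"
proof -
  have "card {k. lin_coef r k \<noteq> 0} \<le> card (fst ` set r)"
    by (intro card_mono) (auto dest: lin_coef_nonzero)
  also have "\<dots> \<le> length r" by (metis card_image_le card_length finite_set order_trans)
  finally show ?thesis .
qed

definition block_vec :: "nat \<Rightarrow> nat \<Rightarrow> (nat \<Rightarrow> nat \<Rightarrow> real) \<Rightarrow> real Matrix.vec" where
  "block_vec nb D X = Matrix.vec (nb * D) (\<lambda>i. X (i div D) (i mod D))"

definition block_layer :: "nat \<Rightarrow> nat \<Rightarrow> register_layer \<Rightarrow> real Matrix.mat \<times> real Matrix.vec" where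
  "block_layer nb D L =
     (Matrix.mat (nb * D) (nb * D) (\<lambda>(i, k). if i div D = k div D then lin_coef (fst (L (i mod D))) (k mod D) else 0),
      Matrix.vec (nb * D) (\<lambda>i. snd (L (i mod D))))"

definition input_layer ::
    "nat \<Rightarrow> nat \<Rightarrow> nat \<Rightarrow> (nat \<Rightarrow> register_layer) \<Rightarrow> real Matrix.mat \<times> real Matrix.vec" where
  "input_layer d nb D I =
     (Matrix.mat (nb * D) d (\<lambda>(i, k). lin_coef (fst (I (i div D) (i mod D))) k),
      Matrix.vec (nb * D) (\<lambda>i. snd (I (i div D) (i mod D))))"

text \<open>Register 0 of every block holds its output shifted by 1.\<close>

definition output_layer ::
    "nat \<Rightarrow> nat \<Rightarrow> nat \<Rightarrow> (nat \<Rightarrow> nat \<Rightarrow> real) \<Rightarrow> real Matrix.mat \<times> real Matrix.vec" where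
  "output_layer J nb D A =
     (Matrix.mat J (nb * D) (\<lambda>(j, k). if k mod D = 0 then A j (k div D) else 0),
      Matrix.vec J (\<lambda>j. - (\<Sum>b<nb. A j b)))"

definition block_network where
  "block_network d J nb D I p A = input_layer d nb D I # map (block_layer nb D) p @ [output_layer J nb D A]"

lemma affine_layer_index:
  assumes "i < r"
  shows "vec_index (affine_layer (Matrix.mat r c F, Matrix.vec r g) (Matrix.vec c x)) i
       = (\<Sum>k<c. F (i, k) * x k) + g i"
  using assms by (simp add: affine_layer_def scalar_prod_def atLeast0LessThan)

lemma sum_blocks:
  fixes f :: "nat \<Rightarrow> nat \<Rightarrow> real"
  assumes "0 < D"
  shows "(\<Sum>k<nb * D. f (k div D) (k mod D)) = (\<Sum>b<nb. \<Sum>l<D. f b l)"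
proof -
  have "(\<Sum>b<nb. \<Sum>l<D. f b l) = (\<Sum>(b, l)\<in>{..<nb} \<times> {..<D}. f b l)"
    by (simp add: sum.cartesian_product)
  also have "\<dots> = (\<Sum>k<nb * D. f (k div D) (k mod D))"
  proof (rule sum.reindex_bij_witness[where i = "\<lambda>k. (k div D, k mod D)" and j = "\<lambda>(b, l). b * D + l"])
    fix a assume a: "a \<in> {..<nb} \<times> {..<D}"
    then obtain b l where bl: "a = (b, l)" "b < nb" "l < D" by auto
    have "b * D + l < (b + 1) * D" using bl by simp
    also have "\<dots> \<le> nb * D" using bl by (intro mult_right_mono) auto
    finally show "(case a of (b, l) \<Rightarrow> b * D + l) \<in> {..<nb * D}" using bl by simp
  qed (use assms in \<open>auto simp: less_mult_imp_div_less\<close>)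
  finally show ?thesis by simp
qed

lemma block_layer_run:
  assumes "0 < D" "layer_wf D L"
  shows "relu_vec (affine_layer (block_layer nb D L) (block_vec nb D X)) = block_vec nb D (\<lambda>b. run_layer L (X b))"
proof (rule eq_vecI)
  fix i assume "i < dim_vec (block_vec nb D (\<lambda>b. run_layer L (X b)))"
  then have i: "i < nb * D" by (simp add: block_vec_def)
  then have b: "i div D < nb" by (simp add: less_mult_imp_div_less)
  let ?r = "fst (L (i mod D))"
  have wf: "\<forall>(l, c)\<in>set ?r. l < D"
    using assms mod_less_divisor[OF assms(1), of i] unfolding layer_wf_def by blast
  have "(\<Sum>k<nb * D. (if i div D = k div D then lin_coef ?r (k mod D) else 0) * X (k div D) (k mod D))
     = (\<Sum>b<nb. \<Sum>l<D. (if i div D = b then lin_coef ?r l else 0) * X b l)"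
    by (rule sum_blocks[OF assms(1), where f = "\<lambda>b l. (if i div D = b then lin_coef ?r l else 0) * X b l"])
  also have "\<dots> = (\<Sum>b<nb. if i div D = b then lin_form ?r (X b) else 0)"
    using lin_form_coef[OF wf] by (intro sum.cong refl) auto
  also have "\<dots> = lin_form ?r (X (i div D))" using b by simp
  finally have "vec_index (affine_layer (block_layer nb D L) (block_vec nb D X)) i = lin_form ?r (X (i div D)) + snd (L (i mod D))"
    unfolding block_layer_def block_vec_def by (subst affine_layer_index[OF i]) simp
  moreover have "i < dim_vec (affine_layer (block_layer nb D L) (block_vec nb D X))"
    using i by (simp add: affine_layer_def block_layer_def)
  ultimately show "vec_index (relu_vec (affine_layer (block_layer nb D L) (block_vec nb D X))) i
      = vec_index (block_vec nb D (\<lambda>b. run_layer L (X b))) i"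
    using i by (simp add: relu_vec_def block_vec_def run_layer_def)
qed (simp add: relu_vec_def affine_layer_def block_layer_def block_vec_def)

lemma input_layer_run:
  assumes "0 < D" "\<And>b i. b < nb \<Longrightarrow> i < D \<Longrightarrow> \<forall>(l, c)\<in>set (fst (I b i)). l < d"
  shows "relu_vec (affine_layer (input_layer d nb D I) (Matrix.vec d x)) = block_vec nb D (\<lambda>b. run_layer (I b) x)"
proof (rule eq_vecI)
  fix i assume "i < dim_vec (block_vec nb D (\<lambda>b. run_layer (I b) x))"
  then have i: "i < nb * D" by (simp add: block_vec_def)
  then have b: "i div D < nb" by (simp add: less_mult_imp_div_less)
  have "vec_index (affine_layer (input_layer d nb D I) (Matrix.vec d x)) i
      = lin_form (fst (I (i div D) (i mod D))) x + snd (I (i div D) (i mod D))"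
    unfolding input_layer_def
    using lin_form_coef[OF assms(2)[OF b mod_less_divisor[OF assms(1), of i]]]
    by (subst affine_layer_index[OF i]) simp
  moreover have "i < dim_vec (affine_layer (input_layer d nb D I) (Matrix.vec d x))"
    using i by (simp add: affine_layer_def input_layer_def)
  ultimately show "vec_index (relu_vec (affine_layer (input_layer d nb D I) (Matrix.vec d x))) i
      = vec_index (block_vec nb D (\<lambda>b. run_layer (I b) x)) i"
    using i by (simp add: relu_vec_def block_vec_def run_layer_def)
qed (simp add: relu_vec_def affine_layer_def input_layer_def block_vec_def)

lemma realization_Cons: "net \<noteq> [] \<Longrightarrow> realization (A # net) x = realization net (relu_vec (affine_layer A x))"
  by (cases net) simp_all

lemma realization_block_layers:
  assumes "0 < D" "\<forall>L\<in>set p. layer_wf D L"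
  shows "realization (map (block_layer nb D) p @ [B]) (block_vec nb D X)
       = affine_layer B (block_vec nb D (\<lambda>b. run_program p (X b)))"
  using assms(2) by (induction p arbitrary: X) (simp_all add: realization_Cons block_layer_run[OF assms(1)])

lemma output_layer_index:
  assumes "0 < D" "j < J"
  shows "vec_index (affine_layer (output_layer J nb D A) (block_vec nb D X)) j = (\<Sum>b<nb. A j b * (X b 0 - 1))"
proof -
  have "vec_index (affine_layer (output_layer J nb D A) (block_vec nb D X)) j
      = (\<Sum>k<nb * D. (if k mod D = 0 then A j (k div D) else 0) * X (k div D) (k mod D)) + - (\<Sum>b<nb. A j b)"
    unfolding output_layer_def block_vec_def affine_layer_index[OF assms(2)] split_conv ..
  also have "(\<Sum>k<nb * D. (if k mod D = 0 then A j (k div D) else 0) * X (k div D) (k mod D))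
      = (\<Sum>b<nb. \<Sum>l<D. (if l = 0 then A j b else 0) * X b l)"
    by (rule sum_blocks[OF assms(1), where f = "\<lambda>b l. (if l = 0 then A j b else 0) * X b l"])
  also have "\<dots> = (\<Sum>b<nb. A j b * X b 0)"
  proof (intro sum.cong refl)
    fix b
    have "(\<Sum>l<D. (if l = 0 then A j b else 0) * X b l) = (\<Sum>l<D. if l = 0 then A j b * X b l else 0)"
      by (intro sum.cong) auto
    then show "(\<Sum>l<D. (if l = 0 then A j b else 0) * X b l) = A j b * X b 0" using assms(1) by simp
  qed
  finally show ?thesis by (simp add: right_diff_distrib sum_subtractf)
qed

lemma block_network_realization:
  assumes "0 < D" "\<forall>L\<in>set p. layer_wf D L" "j < J"
    and "\<And>b i. b < nb \<Longrightarrow> i < D \<Longrightarrow> \<forall>(l, c)\<in>set (fst (I b i)). l < d"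
  shows "vec_index (realization (block_network d J nb D I p A) (Matrix.vec d x)) j
       = (\<Sum>b<nb. A j b * (run_program p (run_layer (I b) x) 0 - 1))"
proof -
  have "realization (block_network d J nb D I p A) (Matrix.vec d x)
      = affine_layer (output_layer J nb D A) (block_vec nb D (\<lambda>b. run_program p (run_layer (I b) x)))"
    unfolding block_network_def
    by (simp add: realization_Cons input_layer_run[OF assms(1,4)] realization_block_layers[OF assms(1,2)])
  then show ?thesis by (simp only: output_layer_index[OF assms(1,3)])
qed

lemma block_network_wf:
  assumes "0 < D" "0 < nb" "0 < d" "0 < J"
  shows "is_network (block_network d J nb D I p A)" "input_dim (block_network d J nb D I p A) = d"
    "output_dim (block_network d J nb D I p A) = J"
proof -
  let ?n = "block_network d J nb D I p A"
  have l: "length ?n = Suc (Suc (length p))" by (simp add: block_network_def)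
  have "dim_col (fst (?n ! Suc j)) = nb * D \<and> dim_row (fst (?n ! j)) = nb * D" if "Suc j < length ?n" for j
  proof -
    have r: "dim_row (fst (?n ! j)) = nb * D"
      using that l by (cases j) (auto simp: block_network_def nth_append input_layer_def block_layer_def)
    have "dim_col (fst (?n ! Suc j)) = nb * D"
      using that l by (auto simp: block_network_def nth_append output_layer_def block_layer_def)
    with r show ?thesis by simp
  qed
  then show "is_network ?n"
    unfolding is_network_def using assms
    by (auto simp: block_network_def input_layer_def block_layer_def output_layer_def)
  show "input_dim ?n = d" by (simp add: input_dim_def block_network_def input_layer_def)
  show "output_dim ?n = J" by (simp add: output_dim_def block_network_def output_layer_def)
qed

definition layer_size :: "real Matrix.mat \<times> real Matrix.vec \<Rightarrow> nat" where
  "layer_size = (\<lambda>(W, b). card {(i, k). i < dim_row W \<and> k < dim_col W \<and> index_mat W (i, k) \<noteq> 0} +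
        card {i. i < dim_vec b \<and> vec_index b i \<noteq> 0})"

lemma network_size_sum: "network_size net = sum_list (map layer_size net)"
  by (simp add: network_size_def layer_size_def)

lemma layer_size_le:
  assumes "\<And>i. i < r \<Longrightarrow> card {k. k < c \<and> F (i, k) \<noteq> 0} \<le> q"
  shows "layer_size (Matrix.mat r c F, Matrix.vec r g) \<le> r * q + r"
proof -
  have "{(i, k). i < r \<and> k < c \<and> F (i, k) \<noteq> 0} = (SIGMA i:{..<r}. {k. k < c \<and> F (i, k) \<noteq> 0})" by auto
  then have "card {(i, k). i < r \<and> k < c \<and> F (i, k) \<noteq> 0} = (\<Sum>i<r. card {k. k < c \<and> F (i, k) \<noteq> 0})"
    by (simp add: card_SigmaI)
  also have "\<dots> \<le> r * q" using sum_bounded_above[of "{..<r}" _ q] assms by simp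
  finally have 1: "card {(i, k). i < r \<and> k < c \<and> F (i, k) \<noteq> 0} \<le> r * q" .
  have 2: "card {i. i < r \<and> g i \<noteq> 0} \<le> r"
    using card_mono[of "{..<r}" "{i. i < r \<and> g i \<noteq> 0}"] by auto
  have "{(i, k). i < r \<and> k < c \<and> index_mat (Matrix.mat r c F) (i, k) \<noteq> 0} = {(i, k). i < r \<and> k < c \<and> F (i, k) \<noteq> 0}"
    "{i. i < r \<and> vec_index (Matrix.vec r g) i \<noteq> 0} = {i. i < r \<and> g i \<noteq> 0}" by auto
  with 1 2 show ?thesis by (simp add: layer_size_def)
qed

lemma layer_size_block:
  assumes "0 < D" "layer_wf D L" shows "layer_size (block_layer nb D L) \<le> 6 * (nb * D)"
proof -
  have "layer_size (block_layer nb D L) \<le> nb * D * 5 + nb * D"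
    unfolding block_layer_def
  proof (rule layer_size_le)
    fix i assume "i < nb * D"
    let ?r = "fst (L (i mod D))"
    let ?S = "{k. k < nb * D \<and> (\<lambda>(i, k). if i div D = k div D then lin_coef (fst (L (i mod D))) (k mod D) else 0) (i, k) \<noteq> 0}"
    have sub: "?S \<subseteq> (\<lambda>l. (i div D) * D + l) ` {k. lin_coef ?r k \<noteq> 0}"
    proof
      fix k assume "k \<in> ?S"
      then have "i div D = k div D" "lin_coef ?r (k mod D) \<noteq> 0" by (auto split: if_splits)
      then show "k \<in> (\<lambda>l. (i div D) * D + l) ` {k. lin_coef ?r k \<noteq> 0}"
        by (intro image_eqI[of _ _ "k mod D"]) auto
    qed
    have "card ?S \<le> card {k. lin_coef ?r k \<noteq> 0}"
      by (rule surj_card_le[OF finite_lin_coef sub])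
    also have "\<dots> \<le> length ?r" by (rule card_lin_coef)
    also have "\<dots> \<le> 5" using assms by (simp add: layer_wf_def)
    finally show "card ?S \<le> 5" .
  qed
  then show ?thesis by linarith
qed

lemma layer_size_input:
  assumes "0 < D" "\<And>b i. b < nb \<Longrightarrow> i < D \<Longrightarrow> length (fst (I b i)) \<le> 1"
  shows "layer_size (input_layer d nb D I) \<le> 2 * (nb * D)"
proof -
  have "layer_size (input_layer d nb D I) \<le> nb * D * 1 + nb * D"
    unfolding input_layer_def
  proof (rule layer_size_le)
    fix i assume i: "i < nb * D"
    let ?r = "fst (I (i div D) (i mod D))"
    have "card {k. k < d \<and> (\<lambda>(i, k). lin_coef (fst (I (i div D) (i mod D))) k) (i, k) \<noteq> 0} \<le> card {k. lin_coef ?r k \<noteq> 0}"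
      by (intro card_mono finite_lin_coef) auto
    also have "\<dots> \<le> length ?r" by (rule card_lin_coef)
    also have "\<dots> \<le> 1" using assms i by (simp add: less_mult_imp_div_less)
    finally show "card {k. k < d \<and> (\<lambda>(i, k). lin_coef (fst (I (i div D) (i mod D))) k) (i, k) \<noteq> 0} \<le> 1" .
  qed
  then show ?thesis by simp
qed

lemma layer_size_output:
  assumes "0 < D"
  shows "layer_size (output_layer J nb D A) \<le> 2 * card {(j, b). j < J \<and> b < nb \<and> A j b \<noteq> 0}"
proof -
  let ?P = "{(j, b). j < J \<and> b < nb \<and> A j b \<noteq> 0}"
  have fin: "finite ?P" by (rule finite_subset[of _ "{..<J} \<times> {..<nb}"]) auto
  let ?S = "{(i, k). i < J \<and> k < nb * D \<and> (if k mod D = 0 then A i (k div D) else 0) \<noteq> 0}"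
  have "?S \<subseteq> (\<lambda>(j, b). (j, b * D)) ` ?P"
  proof
    fix x assume "x \<in> ?S"
    then obtain i k where x: "x = (i, k)" "i < J" "k < nb * D" "k mod D = 0" "A i (k div D) \<noteq> 0"
      by (auto split: if_splits)
    then have "k = (k div D) * D" "k div D < nb" by (auto simp: less_mult_imp_div_less)
    with x show "x \<in> (\<lambda>(j, b). (j, b * D)) ` ?P" by (intro image_eqI[of _ _ "(i, k div D)"]) auto
  qed
  then have 1: "card ?S \<le> card ?P" by (rule surj_card_le[OF fin])
  let ?T = "{i. i < J \<and> - (\<Sum>b<nb. A i b) \<noteq> 0}"
  have "?T \<subseteq> fst ` ?P"
  proof
    fix i assume i: "i \<in> ?T"
    have "\<exists>b<nb. A i b \<noteq> 0"
    proof (rule ccontr)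
      assume "\<not> (\<exists>b<nb. A i b \<noteq> 0)"
      then have "(\<Sum>b<nb. A i b) = 0" by (intro sum.neutral) auto
      with i show False by simp
    qed
    then obtain b where "b < nb" "A i b \<noteq> 0" by blast
    with i show "i \<in> fst ` ?P" by (intro image_eqI[of _ _ "(i, b)"]) auto
  qed
  then have 2: "card ?T \<le> card ?P" by (rule surj_card_le[OF fin])
  have "layer_size (output_layer J nb D A) = card ?S + card ?T"
    unfolding layer_size_def output_layer_def
    by (auto intro!: arg_cong2[of _ _ _ _ "(+)"] arg_cong[of _ _ card] split: if_splits)
  with 1 2 show ?thesis by simp
qed

lemma block_network_size:
  assumes "0 < D" "\<forall>L\<in>set p. layer_wf D L" "\<And>b i. b < nb \<Longrightarrow> i < D \<Longrightarrow> length (fst (I b i)) \<le> 1"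
  shows "network_size (block_network d J nb D I p A)
    \<le> 2 * (nb * D) + length p * (6 * (nb * D)) + 2 * card {(j, b). j < J \<and> b < nb \<and> A j b \<noteq> 0}"
proof -
  have "sum_list (map (layer_size \<circ> block_layer nb D) p) \<le> length p * (6 * (nb * D))"
    using assms(2)
  proof (induction p)
    case (Cons L p)
    then show ?case using layer_size_block[OF assms(1), of L nb] by simp
  qed simp
  moreover have "layer_size (input_layer d nb D I) \<le> 2 * (nb * D)"
    by (rule layer_size_input[OF assms(1,3)])
  ultimately show ?thesis
    using layer_size_output[OF assms(1), of J nb A]
    by (simp add: network_size_sum block_network_def)
qed

subsection \<open>Multiplication by a register program\<close>

definition tent :: "real \<Rightarrow> real" where
  "tent x = 2 * x - 4 * max 0 (x - 1/2)"

lemma tent_range: "0 \<le> x \<Longrightarrow> x \<le> 1 \<Longrightarrow> 0 \<le> tent x \<and> tent x \<le> 1"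
  by (auto simp: tent_def max_def)

lemma tent_iterate_range: "0 \<le> x \<Longrightarrow> x \<le> 1 \<Longrightarrow> 0 \<le> (tent ^^ m) x \<and> (tent ^^ m) x \<le> 1"
  by (induction m) (auto simp: tent_range)

definition approx_square :: "nat \<Rightarrow> real \<Rightarrow> real" where
  "approx_square m x = x - (\<Sum>s<m. (tent ^^ Suc s) x / 4 ^ Suc s)"

text \<open>The defect \<open>x - x\<^sup>2\<close> satisfies \<open>4 (x - x\<^sup>2) = g + (g - g\<^sup>2)\<close> with \<open>g = tent x\<close>; iterate.\<close>

lemma approx_square_error:
  assumes "0 \<le> x" "x \<le> 1"
  shows "approx_square m x - x\<^sup>2 = ((tent ^^ m) x - ((tent ^^ m) x)\<^sup>2) / 4 ^ m"
proof (induction m)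
  case (Suc m)
  define y where "y = (tent ^^ m) x"
  have y: "0 \<le> y" "y \<le> 1" using tent_iterate_range[OF assms] by (auto simp: y_def)
  have t: "4 * (y - y\<^sup>2) = tent y + (tent y - (tent y)\<^sup>2)"
    by (auto simp: tent_def max_def power2_eq_square algebra_simps)
  have "approx_square (Suc m) x - x\<^sup>2 = (approx_square m x - x\<^sup>2) - tent y / 4 ^ Suc m"
    by (simp add: approx_square_def y_def)
  also have "\<dots> = (4 * (y - y\<^sup>2)) / 4 ^ Suc m - tent y / 4 ^ Suc m" unfolding Suc y_def[symmetric] by (simp add: field_simps)
  also have "\<dots> = (tent y - (tent y)\<^sup>2) / 4 ^ Suc m" unfolding t by (simp only: add_divide_distrib)
  finally show ?case by (simp add: y_def)
qed (simp add: approx_square_def)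

lemma approx_square_bounds:
  assumes "0 \<le> x" "x \<le> 1"
  shows "x\<^sup>2 \<le> approx_square m x" "approx_square m x \<le> x\<^sup>2 + (1/4) ^ m" "approx_square m x \<le> x" "0 \<le> approx_square m x"
proof -
  define y where "y = (tent ^^ m) x"
  have y: "0 \<le> y" "y \<le> 1" using tent_iterate_range[OF assms] by (auto simp: y_def)
  have "0 \<le> y * (1 - y)" "y * (1 - y) \<le> 1 * 1" using y by (intro mult_nonneg_nonneg mult_mono; simp)+
  then have e: "0 \<le> (y - y\<^sup>2) / 4 ^ m" "(y - y\<^sup>2) / 4 ^ m \<le> 1 / 4 ^ m"
    by (auto simp: power2_eq_square algebra_simps intro!: divide_right_mono)
  show 1: "x\<^sup>2 \<le> approx_square m x" "approx_square m x \<le> x\<^sup>2 + (1/4) ^ m"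
    using e approx_square_error[OF assms, of m] by (simp_all add: y_def power_divide)
  show "approx_square m x \<le> x"
    unfolding approx_square_def using tent_iterate_range[OF assms] by (auto intro!: sum_nonneg divide_nonneg_nonneg simp del: funpow.simps)
  show "0 \<le> approx_square m x" using 1(1) zero_le_power2[of x] by linarith
qed

text \<open>
  Register 0 holds the running product \<open>P + 1\<close> and register \<open>5 + k\<close> the factor \<open>f k + 1\<close>; the shift by
  1 keeps all registers nonnegative, so that the activation leaves them unchanged.  The product is
  formed as \<open>P f = \<bar>(P + f) / 2\<bar>\<^sup>2 - \<bar>(P - f) / 2\<bar>\<^sup>2\<close>, both squares being iterated simultaneously in
  registers 1, 2 and 3, 4.
\<close>

definition load_layer :: "nat \<Rightarrow> register_layer" where
  "load_layer k i =
    (if i = 1 then ([(0, 1), (5 + k, 1)], - 2)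
     else if i = 2 then ([(0, - 1), (5 + k, - 1)], 2)
     else if i = 3 then ([(0, 1), (5 + k, - 1)], 0)
     else if i = 4 then ([(0, - 1), (5 + k, 1)], 0)
     else ([(i, 1)], 0))"

definition abs_layer :: register_layer where
  "abs_layer i =
    (if i = 0 then ([(1, 1/2), (2, 1/2), (3, - 1/2), (4, - 1/2)], 1)
     else if i = 1 then ([(1, 1/2), (2, 1/2)], 0)
     else if i = 2 then ([(1, 1/2), (2, 1/2)], - 1/2)
     else if i = 3 then ([(3, 1/2), (4, 1/2)], 0)
     else if i = 4 then ([(3, 1/2), (4, 1/2)], - 1/2)
     else ([(i, 1)], 0))"

definition tent_layer :: "nat \<Rightarrow> register_layer" where
  "tent_layer s i =
    (if i = 0 then ([(0, 1), (1, - 2 / 4 ^ s), (2, 4 / 4 ^ s), (3, 2 / 4 ^ s), (4, - 4 / 4 ^ s)], 0)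
     else if i = 1 then ([(1, 2), (2, - 4)], 0)
     else if i = 2 then ([(1, 2), (2, - 4)], - 1/2)
     else if i = 3 then ([(3, 2), (4, - 4)], 0)
     else if i = 4 then ([(3, 2), (4, - 4)], - 1/2)
     else ([(i, 1)], 0))"

definition mult_program :: "nat \<Rightarrow> nat \<Rightarrow> register_layer list" where
  "mult_program m k = load_layer k # abs_layer # map (\<lambda>s. tent_layer (Suc s)) [0..<m]"

definition product_program :: "nat \<Rightarrow> nat \<Rightarrow> register_layer list" where
  "product_program m K = concat (map (mult_program m) [0..<K])"

lemma length_product_program: "length (product_program m K) = K * (m + 2)"
  by (induction K) (simp_all add: product_program_def mult_program_def)

lemma product_program_wf: "\<forall>L\<in>set (product_program m K). layer_wf (5 + K) L"
  by (auto simp: product_program_def mult_program_def layer_wf_def load_layer_def abs_layer_def tent_layer_def)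

lemma run_tent_layers:
  assumes "0 \<le> x" "x \<le> 1" "0 \<le> y" "y \<le> 1"
    and "st 0 = 1 + x - y" "st 1 = x" "st 2 = max 0 (x - 1/2)" "st 3 = y" "st 4 = max 0 (y - 1/2)"
    and "\<And>i. 5 \<le> i \<Longrightarrow> 0 \<le> st i"
  defines "st' \<equiv> \<lambda>m. run_program (map (\<lambda>s. tent_layer (Suc s)) [0..<m]) st"
  shows "st' m 0 = 1 + approx_square m x - approx_square m y \<and> st' m 1 = (tent ^^ m) x
    \<and> st' m 2 = max 0 ((tent ^^ m) x - 1/2) \<and> st' m 3 = (tent ^^ m) y \<and> st' m 4 = max 0 ((tent ^^ m) y - 1/2)
    \<and> (\<forall>i\<ge>5. st' m i = st i)"
proof (induction m)
  case 0
  then show ?case using assms by (simp add: st'_def approx_square_def)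
next
  case (Suc m)
  have step: "st' (Suc m) = run_layer (tent_layer (Suc m)) (st' m)" by (simp add: st'_def)
  define p q where "p = (tent ^^ m) x" and "q = (tent ^^ m) y"
  have tp: "2 * p - 4 * max 0 (p - 1/2) = tent p" "2 * q - 4 * max 0 (q - 1/2) = tent q"
    by (simp_all add: tent_def)
  have nn: "0 \<le> tent p" "0 \<le> tent q"
    using tent_iterate_range[OF assms(1,2), of "Suc m"] tent_iterate_range[OF assms(3,4), of "Suc m"]
    by (simp_all add: p_def q_def)
  have IH: "st' m 0 = 1 + approx_square m x - approx_square m y" "st' m 1 = p" "st' m 2 = max 0 (p - 1/2)"
    "st' m 3 = q" "st' m 4 = max 0 (q - 1/2)" "\<And>i. 5 \<le> i \<Longrightarrow> st' m i = st i"
    using Suc by (auto simp: p_def q_def)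
  have aq: "approx_square (Suc m) x = approx_square m x - tent p / 4 ^ Suc m"
    "approx_square (Suc m) y = approx_square m y - tent q / 4 ^ Suc m"
    by (simp_all add: approx_square_def p_def q_def)
  have "st' (Suc m) 0 = max 0 (st' m 0 - (2 * p - 4 * max 0 (p - 1/2)) / 4 ^ Suc m + (2 * q - 4 * max 0 (q - 1/2)) / 4 ^ Suc m)"
    unfolding step run_layer_def tent_layer_def using IH
    by (simp add: lin_form_def diff_divide_distrib)
  also have "\<dots> = max 0 (1 + approx_square (Suc m) x - approx_square (Suc m) y)"
    unfolding tp IH(1) aq by (simp add: algebra_simps)
  also have "\<dots> = 1 + approx_square (Suc m) x - approx_square (Suc m) y"
    using approx_square_bounds[OF assms(1,2), of "Suc m"] approx_square_bounds[OF assms(3,4), of "Suc m"] assms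
    by simp
  finally have 0: "st' (Suc m) 0 = 1 + approx_square (Suc m) x - approx_square (Suc m) y" .
  have "st' (Suc m) 1 = max 0 (2 * p - 4 * max 0 (p - 1/2))" "st' (Suc m) 2 = max 0 (2 * p - 4 * max 0 (p - 1/2) - 1/2)"
    "st' (Suc m) 3 = max 0 (2 * q - 4 * max 0 (q - 1/2))" "st' (Suc m) 4 = max 0 (2 * q - 4 * max 0 (q - 1/2) - 1/2)"
    unfolding step run_layer_def tent_layer_def using IH by (simp_all add: lin_form_def)
  then have "st' (Suc m) 1 = tent p" "st' (Suc m) 2 = max 0 (tent p - 1/2)" "st' (Suc m) 3 = tent q" "st' (Suc m) 4 = max 0 (tent q - 1/2)"
    unfolding tp using nn by simp_all
  moreover have "st' (Suc m) i = st i" if "5 \<le> i" for i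
    unfolding step run_layer_def tent_layer_def using IH(6)[OF that] assms(10)[OF that] that by (simp add: lin_form_def)
  ultimately show ?case using 0 by (simp add: p_def q_def)
qed

lemma run_mult_program:
  assumes "st 0 = 1 + P" "st (5 + k) = 1 + f" "\<bar>P\<bar> \<le> 1" "\<bar>f\<bar> \<le> 1"
    and "\<And>i. 5 \<le> i \<Longrightarrow> 0 \<le> st i"
  shows "\<exists>P'. run_program (mult_program m k) st 0 = 1 + P' \<and> \<bar>P'\<bar> \<le> 1 \<and> \<bar>P' - P * f\<bar> \<le> (1/4) ^ m
    \<and> (\<forall>i\<ge>5. run_program (mult_program m k) st i = st i)"
proof -
  define x y where "x = \<bar>P + f\<bar> / 2" and "y = \<bar>P - f\<bar> / 2"
  have xy: "0 \<le> x" "x \<le> 1" "0 \<le> y" "y \<le> 1" using assms by (auto simp: x_def y_def)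
  define s1 where "s1 = run_layer (load_layer k) st"
  define s2 where "s2 = run_layer abs_layer s1"
  have s1: "s1 1 = max 0 (P + f)" "s1 2 = max 0 (- P - f)" "s1 3 = max 0 (P - f)" "s1 4 = max 0 (f - P)"
    using assms(1,2) by (simp_all add: s1_def run_layer_def load_layer_def lin_form_def)
  have s1i: "s1 i = st i" if "5 \<le> i" for i
    using assms(5)[OF that] that by (simp add: s1_def run_layer_def load_layer_def lin_form_def)
  have h: "max 0 (P + f) / 2 + max 0 (- P - f) / 2 = x" "max 0 (P - f) / 2 + max 0 (f - P) / 2 = y"
    by (auto simp: x_def y_def max_def)
  have "s2 0 = max 0 (max 0 (P + f) / 2 + (max 0 (- P - f) / 2 + (- (max 0 (P - f) / 2) - max 0 (f - P) / 2)) + 1)"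
    by (simp add: s2_def run_layer_def abs_layer_def lin_form_def s1 s1[unfolded One_nat_def])
  also have "\<dots> = max 0 (1 + (max 0 (P + f) / 2 + max 0 (- P - f) / 2) - (max 0 (P - f) / 2 + max 0 (f - P) / 2))"
    by (rule arg_cong[where f = "max 0"]) linarith
  finally have "s2 0 = max 0 (1 + (max 0 (P + f) / 2 + max 0 (- P - f) / 2) - (max 0 (P - f) / 2 + max 0 (f - P) / 2))" .
  moreover have "s2 1 = max 0 (max 0 (P + f) / 2 + max 0 (- P - f) / 2)"
    "s2 2 = max 0 ((max 0 (P + f) / 2 + max 0 (- P - f) / 2) - 1/2)"
    "s2 3 = max 0 (max 0 (P - f) / 2 + max 0 (f - P) / 2)"
    "s2 4 = max 0 ((max 0 (P - f) / 2 + max 0 (f - P) / 2) - 1/2)"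
    by (simp_all add: s2_def run_layer_def abs_layer_def lin_form_def s1 s1[unfolded One_nat_def])
  ultimately have s2: "s2 0 = 1 + x - y" "s2 1 = x" "s2 2 = max 0 (x - 1/2)" "s2 3 = y" "s2 4 = max 0 (y - 1/2)"
    unfolding h using xy by simp_all
  have s2i: "s2 i = st i" if "5 \<le> i" for i
    using assms(5)[OF that] s1i[OF that] that by (simp add: s2_def run_layer_def abs_layer_def lin_form_def)
  let ?P = "approx_square m x - approx_square m y"
  have r: "run_program (mult_program m k) st = run_program (map (\<lambda>s. tent_layer (Suc s)) [0..<m]) s2"
    by (simp add: mult_program_def s2_def s1_def)
  have "run_program (mult_program m k) st 0 = 1 + ?P" "\<forall>i\<ge>5. run_program (mult_program m k) st i = st i"
    using run_tent_layers[OF xy s2, of m] assms(5) s2i unfolding r by auto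
  moreover have "(P + f)\<^sup>2 - (P - f)\<^sup>2 = 4 * (P * f)"
    by (simp add: power2_eq_square algebra_simps)
  then have "x\<^sup>2 - y\<^sup>2 = P * f"
    by (simp add: x_def y_def power_divide diff_divide_distrib[symmetric])
  then have "\<bar>?P - P * f\<bar> \<le> (1/4) ^ m"
    using approx_square_bounds[OF xy(1,2), of m] approx_square_bounds[OF xy(3,4), of m] by linarith
  moreover have "\<bar>?P\<bar> \<le> 1"
    using approx_square_bounds[OF xy(1,2), of m] approx_square_bounds[OF xy(3,4), of m] xy by linarith
  ultimately show ?thesis by blast
qed

lemma run_product_program:
  assumes "st 0 = 2" "\<And>k. k < K \<Longrightarrow> st (5 + k) = 1 + f k" "\<And>k. k < K \<Longrightarrow> \<bar>f k\<bar> \<le> 1"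
    and "\<And>i. 5 \<le> i \<Longrightarrow> 0 \<le> st i"
  shows "\<bar>run_program (product_program m K) st 0 - 1 - (\<Prod>k<K. f k)\<bar> \<le> real K * (1/4) ^ m"
proof -
  have "\<exists>P. run_program (product_program m n) st 0 = 1 + P \<and> \<bar>P\<bar> \<le> 1 \<and> \<bar>P - (\<Prod>k<n. f k)\<bar> \<le> real n * (1/4) ^ m
    \<and> (\<forall>i\<ge>5. run_program (product_program m n) st i = st i)" if "n \<le> K" for n
    using that
  proof (induction n)
    case 0
    then show ?case using assms by (intro exI[of _ 1]) (simp add: product_program_def)
  next
    case (Suc n)
    then obtain P where P: "run_program (product_program m n) st 0 = 1 + P" "\<bar>P\<bar> \<le> 1" "\<bar>P - (\<Prod>k<n. f k)\<bar> \<le> real n * (1/4) ^ m"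
      "\<And>i. 5 \<le> i \<Longrightarrow> run_program (product_program m n) st i = st i" by auto
    have r: "run_program (product_program m (Suc n)) st = run_program (mult_program m n) (run_program (product_program m n) st)"
      by (simp add: product_program_def)
    obtain Q where Q: "run_program (product_program m (Suc n)) st 0 = 1 + Q" "\<bar>Q\<bar> \<le> 1" "\<bar>Q - P * f n\<bar> \<le> (1/4) ^ m"
      "\<And>i. 5 \<le> i \<Longrightarrow> run_program (product_program m (Suc n)) st i = st i"
      using run_mult_program[of "run_program (product_program m n) st" P n "f n" m] P assms Suc.prems unfolding r by auto
    have "\<bar>Q - (\<Prod>k<Suc n. f k)\<bar> \<le> \<bar>Q - P * f n\<bar> + \<bar>P - (\<Prod>k<n. f k)\<bar> * \<bar>f n\<bar>"
      unfolding abs_mult[symmetric] left_diff_distrib by simp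
    also have "\<dots> \<le> (1/4) ^ m + real n * (1/4) ^ m * 1"
      using Q P assms(3)[of n] Suc.prems by (intro add_mono mult_mono) auto
    finally have "\<bar>Q - (\<Prod>k<Suc n. f k)\<bar> \<le> real (Suc n) * (1/4) ^ m" by (simp add: algebra_simps)
    with Q show ?case by auto
  qed
  from this[of K] show ?thesis by auto
qed

lemma run_layer_measurable:
  assumes "\<And>i. (\<lambda>a. g a i) \<in> borel_measurable M"
  shows "(\<lambda>a. run_layer L (g a) i) \<in> borel_measurable M"
proof -
  have "(\<lambda>a. lin_form r (g a)) \<in> borel_measurable M" for r
    unfolding lin_form_def
    by (induction r) (auto intro!: borel_measurable_add borel_measurable_times assms)
  then show ?thesis unfolding run_layer_def by measurable
qed

lemma run_program_measurable:
  assumes "\<And>i. (\<lambda>a. g a i) \<in> borel_measurable M"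
  shows "(\<lambda>a. run_program p (g a) i) \<in> borel_measurable M"
  using assms
proof (induction p arbitrary: g)
  case (Cons L p)
  then show ?case using Cons.IH[of "\<lambda>a. run_layer L (g a)"] run_layer_measurable[OF Cons.prems] by simp
qed simp

theorem product_network:
  fixes iv :: "nat \<Rightarrow> nat \<Rightarrow> nat" and \<alpha> \<beta> A :: "nat \<Rightarrow> nat \<Rightarrow> real"
  assumes "0 < d" "0 < J" "0 < nb" and iv: "\<And>b k. b < nb \<Longrightarrow> k < K \<Longrightarrow> iv b k < d"
  obtains net where "is_network net" "input_dim net = d" "output_dim net = J"
    and "network_size net \<le> 2 * (nb * (5 + K)) + K * (m + 2) * (6 * (nb * (5 + K)))
      + 2 * card {(j, b). j < J \<and> b < nb \<and> A j b \<noteq> 0}"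
    and "\<And>x j. (\<And>b k. b < nb \<Longrightarrow> k < K \<Longrightarrow> \<bar>\<alpha> b k * x (iv b k) + \<beta> b k\<bar> \<le> 1) \<Longrightarrow> j < J \<Longrightarrow>
      \<bar>vec_index (realization net (Matrix.vec d x)) j - (\<Sum>b<nb. A j b * (\<Prod>k<K. \<alpha> b k * x (iv b k) + \<beta> b k))\<bar>
      \<le> (\<Sum>b<nb. \<bar>A j b\<bar>) * (real K * (1/4) ^ m)"
    and "\<And>(M :: 'a measure) g j. (\<And>i. (\<lambda>a. g a i) \<in> borel_measurable M) \<Longrightarrow> j < J \<Longrightarrow>
      (\<lambda>a. vec_index (realization net (Matrix.vec d (g a))) j) \<in> borel_measurable M"
proof -
  define D where "D = 5 + K"
  define I :: "nat \<Rightarrow> register_layer" where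
    "I = (\<lambda>b i. if i = 0 then ([], 2) else if i < 5 \<or> i \<ge> 5 + K then ([], 0) else ([(iv b (i - 5), \<alpha> b (i - 5))], \<beta> b (i - 5) + 1))"
  define p where "p = product_program m K"
  define net where "net = block_network d J nb D I p A"
  have D0: "0 < D" by (simp add: D_def)
  have wf: "\<forall>L\<in>set p. layer_wf D L" using product_program_wf by (simp add: p_def D_def)
  have Iwf: "\<forall>(l, c)\<in>set (fst (I b i)). l < d" if "b < nb" "i < D" for b i
    using that iv[of b "i - 5"] by (auto simp: I_def D_def)
  have real: "vec_index (realization net (Matrix.vec d x)) j = (\<Sum>b<nb. A j b * (run_program p (run_layer (I b) x) 0 - 1))" if "j < J" for j x
    unfolding net_def by (rule block_network_realization[OF D0 wf that Iwf])
  show ?thesis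
  proof (rule that[of net])
    show "is_network net" "input_dim net = d" "output_dim net = J"
      unfolding net_def by (rule block_network_wf[OF D0 assms(3,1,2)])+
    have "length (fst (I b i)) \<le> 1" for b i by (simp add: I_def)
    from block_network_size[OF D0 wf this, where nb = nb and d = d and J = J and A = A]
    show "network_size net \<le> 2 * (nb * (5 + K)) + K * (m + 2) * (6 * (nb * (5 + K)))
      + 2 * card {(j, b). j < J \<and> b < nb \<and> A j b \<noteq> 0}"
      by (simp add: net_def D_def p_def length_product_program)
    show "(\<lambda>a. vec_index (realization net (Matrix.vec d (g a))) j) \<in> borel_measurable M"
      if "\<And>i. (\<lambda>a. g a i) \<in> borel_measurable M" "j < J" for M :: "'a measure" and g j
      unfolding real[OF that(2)]
      by (intro borel_measurable_sum borel_measurable_times borel_measurable_diff borel_measurable_const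
          run_program_measurable run_layer_measurable that(1))
    fix x j assume x: "\<And>b k. b < nb \<Longrightarrow> k < K \<Longrightarrow> \<bar>\<alpha> b k * x (iv b k) + \<beta> b k\<bar> \<le> 1" and j: "j < J"
    let ?f = "\<lambda>b k. \<alpha> b k * x (iv b k) + \<beta> b k"
    have b: "\<bar>run_program p (run_layer (I b) x) 0 - 1 - (\<Prod>k<K. ?f b k)\<bar> \<le> real K * (1/4) ^ m" if b: "b < nb" for b
      unfolding p_def
    proof (rule run_product_program)
      show "run_layer (I b) x 0 = 2" by (simp add: run_layer_def I_def lin_form_def)
      show "run_layer (I b) x (5 + k) = 1 + ?f b k" if "k < K" for k
        using x[OF b that] that by (simp add: run_layer_def I_def lin_form_def)
      show "\<bar>?f b k\<bar> \<le> 1" if "k < K" for k using x[OF b that] .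
      show "0 \<le> run_layer (I b) x i" for i by (simp add: run_layer_def)
    qed
    have "\<bar>vec_index (realization net (Matrix.vec d x)) j - (\<Sum>b<nb. A j b * (\<Prod>k<K. ?f b k))\<bar>
       = \<bar>\<Sum>b<nb. A j b * (run_program p (run_layer (I b) x) 0 - 1 - (\<Prod>k<K. ?f b k))\<bar>"
      unfolding real[OF j] by (simp add: sum_subtractf[symmetric] right_diff_distrib)
    also have "\<dots> \<le> (\<Sum>b<nb. \<bar>A j b\<bar> * (real K * (1/4) ^ m))"
      by (rule order_trans[OF sum_abs]) (auto simp: abs_mult intro!: sum_mono mult_left_mono b)
    finally show "\<bar>vec_index (realization net (Matrix.vec d x)) j - (\<Sum>b<nb. A j b * (\<Prod>k<K. ?f b k))\<bar>
       \<le> (\<Sum>b<nb. \<bar>A j b\<bar>) * (real K * (1/4) ^ m)"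
      by (simp add: sum_distrib_right)
  qed
qed

subsection \<open>The uniform measure on the cube\<close>

definition uniform_interval :: "real measure" where
  "uniform_interval = scale_measure (1/2) (restrict_space lborel {-1..1})"

lemma space_uniform_interval [simp]: "space uniform_interval = {-1..1}"
  by (simp add: uniform_interval_def space_scale_measure space_restrict_space)

lemma sets_uniform_interval [simp, measurable_cong]: "sets uniform_interval = sets (restrict_space borel {-1..1})"
  by (simp add: uniform_interval_def sets_restrict_space)

lemma prob_space_uniform_interval: "prob_space uniform_interval"
proof (rule prob_spaceI)
  have "emeasure (restrict_space lborel {-1..1}) {-1..1::real} = 2"
    by (subst emeasure_restrict_space) auto
  moreover have "(1/2 :: ennreal) * 2 = 1"
    by (simp add: ennreal_divide_times divide_eq_1_ennreal)
  ultimately show "emeasure uniform_interval (space uniform_interval) = 1"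
    by (simp add: uniform_interval_def space_restrict_space space_scale_measure)
qed

interpretation uniform_interval: prob_space uniform_interval
  by (rule prob_space_uniform_interval)

lemma uniform_cube_eq: "uniform_cube = Pi\<^sub>M UNIV (\<lambda>_. uniform_interval)"
  by (simp add: uniform_cube_def uniform_interval_def)

interpretation uniform_cube: product_prob_space "\<lambda>_. uniform_interval" "UNIV :: nat set"
  by unfold_locales

lemma prob_space_uniform_cube: "prob_space uniform_cube"
  unfolding uniform_cube_eq by (rule uniform_cube.P.prob_space_axioms)

lemma space_uniform_cube: "space uniform_cube = param_cube"
  by (auto simp: uniform_cube_eq space_PiM param_cube_def)

lemma coordinate_measurable:
  assumes "continuous_on UNIV (h :: real \<Rightarrow> real)"
  shows "(\<lambda>y. h (y i)) \<in> borel_measurable uniform_cube"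
proof -
  have "h \<in> borel_measurable uniform_interval"
    using borel_measurable_continuous_onI[OF assms]
    by (subst measurable_cong_sets[OF sets_uniform_interval refl]) (rule measurable_restrict_space1)
  moreover have "(\<lambda>y. y i) \<in> measurable uniform_cube uniform_interval"
    unfolding uniform_cube_eq by (rule measurable_component_singleton) simp
  ultimately show ?thesis by (rule measurable_compose[rotated])
qed

lemma integrable_uniform_interval:
  fixes h :: "real \<Rightarrow> real"
  assumes "continuous_on UNIV h"
  shows "integrable uniform_interval h"
proof -
  have c: "continuous_on {-1..1} h" using assms by (rule continuous_on_subset) simp
  have "compact (h ` {-1..1})" by (rule compact_continuous_image[OF c]) simp
  then obtain B where B: "\<And>x. x \<in> {-1..1} \<Longrightarrow> norm (h x) \<le> B"
    by (meson bounded_iff compact_imp_bounded imageI)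
  show ?thesis
  proof (rule uniform_interval.integrable_const_bound[where B = B])
    show "AE x in uniform_interval. norm (h x) \<le> B" using B by (intro AE_I2) simp
    show "h \<in> borel_measurable uniform_interval"
      using borel_measurable_continuous_onI[OF assms]
      by (subst measurable_cong_sets[OF sets_uniform_interval refl]) (rule measurable_restrict_space1)
  qed
qed

lemma integral_uniform_cube_prod:
  fixes h :: "nat \<Rightarrow> real \<Rightarrow> real"
  assumes "\<And>i. continuous_on UNIV (h i)"
  shows "(\<integral>y. (\<Prod>i<d. h i (y i)) \<partial>uniform_cube) = (\<Prod>i<d. \<integral>x. h i x \<partial>uniform_interval)"
proof -
  let ?M = "\<lambda>_::nat. uniform_interval"
  have m: "(\<lambda>y. h i (y i)) \<in> borel_measurable (Pi\<^sub>M {..<d} ?M)" if "i \<in> {..<d}" for i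
  proof -
    have "h i \<in> borel_measurable uniform_interval"
      using integrable_uniform_interval[OF assms] by (rule borel_measurable_integrable)
    with measurable_component_singleton[OF that] show ?thesis by (rule measurable_compose)
  qed
  have "(\<Prod>i<d. \<integral>x. h i x \<partial>uniform_interval) = (\<integral>y. (\<Prod>i<d. h i (y i)) \<partial>Pi\<^sub>M {..<d} ?M)"
    using uniform_cube.product_integral_prod[of "{..<d}" h] integrable_uniform_interval[OF assms] by simp
  also have "\<dots> = (\<integral>y. (\<Prod>i<d. h i (y i)) \<partial>distr uniform_cube (Pi\<^sub>M {..<d} ?M) (\<lambda>x. restrict x {..<d}))"
    unfolding uniform_cube_eq
    by (subst uniform_cube.distr_PiM_restrict_finite) auto
  also have "\<dots> = (\<integral>y. (\<Prod>i<d. h i (restrict y {..<d} i)) \<partial>uniform_cube)"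
  proof (rule integral_distr)
    show "(\<lambda>x. restrict x {..<d}) \<in> measurable uniform_cube (Pi\<^sub>M {..<d} ?M)"
      unfolding uniform_cube_eq by (rule measurable_restrict_subset) simp
    show "(\<lambda>y. \<Prod>i<d. h i (y i)) \<in> borel_measurable (Pi\<^sub>M {..<d} ?M)"
      by (intro borel_measurable_prod m)
  qed
  also have "\<dots> = (\<integral>y. (\<Prod>i<d. h i (y i)) \<partial>uniform_cube)" by simp
  finally show ?thesis by simp
qed

subsection \<open>A weighted bound for Chebyshev sums in the uniform mean square\<close>

definition cheb_gram :: "nat \<Rightarrow> nat \<Rightarrow> real" where
  "cheb_gram n m = (\<integral>x. cheb n x * cheb m x \<partial>uniform_interval)"

text \<open>
  Coordinate \<open>i\<close> is used with \<open>\<epsilon> = \<rho>\<^sub>i\<^bsup>-2\<^esup>\<close>, which is summable, so that products of these weights over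
  the coordinates with \<open>\<kappa> i = 0\<close> stay bounded in every dimension.
\<close>

definition mean_weight :: "real \<Rightarrow> real \<Rightarrow> nat \<Rightarrow> real" where
  "mean_weight \<epsilon> q n = (if n < 2 then 1 + \<epsilon> else (1 + 1 / \<epsilon>) * (q ^ (2 * n) / (1 - inverse (q\<^sup>2))))"

lemma mean_weight_nonneg: "0 < \<epsilon> \<Longrightarrow> 1 < q \<Longrightarrow> 0 \<le> mean_weight \<epsilon> q n"
  by (auto simp: mean_weight_def inverse_le_1_iff intro!: mult_nonneg_nonneg divide_nonneg_nonneg)

lemma integral_id_uniform_interval: "(\<integral>x. x \<partial>uniform_interval) = 0"
proof -
  have "(\<integral>x. x * indicator {-1..1} x \<partial>lborel) = (0::real)"
    using integral_power[of "-1" 1 1] by simp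
  then have "(\<integral>x. x \<partial>restrict_space lborel {-1..1}) = (0::real)"
    by (subst integral_restrict_space) (auto simp: mult.commute)
  moreover have "(\<integral>x. x \<partial>uniform_interval) = 1/2 * (\<integral>x. x \<partial>restrict_space lborel {-1..1})"
  proof -
    have "(1/2 :: ennreal) = ennreal (1/2)" by (simp add: divide_ennreal_def)
    then have eq: "uniform_interval = density (restrict_space lborel {-1..1}) (\<lambda>_. ennreal (1/2))"
      unfolding uniform_interval_def by (intro measure_eqI) (auto simp: emeasure_density_const)
    show ?thesis unfolding eq by (subst integral_density) (auto simp: measurable_restrict_space1)
  qed
  ultimately show ?thesis by simp
qed

lemma young_square:
  fixes a h :: real
  assumes "0 < \<epsilon>"
  shows "(a + h)\<^sup>2 \<le> (1 + \<epsilon>) * a\<^sup>2 + (1 + 1 / \<epsilon>) * h\<^sup>2"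
proof -
  have "0 \<le> (sqrt \<epsilon> * a - h / sqrt \<epsilon>)\<^sup>2" by simp
  also have "\<dots> = \<epsilon> * a\<^sup>2 - 2 * a * h + h\<^sup>2 / \<epsilon>"
    using assms by (simp add: power2_diff power_mult_distrib power_divide)
  finally show ?thesis by (simp add: power2_sum algebra_simps)
qed

lemma cheb_mean_square_1d:
  assumes "0 < \<epsilon>" "1 < q"
  shows "(\<integral>x. (\<Sum>n\<le>N. c n * cheb n x)\<^sup>2 \<partial>uniform_interval) \<le> (\<Sum>n\<le>N. mean_weight \<epsilon> q n * (c n)\<^sup>2)"
proof -
  let ?K = "1 / (1 - inverse (q\<^sup>2))"
  define L where "L = {n. n \<le> N \<and> n < 2}"
  define U where "U = {n. n \<le> N \<and> 2 \<le> n}"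
  have split: "(\<Sum>n\<le>N. g n) = (\<Sum>n\<in>L. g n) + (\<Sum>n\<in>U. g n)" for g :: "nat \<Rightarrow> real"
  proof -
    have "{..N} = L \<union> U" "finite L" "finite U" "L \<inter> U = {}" by (auto simp: L_def U_def)
    then show ?thesis by (simp add: sum.union_disjoint)
  qed
  have fin: "finite U" "finite L" by (auto simp: U_def L_def)
  define c0 c1 where "c0 = c 0" and "c1 = (if 1 \<le> N then c 1 else 0)"
  have low: "(\<Sum>n\<in>L. c n * cheb n x) = c0 + c1 * x" for x
  proof (cases "1 \<le> N")
    case True
    then have "L = {0, 1}" by (auto simp: L_def)
    then show ?thesis using True by (simp add: c0_def c1_def)
  next
    case False
    then have "L = {0}" by (auto simp: L_def)
    then show ?thesis using False by (simp add: c0_def c1_def)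
  qed
  have low2: "(\<Sum>n\<in>L. (c n)\<^sup>2) = c0\<^sup>2 + c1\<^sup>2"
  proof (cases "1 \<le> N")
    case True
    then have "L = {0, 1}" by (auto simp: L_def)
    then show ?thesis using True by (simp add: c0_def c1_def)
  next
    case False
    then have "L = {0}" by (auto simp: L_def)
    then show ?thesis using False by (simp add: c0_def c1_def)
  qed
  define h where "h = (\<lambda>x. \<Sum>n\<in>U. c n * cheb n x)"
  have h: "(h x)\<^sup>2 \<le> ?K * (\<Sum>n\<in>U. q ^ (2 * n) * (c n)\<^sup>2)" if "\<bar>x\<bar> \<le> 1" for x
  proof -
    have "\<bar>h x\<bar> \<le> (\<Sum>n\<in>U. \<bar>c n\<bar>)"
      unfolding h_def using abs_cheb_le_1[OF that]
      by (intro order_trans[OF sum_abs] sum_mono) (simp add: abs_mult mult_left_le)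
    also have "\<dots> = (\<Sum>n\<in>U. (q ^ n * \<bar>c n\<bar>) * inverse (q ^ n))"
      using assms by (intro sum.cong) auto
    finally have "(h x)\<^sup>2 \<le> (\<Sum>n\<in>U. (q ^ n * \<bar>c n\<bar>) * inverse (q ^ n))\<^sup>2"
      by (metis abs_ge_zero power2_abs power_mono)
    also have "\<dots> \<le> (\<Sum>n\<in>U. (q ^ n * \<bar>c n\<bar>)\<^sup>2) * (\<Sum>n\<in>U. (inverse (q ^ n))\<^sup>2)"
      by (rule Cauchy_Schwarz_ineq_sum)
    also have "(\<Sum>n\<in>U. (q ^ n * \<bar>c n\<bar>)\<^sup>2) = (\<Sum>n\<in>U. q ^ (2 * n) * (c n)\<^sup>2)"
      by (simp add: power_mult_distrib power_mult[symmetric] mult.commute)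
    also have "(\<Sum>n\<in>U. q ^ (2 * n) * (c n)\<^sup>2) * (\<Sum>n\<in>U. (inverse (q ^ n))\<^sup>2)
        \<le> (\<Sum>n\<in>U. q ^ (2 * n) * (c n)\<^sup>2) * ?K"
    proof (intro mult_left_mono sum_nonneg)
      have q2: "inverse (q\<^sup>2) < 1" "0 \<le> inverse (q\<^sup>2)" using assms by (auto simp: inverse_less_1_iff one_less_power)
      have "(\<Sum>n\<in>U. (inverse (q ^ n))\<^sup>2) = (\<Sum>n\<in>U. inverse (q\<^sup>2) ^ n)"
        by (simp add: power_inverse power_mult[symmetric] mult.commute)
      also have "\<dots> \<le> (\<Sum>n. inverse (q\<^sup>2) ^ n)"
        using q2 fin by (intro sum_le_suminf summable_geometric) auto
      also have "\<dots> = ?K" using q2 by (intro suminf_geometric) auto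
      finally show "(\<Sum>n\<in>U. (inverse (q ^ n))\<^sup>2) \<le> ?K" .
    qed (use assms in auto)
    finally show ?thesis by (simp only: mult.commute)
  qed
  define H where "H = ?K * (\<Sum>n\<in>U. q ^ (2 * n) * (c n)\<^sup>2)"
  have "(\<integral>x. (\<Sum>n\<le>N. c n * cheb n x)\<^sup>2 \<partial>uniform_interval)
      \<le> (\<integral>x. (1 + \<epsilon>) * (c0\<^sup>2 + 2 * c0 * c1 * x + c1\<^sup>2) + (1 + 1 / \<epsilon>) * H \<partial>uniform_interval)"
  proof (rule integral_mono)
    show "integrable uniform_interval (\<lambda>x. (\<Sum>n\<le>N. c n * cheb n x)\<^sup>2)"
      "integrable uniform_interval (\<lambda>x. (1 + \<epsilon>) * (c0\<^sup>2 + 2 * c0 * c1 * x + c1\<^sup>2) + (1 + 1 / \<epsilon>) * H)"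
      by (intro integrable_uniform_interval continuous_intros)+
    fix x assume "x \<in> space uniform_interval"
    then have x: "\<bar>x\<bar> \<le> 1" by auto
    have "(\<Sum>n\<le>N. c n * cheb n x)\<^sup>2 = ((c0 + c1 * x) + h x)\<^sup>2" by (simp add: split low h_def)
    also have "\<dots> \<le> (1 + \<epsilon>) * (c0 + c1 * x)\<^sup>2 + (1 + 1 / \<epsilon>) * (h x)\<^sup>2" by (rule young_square[OF assms(1)])
    also have "(c0 + c1 * x)\<^sup>2 \<le> c0\<^sup>2 + 2 * c0 * c1 * x + c1\<^sup>2"
    proof -
      have "c1\<^sup>2 * x\<^sup>2 \<le> c1\<^sup>2 * 1" using x by (intro mult_left_mono) (auto simp: abs_square_le_1)
      then show ?thesis by (simp add: power2_sum power_mult_distrib)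
    qed
    also have "(h x)\<^sup>2 \<le> H" unfolding H_def by (rule h[OF x])
    finally show "(\<Sum>n\<le>N. c n * cheb n x)\<^sup>2 \<le> (1 + \<epsilon>) * (c0\<^sup>2 + 2 * c0 * c1 * x + c1\<^sup>2) + (1 + 1 / \<epsilon>) * H"
      using assms(1) by (simp add: mult_left_mono)
  qed
  also have "\<dots> = (1 + \<epsilon>) * (c0\<^sup>2 + c1\<^sup>2) + (1 + 1 / \<epsilon>) * H"
  proof -
    have i: "integrable uniform_interval (\<lambda>x::real. x)" by (intro integrable_uniform_interval continuous_intros)
    have "(\<lambda>x. (1 + \<epsilon>) * (c0\<^sup>2 + 2 * c0 * c1 * x + c1\<^sup>2) + (1 + 1 / \<epsilon>) * H)
      = (\<lambda>x. ((1 + \<epsilon>) * (2 * c0 * c1)) * x + ((1 + \<epsilon>) * (c0\<^sup>2 + c1\<^sup>2) + (1 + 1 / \<epsilon>) * H))"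
      by (simp add: fun_eq_iff algebra_simps)
    then show ?thesis using i
      by (simp add: integral_id_uniform_interval uniform_interval.prob_space[unfolded space_uniform_interval])
  qed
  also have "\<dots> = (\<Sum>n\<le>N. mean_weight \<epsilon> q n * (c n)\<^sup>2)"
  proof -
    have "(\<Sum>n\<in>L. mean_weight \<epsilon> q n * (c n)\<^sup>2) = (1 + \<epsilon>) * (c0\<^sup>2 + c1\<^sup>2)"
      unfolding low2[symmetric] sum_distrib_left by (intro sum.cong) (auto simp: L_def mean_weight_def)
    moreover have "(\<Sum>n\<in>U. mean_weight \<epsilon> q n * (c n)\<^sup>2) = (1 + 1 / \<epsilon>) * H"
      unfolding H_def sum_distrib_left by (intro sum.cong) (auto simp: U_def mean_weight_def)
    ultimately show ?thesis by (simp add: split)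
  qed
  finally show ?thesis .
qed

lemma cheb_gram_tensor:
  fixes \<epsilon> q :: "nat \<Rightarrow> real" and N :: nat
  assumes eq: "\<And>i. 0 < \<epsilon> i" "\<And>i. 1 < q i"
  defines "K \<equiv> \<lambda>d. PiE {..<d} (\<lambda>_. {..N})"
  shows "(\<Sum>\<kappa>\<in>K d. \<Sum>\<kappa>'\<in>K d. c \<kappa> * c \<kappa>' * (\<Prod>i<d. cheb_gram (\<kappa> i) (\<kappa>' i)))
      \<le> (\<Sum>\<kappa>\<in>K d. (c \<kappa>)\<^sup>2 * (\<Prod>i<d. mean_weight (\<epsilon> i) (q i) (\<kappa> i)))"
proof (induction d arbitrary: c)
  case 0
  show ?case by (simp add: K_def power2_eq_square)
next
  case (Suc d)
  let ?C = "\<lambda>\<kappa> x. \<Sum>n\<le>N. c (\<kappa>(d := n)) * cheb n x"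
  let ?G = "\<lambda>\<kappa> \<kappa>'. \<Prod>i<d. cheb_gram (\<kappa> i) (\<kappa>' i)"
  let ?W = "\<lambda>\<kappa>. \<Prod>i<d. mean_weight (\<epsilon> i) (q i) (\<kappa> i)"
  have int: "integrable uniform_interval f" if "continuous_on UNIV f" for f :: "real \<Rightarrow> real"
    using that by (rule integrable_uniform_interval)
  have CC: "(\<integral>x. ?C \<kappa> x * ?C \<kappa>' x \<partial>uniform_interval) = (\<Sum>n\<le>N. \<Sum>m\<le>N. c (\<kappa>(d := n)) * c (\<kappa>'(d := m)) * cheb_gram n m)" for \<kappa> \<kappa>'
  proof -
    have "(\<integral>x. ?C \<kappa> x * ?C \<kappa>' x \<partial>uniform_interval)
       = (\<integral>x. (\<Sum>n\<le>N. \<Sum>m\<le>N. (c (\<kappa>(d := n)) * c (\<kappa>'(d := m))) * (cheb n x * cheb m x)) \<partial>uniform_interval)"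
      unfolding sum_product by (simp add: mult_ac)
    also have "\<dots> = (\<Sum>n\<le>N. \<Sum>m\<le>N. (c (\<kappa>(d := n)) * c (\<kappa>'(d := m))) * cheb_gram n m)"
      unfolding cheb_gram_def
      by (subst Bochner_Integration.integral_sum, intro int continuous_intros, rule sum.cong[OF refl],
          subst Bochner_Integration.integral_sum, intro int continuous_intros, simp)
    finally show ?thesis .
  qed
  have up: "(\<Prod>i<d. cheb_gram ((\<kappa>(d := n)) i) ((\<kappa>'(d := m)) i)) = ?G \<kappa> \<kappa>'"
     "(\<Prod>i<d. mean_weight (\<epsilon> i) (q i) ((\<kappa>(d := n)) i)) = ?W \<kappa>" for \<kappa> \<kappa>' n m
    by (auto intro!: prod.cong)
  have "(\<Sum>\<kappa>\<in>K (Suc d). \<Sum>\<kappa>'\<in>K (Suc d). c \<kappa> * c \<kappa>' * (\<Prod>i<Suc d. cheb_gram (\<kappa> i) (\<kappa>' i)))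
      = (\<Sum>\<kappa>\<in>K d. \<Sum>n\<le>N. \<Sum>\<kappa>'\<in>K d. \<Sum>m\<le>N. c (\<kappa>(d := n)) * c (\<kappa>'(d := m)) * (?G \<kappa> \<kappa>' * cheb_gram n m))"
    unfolding K_def sum_PiE_Suc by (simp only: prod.lessThan_Suc up fun_upd_same)
  also have "\<dots> = (\<Sum>\<kappa>\<in>K d. \<Sum>\<kappa>'\<in>K d. ?G \<kappa> \<kappa>' * (\<integral>x. ?C \<kappa> x * ?C \<kappa>' x \<partial>uniform_interval))"
    unfolding CC unfolding sum_distrib_left
    by (rule sum.cong[OF refl], subst sum.swap) (simp add: mult_ac)
  also have "\<dots> = (\<integral>x. (\<Sum>\<kappa>\<in>K d. \<Sum>\<kappa>'\<in>K d. ?C \<kappa> x * ?C \<kappa>' x * ?G \<kappa> \<kappa>') \<partial>uniform_interval)"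
    by (subst Bochner_Integration.integral_sum, intro int continuous_intros, rule sum.cong[OF refl],
          subst Bochner_Integration.integral_sum, intro int continuous_intros, simp add: mult.commute)
  also have "\<dots> \<le> (\<integral>x. (\<Sum>\<kappa>\<in>K d. (?C \<kappa> x)\<^sup>2 * ?W \<kappa>) \<partial>uniform_interval)"
    by (intro integral_mono int continuous_intros Suc.IH)
  also have "\<dots> = (\<Sum>\<kappa>\<in>K d. (\<integral>x. (?C \<kappa> x)\<^sup>2 \<partial>uniform_interval) * ?W \<kappa>)"
    by (subst Bochner_Integration.integral_sum, intro int continuous_intros) simp
  also have "\<dots> \<le> (\<Sum>\<kappa>\<in>K d. (\<Sum>n\<le>N. mean_weight (\<epsilon> d) (q d) n * (c (\<kappa>(d := n)))\<^sup>2) * ?W \<kappa>)"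
    by (intro sum_mono mult_right_mono cheb_mean_square_1d eq prod_nonneg) (auto simp: mean_weight_nonneg eq)
  also have "\<dots> = (\<Sum>\<kappa>\<in>K (Suc d). (c \<kappa>)\<^sup>2 * (\<Prod>i<Suc d. mean_weight (\<epsilon> i) (q i) (\<kappa> i)))"
    unfolding K_def sum_PiE_Suc sum_distrib_right by (simp only: prod.lessThan_Suc up fun_upd_same mult_ac)
  finally show ?case .
qed

theorem cheb_mean_square:
  fixes \<epsilon> q :: "nat \<Rightarrow> real" and c :: "(nat \<Rightarrow> nat) \<Rightarrow> real" and d N :: nat
  assumes "\<And>i. 0 < \<epsilon> i" "\<And>i. 1 < q i"
  defines "K \<equiv> PiE {..<d} (\<lambda>_. {..N})"
  shows "integrable uniform_cube (\<lambda>y. (\<Sum>\<kappa>\<in>K. c \<kappa> * (\<Prod>i<d. cheb (\<kappa> i) (y i)))\<^sup>2)"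
    "(\<integral>y. (\<Sum>\<kappa>\<in>K. c \<kappa> * (\<Prod>i<d. cheb (\<kappa> i) (y i)))\<^sup>2 \<partial>uniform_cube)
      \<le> (\<Sum>\<kappa>\<in>K. (c \<kappa>)\<^sup>2 * (\<Prod>i<d. mean_weight (\<epsilon> i) (q i) (\<kappa> i)))"
proof -
  interpret prob_space uniform_cube by (rule prob_space_uniform_cube)
  have int: "integrable uniform_cube (\<lambda>y. \<Prod>i<d. cheb (\<kappa> i) (y i) * cheb (\<kappa>' i) (y i))" for \<kappa> \<kappa>' :: "nat \<Rightarrow> nat"
  proof (rule integrable_const_bound[where B = 1])
    show "AE y in uniform_cube. norm (\<Prod>i<d. cheb (\<kappa> i) (y i) * cheb (\<kappa>' i) (y i)) \<le> 1"
    proof (rule AE_I2)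
      fix y assume "y \<in> space uniform_cube"
      then have y: "\<bar>y i\<bar> \<le> 1" for i by (auto simp: space_uniform_cube param_cube_def abs_le_iff)
      show "norm (\<Prod>i<d. cheb (\<kappa> i) (y i) * cheb (\<kappa>' i) (y i)) \<le> 1"
        unfolding prod_norm[symmetric] using abs_cheb_le_1[OF y]
        by (intro prod_le_1) (auto simp: abs_mult intro: mult_le_one)
    qed
    show "(\<lambda>y. \<Prod>i<d. cheb (\<kappa> i) (y i) * cheb (\<kappa>' i) (y i)) \<in> borel_measurable uniform_cube"
      by (intro borel_measurable_prod coordinate_measurable[where h = "\<lambda>x. cheb _ x * cheb _ x"] continuous_intros)
  qed
  have sq: "(\<Sum>\<kappa>\<in>K. c \<kappa> * (\<Prod>i<d. cheb (\<kappa> i) (y i)))\<^sup>2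
     = (\<Sum>\<kappa>\<in>K. \<Sum>\<kappa>'\<in>K. c \<kappa> * c \<kappa>' * (\<Prod>i<d. cheb (\<kappa> i) (y i) * cheb (\<kappa>' i) (y i)))" for y
    unfolding power2_eq_square sum_product prod.distrib by (simp only: mult_ac)
  show "integrable uniform_cube (\<lambda>y. (\<Sum>\<kappa>\<in>K. c \<kappa> * (\<Prod>i<d. cheb (\<kappa> i) (y i)))\<^sup>2)"
    unfolding sq by (intro Bochner_Integration.integrable_sum integrable_mult_right int)
  have "(\<integral>y. (\<Sum>\<kappa>\<in>K. c \<kappa> * (\<Prod>i<d. cheb (\<kappa> i) (y i)))\<^sup>2 \<partial>uniform_cube)
      = (\<Sum>\<kappa>\<in>K. \<Sum>\<kappa>'\<in>K. c \<kappa> * c \<kappa>' * (\<integral>y. (\<Prod>i<d. cheb (\<kappa> i) (y i) * cheb (\<kappa>' i) (y i)) \<partial>uniform_cube))"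
    unfolding sq
    by (subst Bochner_Integration.integral_sum, intro Bochner_Integration.integrable_sum integrable_mult_right int,
        rule sum.cong[OF refl], subst Bochner_Integration.integral_sum, intro integrable_mult_right int, simp)
  also have "\<dots> = (\<Sum>\<kappa>\<in>K. \<Sum>\<kappa>'\<in>K. c \<kappa> * c \<kappa>' * (\<Prod>i<d. cheb_gram (\<kappa> i) (\<kappa>' i)))"
  proof (intro sum.cong refl arg_cong2[where f = "(*)"])
    fix \<kappa> \<kappa>' :: "nat \<Rightarrow> nat"
    show "(\<integral>y. (\<Prod>i<d. cheb (\<kappa> i) (y i) * cheb (\<kappa>' i) (y i)) \<partial>uniform_cube) = (\<Prod>i<d. cheb_gram (\<kappa> i) (\<kappa>' i))"
      unfolding cheb_gram_def
      by (rule integral_uniform_cube_prod[where h = "\<lambda>i x. cheb (\<kappa> i) x * cheb (\<kappa>' i) x"]) (intro continuous_intros)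
  qed
  also have "\<dots> \<le> (\<Sum>\<kappa>\<in>K. (c \<kappa>)\<^sup>2 * (\<Prod>i<d. mean_weight (\<epsilon> i) (q i) (\<kappa> i)))"
    unfolding K_def by (rule cheb_gram_tensor[OF assms(1,2)])
  finally show "(\<integral>y. (\<Sum>\<kappa>\<in>K. c \<kappa> * (\<Prod>i<d. cheb (\<kappa> i) (y i)))\<^sup>2 \<partial>uniform_cube)
      \<le> (\<Sum>\<kappa>\<in>K. (c \<kappa>)\<^sup>2 * (\<Prod>i<d. mean_weight (\<epsilon> i) (q i) (\<kappa> i)))" .
qed

subsection \<open>Riesz bases\<close>

lemma riesz_basisE:
  fixes \<psi> :: "nat \<Rightarrow> 'a::real_inner"
  assumes "riesz_basis \<psi>"
  obtains e :: "nat \<Rightarrow> 'a" and T :: "'a \<Rightarrow> 'a" where "orthonormal_basis e" "bounded_linear T" "bij T" "\<And>j. \<psi> j = T (e j)"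
  using assms unfolding riesz_basis_def by (elim exE conjE) (rule that; (assumption | erule spec))

lemma orthonormal_bessel:
  fixes e :: "nat \<Rightarrow> 'a::real_inner"
  assumes "orthonormal_basis e" "finite A"
  shows "(\<Sum>j\<in>A. (inner z (e j))\<^sup>2) \<le> (norm z)\<^sup>2"
proof -
  have on: "inner (e i) (e j) = (if i = j then 1 else 0)" for i j
    using assms by (simp add: orthonormal_basis_def)
  let ?p = "\<Sum>j\<in>A. inner z (e j) *\<^sub>R e j"
  have pp: "inner ?p ?p = (\<Sum>j\<in>A. (inner z (e j))\<^sup>2)"
    using assms(2) by (simp add: inner_sum_left inner_sum_right on power2_eq_square if_distrib cong: if_cong)
  have zp: "inner z ?p = (\<Sum>j\<in>A. (inner z (e j))\<^sup>2)"
    by (simp add: inner_sum_right power2_eq_square)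
  have "0 \<le> inner (z - ?p) (z - ?p)" by simp
  also have "\<dots> = inner z z - 2 * inner z ?p + inner ?p ?p"
    by (simp add: inner_diff_left inner_diff_right inner_commute)
  finally show ?thesis unfolding pp zp by (simp add: power2_norm_eq_inner)
qed

lemma orthonormal_sum_norm:
  fixes e :: "nat \<Rightarrow> 'a::real_inner"
  assumes "orthonormal_basis e" "finite A"
  shows "(norm (\<Sum>j\<in>A. c j *\<^sub>R e j))\<^sup>2 = (\<Sum>j\<in>A. (c j)\<^sup>2)"
proof -
  have on: "inner (e i) (e j) = (if i = j then 1 else 0)" for i j
    using assms by (simp add: orthonormal_basis_def)
  show ?thesis unfolding power2_norm_eq_inner
    using assms(2) by (simp add: inner_sum_left inner_sum_right on power2_eq_square if_distrib cong: if_cong)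
qed

lemma orthonormal_coeff_dual:
  fixes e \<psi>d :: "nat \<Rightarrow> 'a::real_inner"
  assumes e: "orthonormal_basis e" and T: "bounded_linear T" and d: "dual_basis (\<lambda>j. T (e j)) \<psi>d"
  shows "inner (T z) (\<psi>d j) = inner z (e j)"
proof -
  interpret T: bounded_linear T by fact
  have "z \<in> closure (span (range e))" using e by (simp add: orthonormal_basis_def)
  then have "inner (T z) (\<psi>d j) - inner z (e j) = 0"
  proof (rule continuous_constant_on_closure[rotated 2])
    show "continuous_on (closure (span (range e))) (\<lambda>z. inner (T z) (\<psi>d j) - inner z (e j))"
      by (intro continuous_intros T.continuous_on)
    fix x assume "x \<in> span (range e)"
    then show "inner (T x) (\<psi>d j) - inner x (e j) = 0"
    proof (induction rule: span_induct_alt)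
      case (step c x y)
      then obtain i where "x = e i" by auto
      with step e d show ?case
        by (simp add: T.add T.scaleR inner_add_left orthonormal_basis_def dual_basis_def)
    qed (simp add: T.zero)
  qed
  then show ?thesis by simp
qed

lemma riesz_basis_summable:
  fixes \<psi> :: "nat \<Rightarrow> 'a::real_inner"
  assumes "riesz_basis \<psi>" "dual_basis \<psi> \<psi>d"
  shows "summable (\<lambda>j. (inner x (\<psi>d j))\<^sup>2)"
proof -
  obtain e :: "nat \<Rightarrow> 'a" and T :: "'a \<Rightarrow> 'a" where e: "orthonormal_basis e" and T: "bounded_linear T" "bij T" "\<And>j. \<psi> j = T (e j)"
    by (rule riesz_basisE[OF assms(1)], rule that)
  obtain z where z: "x = T z" using T(2) by (metis bij_pointE)
  have "dual_basis (\<lambda>j. T (e j)) \<psi>d" using assms(2) T(3) by (simp add: dual_basis_def)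
  then have "inner x (\<psi>d j) = inner z (e j)" for j
    unfolding z by (rule orthonormal_coeff_dual[OF e T(1)])
  then show ?thesis
    using orthonormal_bessel[OF e, of "{..<n}" z for n] by (auto intro!: summableI_nonneg_bounded)
qed

lemma riesz_basis_total:
  fixes \<psi> :: "nat \<Rightarrow> 'a::real_inner"
  assumes "riesz_basis \<psi>" "dual_basis \<psi> \<psi>d" "\<And>j. inner x (\<psi>d j) = 0"
  shows "x = 0"
proof -
  obtain e :: "nat \<Rightarrow> 'a" and T :: "'a \<Rightarrow> 'a" where e: "orthonormal_basis e" and T: "bounded_linear T" "bij T" "\<And>j. \<psi> j = T (e j)"
    by (rule riesz_basisE[OF assms(1)], rule that)
  obtain z where z: "x = T z" using T(2) by (metis bij_pointE)
  have "dual_basis (\<lambda>j. T (e j)) \<psi>d" using assms(2) T(3) by (simp add: dual_basis_def)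
  then have ze: "inner z (e j) = 0" for j
    using orthonormal_coeff_dual[OF e T(1), of \<psi>d z j] assms(3)[of j] by (simp add: z)
  have "z \<in> closure (span (range e))" using e by (simp add: orthonormal_basis_def)
  then have "inner z z = 0"
  proof (rule continuous_constant_on_closure[where f = "\<lambda>y. inner z y" and x = z, rotated 2])
    show "continuous_on (closure (span (range e))) (\<lambda>y. inner z y)" by (intro continuous_intros)
    fix y assume "y \<in> span (range e)"
    then show "inner z y = 0"
      by (induction rule: span_induct_alt) (auto simp: inner_add_right ze)
  qed
  then show ?thesis using T(1) by (simp add: z linear_0 bounded_linear.linear)
qed

lemma riesz_basis_sum_bound:
  fixes \<psi> :: "nat \<Rightarrow> 'a::real_inner"
  assumes "riesz_basis \<psi>"
  obtains B where "0 < B" "\<And>A c. finite A \<Longrightarrow> norm (\<Sum>j\<in>A. c j *\<^sub>R \<psi> j) \<le> B * sqrt (\<Sum>j\<in>A. (c j)\<^sup>2)"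
proof -
  obtain e :: "nat \<Rightarrow> 'a" and T :: "'a \<Rightarrow> 'a" where e: "orthonormal_basis e" and T: "bounded_linear T" "bij T" "\<And>j. \<psi> j = T (e j)"
    by (rule riesz_basisE[OF assms(1)], rule that)
  interpret T: bounded_linear T by fact
  obtain B where B: "0 < B" "\<And>x. norm (T x) \<le> norm x * B" using T.pos_bounded by blast
  show ?thesis
  proof (rule that[OF B(1)])
    fix A :: "nat set" and c :: "nat \<Rightarrow> real" assume A: "finite A"
    have "norm (\<Sum>j\<in>A. c j *\<^sub>R \<psi> j) = norm (T (\<Sum>j\<in>A. c j *\<^sub>R e j))"
      by (simp add: T T.sum T.scaleR)
    also have "\<dots> \<le> norm (\<Sum>j\<in>A. c j *\<^sub>R e j) * B" by (rule B)
    also have "norm (\<Sum>j\<in>A. c j *\<^sub>R e j) = sqrt (\<Sum>j\<in>A. (c j)\<^sup>2)"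
      using orthonormal_sum_norm[OF e A, of c] by (metis norm_ge_zero real_sqrt_unique)
    finally show "norm (\<Sum>j\<in>A. c j *\<^sub>R \<psi> j) \<le> B * sqrt (\<Sum>j\<in>A. (c j)\<^sup>2)" by (simp add: mult.commute)
  qed
qed

lemma encoder_nth:
  assumes "riesz_basis \<psi>" "dual_basis \<psi> \<psi>d"
  shows "ell2_nth (encoder \<psi>d x) j = inner x (\<psi>d j)"
  using riesz_basis_summable[OF assms] by (simp add: encoder_def Abs_ell2_inverse)

subsection \<open>Frames\<close>

lemma frame_bessel:
  fixes \<eta> :: "nat \<Rightarrow> 'a::real_inner"
  assumes "is_frame \<eta>"
  obtains B where "0 < B" "\<And>v. (\<Sum>j. (inner v (\<eta> j))\<^sup>2) \<le> (B * norm v)\<^sup>2"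
proof -
  have s: "summable (\<lambda>j. (inner v (\<eta> j))\<^sup>2)" for v using assms by (simp add: is_frame_def)
  interpret F: bounded_linear "analysis_op \<eta>" using assms by (simp add: is_frame_def)
  obtain B where B: "0 < B" "\<And>v. norm (analysis_op \<eta> v) \<le> norm v * B" using F.pos_bounded by blast
  have nth: "ell2_nth (analysis_op \<eta> v) j = inner v (\<eta> j)" for v j
    by (simp add: analysis_op_def Abs_ell2_inverse s)
  have n: "(norm (analysis_op \<eta> v))\<^sup>2 = (\<Sum>j. (inner v (\<eta> j))\<^sup>2)" for v
    by (simp only: power2_norm_eq_inner inner_ell2.rep_eq nth) (simp only: power2_eq_square)
  have "(\<Sum>j. (inner v (\<eta> j))\<^sup>2) \<le> (B * norm v)\<^sup>2" for v
    unfolding n[symmetric] using B(2)[of v] by (intro power_mono) (auto simp: mult.commute)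
  with B(1) that show ?thesis by blast
qed

lemma frame_sum_bound:
  fixes \<eta> :: "nat \<Rightarrow> 'a::real_inner"
  assumes "is_frame \<eta>"
  obtains B where "0 < B" "\<And>A c. finite A \<Longrightarrow> norm (\<Sum>j\<in>A. c j *\<^sub>R \<eta> j) \<le> B * sqrt (\<Sum>j\<in>A. (c j)\<^sup>2)"
proof -
  obtain B where B: "0 < B" "\<And>v. (\<Sum>j. (inner v (\<eta> j))\<^sup>2) \<le> (B * norm v)\<^sup>2"
    using frame_bessel[OF assms] by blast
  have s: "summable (\<lambda>j. (inner v (\<eta> j))\<^sup>2)" for v using assms by (simp add: is_frame_def)
  show ?thesis
  proof (rule that[OF B(1)])
    fix A :: "nat set" and c :: "nat \<Rightarrow> real" assume A: "finite A"
    define u where "u = (\<Sum>j\<in>A. c j *\<^sub>R \<eta> j)"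
    have "(\<Sum>j\<in>A. (inner u (\<eta> j))\<^sup>2) \<le> (B * norm u)\<^sup>2"
      using sum_le_suminf[OF s A, of u] B(2)[of u] by simp
    then have 1: "sqrt (\<Sum>j\<in>A. (inner u (\<eta> j))\<^sup>2) \<le> B * norm u"
      using B(1) by (simp add: real_le_lsqrt)
    have "(norm u)\<^sup>2 = inner u (\<Sum>j\<in>A. c j *\<^sub>R \<eta> j)" by (simp add: power2_norm_eq_inner u_def)
    also have "\<dots> = (\<Sum>j\<in>A. c j * inner u (\<eta> j))" by (simp add: inner_sum_right)
    also have "\<dots> \<le> sqrt ((\<Sum>j\<in>A. c j * inner u (\<eta> j))\<^sup>2)" by simp
    also have "\<dots> \<le> sqrt ((\<Sum>j\<in>A. (c j)\<^sup>2) * (\<Sum>j\<in>A. (inner u (\<eta> j))\<^sup>2))"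
      by (intro real_sqrt_le_mono Cauchy_Schwarz_ineq_sum)
    also have "\<dots> \<le> sqrt (\<Sum>j\<in>A. (c j)\<^sup>2) * (B * norm u)"
      unfolding real_sqrt_mult using 1 by (intro mult_left_mono) (auto intro: sum_nonneg)
    finally have "norm u * norm u \<le> (B * sqrt (\<Sum>j\<in>A. (c j)\<^sup>2)) * norm u"
      by (simp add: power2_eq_square mult_ac)
    then have "norm u \<le> B * sqrt (\<Sum>j\<in>A. (c j)\<^sup>2)"
      using B(1) by (cases "norm u = 0") (auto intro!: mult_nonneg_nonneg real_sqrt_ge_zero sum_nonneg)
    then show "norm (\<Sum>j\<in>A. c j *\<^sub>R \<eta> j) \<le> B * sqrt (\<Sum>j\<in>A. (c j)\<^sup>2)" by (simp add: u_def)
  qed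
qed

lemma frame_synthesis_summable:
  fixes \<eta> :: "nat \<Rightarrow> 'a::{real_inner, complete_space}"
  assumes "is_frame \<eta>" "summable (\<lambda>j. (c j)\<^sup>2)"
  shows "summable (\<lambda>j. c j *\<^sub>R \<eta> j)"
proof -
  obtain B where B: "0 < B" "\<And>A c. finite A \<Longrightarrow> norm (\<Sum>j\<in>A. c j *\<^sub>R \<eta> j) \<le> B * sqrt (\<Sum>j\<in>A. (c j)\<^sup>2)"
    using frame_sum_bound[OF assms(1)] by blast
  have "Cauchy (\<lambda>n. \<Sum>j<n. c j *\<^sub>R \<eta> j)"
  proof (rule CauchyI')
    fix e :: real assume "0 < e"
    then have "0 < (e / B)\<^sup>2" using B by simp
    with assms(2) obtain N where N: "\<And>m n. m \<ge> N \<Longrightarrow> norm (\<Sum>j\<in>{m..<n}. (c j)\<^sup>2) < (e / B)\<^sup>2"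
      unfolding summable_Cauchy by blast
    show "\<exists>M. \<forall>m\<ge>M. \<forall>n>m. dist (\<Sum>j<m. c j *\<^sub>R \<eta> j) (\<Sum>j<n. c j *\<^sub>R \<eta> j) < e"
    proof (intro exI[of _ N] allI impI)
      fix m n :: nat assume mn: "N \<le> m" "m < n"
      have "(\<Sum>j<n. c j *\<^sub>R \<eta> j) - (\<Sum>j<m. c j *\<^sub>R \<eta> j) = (\<Sum>j\<in>{m..<n}. c j *\<^sub>R \<eta> j)"
        using mn sum_diff_nat_ivl[of 0 m n "\<lambda>j. c j *\<^sub>R \<eta> j"] by (simp add: atLeast0LessThan)
      then have "dist (\<Sum>j<m. c j *\<^sub>R \<eta> j) (\<Sum>j<n. c j *\<^sub>R \<eta> j) = norm (\<Sum>j\<in>{m..<n}. c j *\<^sub>R \<eta> j)"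
        by (metis dist_commute dist_norm)
      also have "\<dots> \<le> B * sqrt (\<Sum>j\<in>{m..<n}. (c j)\<^sup>2)" by (intro B) simp
      also have "\<dots> < B * (e / B)"
      proof (intro mult_strict_left_mono B)
        have "(\<Sum>j\<in>{m..<n}. (c j)\<^sup>2) < (e / B)\<^sup>2" using N[OF mn(1), of n] by (simp add: sum_nonneg)
        then show "sqrt (\<Sum>j\<in>{m..<n}. (c j)\<^sup>2) < e / B"
          using \<open>0 < e\<close> B by (intro real_less_lsqrt) (auto simp: sum_nonneg)
      qed
      finally show "dist (\<Sum>j<m. c j *\<^sub>R \<eta> j) (\<Sum>j<n. c j *\<^sub>R \<eta> j) < e" using B by simp
    qed
  qed
  then show ?thesis by (simp add: summable_iff_convergent Cauchy_convergent)
qed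

lemma frame_adjoint:
  fixes \<eta> :: "nat \<Rightarrow> 'a::{real_inner, complete_space}"
  assumes "is_frame \<eta>"
  shows "adjoint (analysis_op \<eta>) c = (\<Sum>j. ell2_nth c j *\<^sub>R \<eta> j)"
proof -
  have s: "summable (\<lambda>j. (inner v (\<eta> j))\<^sup>2)" for v using assms by (simp add: is_frame_def)
  have ex: "\<forall>v c. inner (analysis_op \<eta> v) c = inner v (\<Sum>j. ell2_nth c j *\<^sub>R \<eta> j)"
  proof (intro allI)
    fix v and c :: ell2
    have sc: "summable (\<lambda>j. ell2_nth c j *\<^sub>R \<eta> j)"
      using ell2_nth[of c] by (intro frame_synthesis_summable[OF assms]) simp
    have "inner v (\<Sum>j. ell2_nth c j *\<^sub>R \<eta> j) = (\<Sum>j. inner v (ell2_nth c j *\<^sub>R \<eta> j))"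
      by (rule bounded_linear.suminf[OF bounded_linear_inner_right sc])
    then show "inner (analysis_op \<eta> v) c = inner v (\<Sum>j. ell2_nth c j *\<^sub>R \<eta> j)"
      by (simp add: inner_ell2.rep_eq analysis_op_def Abs_ell2_inverse s mult.commute)
  qed
  then have "\<exists>f'. \<forall>x y. inner (analysis_op \<eta> x) y = inner x (f' y)" by (intro exI)
  then have adj: "\<forall>x y. inner (analysis_op \<eta> x) y = inner x (adjoint (analysis_op \<eta>) y)"
    unfolding adjoint_def by (rule someI_ex)
  have "inner v (adjoint (analysis_op \<eta>) c) = inner v (\<Sum>j. ell2_nth c j *\<^sub>R \<eta> j)" for v
    using spec[OF spec[OF ex, of v], of c] spec[OF spec[OF adj, of v], of c] by simp
  then have "\<forall>v. inner v (adjoint (analysis_op \<eta>) c) = inner v (\<Sum>j. ell2_nth c j *\<^sub>R \<eta> j)" by (rule allI)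
  then show ?thesis by (rule vector_eq_ldot[THEN iffD1])
qed

lemma coercive_bij:
  fixes S :: "'a::{real_inner, complete_space} \<Rightarrow> 'a"
  assumes "linear S" "\<And>v. norm (S v) \<le> b * norm v" "\<And>v. a * (norm v)\<^sup>2 \<le> inner (S v) v" "0 < a"
  shows "bij S"
proof -
  interpret S: linear S by fact
  define B where "B = \<bar>b\<bar> + a"
  have B: "0 < B" "a \<le> B" "\<And>v. norm (S v) \<le> B * norm v"
    using assms(4) order_trans[OF assms(2) mult_right_mono[of b "\<bar>b\<bar> + a"]] by (auto simp: B_def)
  define c where "c = sqrt (1 - (a / B)\<^sup>2)"
  have ab: "0 < a / B" "a / B \<le> 1" using B assms(4) by (auto simp: field_simps)
  then have ab2: "(a / B)\<^sup>2 \<le> 1" by (simp add: abs_square_le_1)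
  have c: "0 \<le> c" "c < 1" "c\<^sup>2 = 1 - (a / B)\<^sup>2"
    using ab ab2 by (auto simp: c_def real_sqrt_lt_1_iff)
  have contr: "norm (x - (a / B\<^sup>2) *\<^sub>R S x) \<le> c * norm x" for x
  proof (rule power2_le_imp_le)
    have "(norm (x - (a / B\<^sup>2) *\<^sub>R S x))\<^sup>2 = (norm x)\<^sup>2 - 2 * (a / B\<^sup>2) * inner (S x) x + (a / B\<^sup>2)\<^sup>2 * (norm (S x))\<^sup>2"
      unfolding power2_norm_eq_inner inner_diff_left inner_diff_right
      by (simp add: inner_commute power2_eq_square algebra_simps)
    also have "\<dots> \<le> (norm x)\<^sup>2 - 2 * (a / B\<^sup>2) * (a * (norm x)\<^sup>2) + (a / B\<^sup>2)\<^sup>2 * (B * norm x)\<^sup>2"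
      using assms(3)[of x] B assms(4) by (intro add_mono diff_mono mult_left_mono power_mono) auto
    also have "\<dots> = (1 - (a / B)\<^sup>2) * (norm x)\<^sup>2"
      using B(1) by (simp add: power2_eq_square field_simps)
    finally show "(norm (x - (a / B\<^sup>2) *\<^sub>R S x))\<^sup>2 \<le> (c * norm x)\<^sup>2" by (simp add: power_mult_distrib c)
  qed (use c in auto)
  have ex1: "\<exists>!x. S x = y" for y
  proof -
    let ?f = "\<lambda>x. x - (a / B\<^sup>2) *\<^sub>R (S x - y)"
    have "dist (?f x) (?f x') \<le> c * dist x x'" for x x'
      using contr[of "x - x'"] by (simp add: dist_norm S.diff algebra_simps)
    then have "\<exists>!x. ?f x = x" by (intro banach_fix_type[OF c(1,2)]) auto
    moreover have "?f x = x \<longleftrightarrow> S x = y" for x using B(1) assms(4) by auto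
    ultimately show ?thesis by simp
  qed
  show ?thesis
  proof (rule bijI)
    show "inj S" using ex1 by (metis injI)
    show "surj S" using ex1 by (metis surjI surj_def)
  qed
qed

lemma frame_expansion:
  fixes \<eta> :: "nat \<Rightarrow> 'a::{real_inner, complete_space}"
  assumes "is_frame \<eta>"
  shows "(\<lambda>j. inner v (canonical_dual_frame \<eta> j) *\<^sub>R \<eta> j) sums v"
proof -
  have s: "summable (\<lambda>j. (inner v (\<eta> j))\<^sup>2)" for v using assms by (simp add: is_frame_def)
  define F where "F = analysis_op \<eta>"
  define S where "S = adjoint F \<circ> F"
  interpret F: bounded_linear F using assms by (simp add: is_frame_def F_def)
  have nth: "ell2_nth (F v) j = inner v (\<eta> j)" for v j
    by (simp add: F_def analysis_op_def Abs_ell2_inverse s)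
  have S: "S v = (\<Sum>j. inner v (\<eta> j) *\<^sub>R \<eta> j)" for v
    unfolding S_def o_def F_def frame_adjoint[OF assms] nth[unfolded F_def] ..
  have Ssum: "(\<lambda>j. inner v (\<eta> j) *\<^sub>R \<eta> j) sums S v" for v
    unfolding S by (intro summable_sums frame_synthesis_summable[OF assms] s)
  have SF: "inner (S v) u = inner (F v) (F u)" for u v
  proof -
    have "(\<lambda>j. inner (inner v (\<eta> j) *\<^sub>R \<eta> j) u) sums inner (S v) u"
      by (rule bounded_linear.sums[OF bounded_linear_inner_left Ssum])
    moreover have "inner (F v) (F u) = (\<Sum>j. inner v (\<eta> j) * inner u (\<eta> j))"
      unfolding inner_ell2.rep_eq nth ..
    ultimately show ?thesis by (simp add: sums_iff inner_commute)
  qed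
  have sym: "inner (S v) u = inner v (S u)" for u v
    by (metis SF inner_commute)
  obtain b where b: "0 < b" "\<And>v. norm (F v) \<le> norm v * b" using F.pos_bounded by blast
  obtain K where K: "\<forall>y\<in>range F. norm (inv_into UNIV F y) \<le> K * norm y"
    using assms by (auto simp: is_frame_def F_def)
  have "inj F" using assms by (simp add: is_frame_def F_def)
  then have lower: "norm v \<le> (\<bar>K\<bar> + 1) * norm (F v)" for v
  proof -
    have "norm v \<le> K * norm (F v)" using bspec[OF K, of "F v"] \<open>inj F\<close> by simp
    also have "\<dots> \<le> (\<bar>K\<bar> + 1) * norm (F v)" by (intro mult_right_mono) auto
    finally show ?thesis .
  qed
  have "bij S"
  proof (rule coercive_bij)
    show "linear S"
    proof (rule linearI)
      fix x y :: 'a and r :: real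
      have "\<forall>u. inner (S (x + y)) u = inner (S x + S y) u"
        by (simp add: SF F.add inner_add_left)
      then show "S (x + y) = S x + S y" by (rule vector_eq_rdot[THEN iffD1])
      have "\<forall>u. inner (S (r *\<^sub>R x)) u = inner (r *\<^sub>R S x) u"
        by (simp add: SF F.scaleR)
      then show "S (r *\<^sub>R x) = r *\<^sub>R S x" by (rule vector_eq_rdot[THEN iffD1])
    qed
    show "norm (S v) \<le> b\<^sup>2 * norm v" for v
    proof (cases "S v = 0")
      case False
      have "(norm (S v))\<^sup>2 = inner (F v) (F (S v))" by (simp add: power2_norm_eq_inner SF)
      also have "\<dots> \<le> norm (F v) * norm (F (S v))" by (rule norm_cauchy_schwarz)
      also have "\<dots> \<le> (norm v * b) * (norm (S v) * b)" using b by (intro mult_mono) auto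
      finally have "norm (S v) * norm (S v) \<le> (b\<^sup>2 * norm v) * norm (S v)"
        by (simp add: power2_eq_square mult_ac)
      then show ?thesis using False by simp
    qed (use b in simp)
    show "1 / (\<bar>K\<bar> + 1)\<^sup>2 * (norm v)\<^sup>2 \<le> inner (S v) v" for v
    proof -
      have "(norm v)\<^sup>2 \<le> ((\<bar>K\<bar> + 1) * norm (F v))\<^sup>2" using lower by (intro power_mono) auto
      also have "\<dots> = (\<bar>K\<bar> + 1)\<^sup>2 * inner (S v) v" by (simp add: SF power_mult_distrib power2_norm_eq_inner)
      finally show ?thesis by (simp add: divide_le_eq mult.commute add_nonneg_pos)
    qed
    show "0 < 1 / (\<bar>K\<bar> + 1)\<^sup>2" by (simp add: add_nonneg_pos)
  qed
  have Sd: "S (canonical_dual_frame \<eta> j) = \<eta> j" for j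
    unfolding canonical_dual_frame_def F_def[symmetric] S_def[symmetric]
    using \<open>bij S\<close> by (simp add: bij_is_surj surj_f_inv_f)
  obtain u where u: "v = S u" using \<open>bij S\<close> by (metis bij_pointE)
  have "inner v (canonical_dual_frame \<eta> j) = inner u (\<eta> j)" for j
    unfolding u sym Sd ..
  then show ?thesis using Ssum[of u] u by simp
qed

subsection \<open>Weights of multi-indices\<close>

definition index_weight :: "real \<Rightarrow> (nat \<Rightarrow> real) \<Rightarrow> real \<Rightarrow> nat \<Rightarrow> (nat \<Rightarrow> nat) \<Rightarrow> real" where
  "index_weight k \<rho> q d \<kappa> = (\<Prod>i<d. if \<kappa> i = 0 then 1 else k * \<rho> i * q ^ \<kappa> i)"

lemma index_weight_pos:
  assumes "0 < k" "\<And>i. 0 < \<rho> i" "0 < q"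
  shows "0 < index_weight k \<rho> q d \<kappa>"
  unfolding index_weight_def using assms by (intro prod_pos) auto

lemma index_weight_summable:
  fixes \<rho> :: "nat \<Rightarrow> real"
  assumes k: "0 < k" and \<rho>: "\<And>i. 0 < \<rho> i" and q: "1 < q" and p: "0 < p"
    and s: "summable (\<lambda>i. \<rho> i powr (- p))"
  obtains C where "0 < C"
    "\<And>d n. (\<Sum>\<kappa>\<in>PiE {..<d} (\<lambda>_. {..n}). index_weight k \<rho> q d \<kappa> powr (- p)) \<le> C"
proof -
  define a where "a = q powr (- p)"
  have a: "0 < a" "a < 1"
    using q p by (auto simp: a_def powr_less_one)
  define b where "b = (\<lambda>i. k powr (- p) / (1 - a) * \<rho> i powr (- p))"
  have b0: "0 \<le> b i" for i using a by (simp add: b_def)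
  have sb: "summable b" unfolding b_def by (intro summable_mult s)
  have one: "(\<Sum>m\<le>n. (if m = 0 then 1 else k * \<rho> i * q ^ m) powr (- p)) \<le> 1 + b i" for i n
  proof -
    have "(\<Sum>m\<le>n. (if m = 0 then 1 else k * \<rho> i * q ^ m) powr (- p))
       \<le> (\<Sum>m\<le>n. (if m = 0 then 1 else 0) + k powr (- p) * \<rho> i powr (- p) * a ^ m)"
    proof (rule sum_mono)
      fix m
      show "(if m = 0 then 1 else k * \<rho> i * q ^ m) powr (- p) \<le> (if m = 0 then 1 else 0) + k powr (- p) * \<rho> i powr (- p) * a ^ m"
      proof (cases "m = 0")
        case False
        have "(q ^ m) powr (- p) = a ^ m"
          using q by (simp add: a_def powr_power powr_realpow[symmetric] powr_powr mult.commute)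
        then have "(k * \<rho> i * q ^ m) powr (- p) = k powr (- p) * \<rho> i powr (- p) * a ^ m"
          using k \<rho>[of i] q by (simp add: powr_mult)
        then show ?thesis using False by simp
      qed (use a in simp)
    qed
    also have "\<dots> = 1 + k powr (- p) * \<rho> i powr (- p) * (\<Sum>m\<le>n. a ^ m)"
      by (simp add: sum.distrib sum_distrib_left)
    also have "(\<Sum>m\<le>n. a ^ m) \<le> (\<Sum>m. a ^ m)"
      using a by (intro sum_le_suminf summable_geometric) auto
    also have "(\<Sum>m. a ^ m) = 1 / (1 - a)" using a by (intro suminf_geometric) auto
    finally show ?thesis
      by (simp add: b_def mult_left_mono)
  qed
  show ?thesis
  proof (rule that[of "exp (suminf b)"])
    fix d n
    have "(\<Sum>\<kappa>\<in>PiE {..<d} (\<lambda>_. {..n}). index_weight k \<rho> q d \<kappa> powr (- p))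
       = (\<Sum>\<kappa>\<in>PiE {..<d} (\<lambda>_. {..n}). \<Prod>i<d. (if \<kappa> i = 0 then 1 else k * \<rho> i * q ^ \<kappa> i) powr (- p))"
      unfolding index_weight_def using k \<rho> q by (intro sum.cong refl prod_powr_distrib)
    also have "\<dots> = (\<Prod>i<d. \<Sum>m\<le>n. (if m = 0 then 1 else k * \<rho> i * q ^ m) powr (- p))"
      by (subst prod_sum_PiE) auto
    also have "\<dots> \<le> (\<Prod>i<d. exp (b i))"
      using order_trans[OF one exp_ge_add_one_self] by (intro prod_mono) (auto intro: sum_nonneg)
    also have "\<dots> = exp (\<Sum>i<d. b i)" by (simp add: exp_sum)
    also have "\<dots> \<le> exp (suminf b)" using sum_le_suminf[OF sb, of "{..<d}"] b0 by simp
    finally show "(\<Sum>\<kappa>\<in>PiE {..<d} (\<lambda>_. {..n}). index_weight k \<rho> q d \<kappa> powr (- p)) \<le> exp (suminf b)" .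
  qed simp
qed

lemma index_weight_lower:
  fixes \<rho> :: "nat \<Rightarrow> real"
  assumes k: "0 < k" and \<rho>: "\<And>i. 0 < \<rho> i" and q: "1 < q" and p: "0 < p"
    and s: "summable (\<lambda>i. \<rho> i powr (- p))"
  obtains c where "0 < c" "\<And>d \<kappa>. c * sqrt q ^ (\<Sum>i<d. \<kappa> i) \<le> index_weight k \<rho> q d \<kappa>"
proof -
  have q2: "1 < sqrt q" using q by simp
  obtain C where C: "0 < C" "\<And>d n. (\<Sum>\<kappa>\<in>PiE {..<d} (\<lambda>_. {..n}). index_weight k \<rho> (sqrt q) d \<kappa> powr (- p)) \<le> C"
    using index_weight_summable[OF k \<rho> q2 p s] by blast
  show ?thesis
  proof (rule that[of "C powr (- 1 / p)"])
    fix d and \<kappa> :: "nat \<Rightarrow> nat"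
    define \<kappa>' where "\<kappa>' = restrict \<kappa> {..<d}"
    have mem: "\<kappa>' \<in> PiE {..<d} (\<lambda>_. {..\<Sum>i<d. \<kappa> i})"
      by (auto simp: \<kappa>'_def intro!: member_le_sum)
    have pos: "0 < index_weight k \<rho> (sqrt q) d \<kappa>" using k \<rho> q by (intro index_weight_pos) auto
    have eq: "index_weight k \<rho> (sqrt q) d \<kappa>' = index_weight k \<rho> (sqrt q) d \<kappa>"
      by (auto simp: index_weight_def \<kappa>'_def intro!: prod.cong)
    have "index_weight k \<rho> (sqrt q) d \<kappa>' powr (- p) \<le> (\<Sum>\<kappa>\<in>PiE {..<d} (\<lambda>_. {..\<Sum>i<d. \<kappa> i}). index_weight k \<rho> (sqrt q) d \<kappa> powr (- p))"
      by (rule member_le_sum[OF mem]) (auto intro: finite_PiE)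
    then have "index_weight k \<rho> (sqrt q) d \<kappa> powr (- p) \<le> C" unfolding eq using C(2) by (rule order_trans)
    then have "C powr (- 1 / p) \<le> (index_weight k \<rho> (sqrt q) d \<kappa> powr (- p)) powr (- 1 / p)"
      using pos p by (intro powr_mono2') auto
    also have "\<dots> = index_weight k \<rho> (sqrt q) d \<kappa>" using pos p by (simp add: powr_powr)
    finally have "C powr (- 1 / p) \<le> index_weight k \<rho> (sqrt q) d \<kappa>" .
    then have "C powr (- 1 / p) * sqrt q ^ (\<Sum>i<d. \<kappa> i) \<le> index_weight k \<rho> (sqrt q) d \<kappa> * sqrt q ^ (\<Sum>i<d. \<kappa> i)"
      using q by (intro mult_right_mono) auto
    also have "\<dots> = index_weight k \<rho> q d \<kappa>"
      unfolding index_weight_def power_sum prod.distrib[symmetric]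
      using q by (intro prod.cong) (auto simp: power_mult_distrib[symmetric])
    finally show "C powr (- 1 / p) * sqrt q ^ (\<Sum>i<d. \<kappa> i) \<le> index_weight k \<rho> q d \<kappa>" .
  qed (use C in simp)
qed

lemma ell_weight_pos: "0 < \<rho> \<Longrightarrow> 0 < ell_weight \<rho> n"
  by (auto simp: ell_weight_def intro!: add_pos_pos)

lemma ell_weight_ge: "1 \<le> n \<Longrightarrow> 0 < \<rho> \<Longrightarrow> \<rho> ^ (2 * n) / 4 \<le> ell_weight \<rho> n"
  by (simp add: ell_weight_def)

lemma mean_weight_le_ell_weight:
  assumes q: "1 < q" and \<rho>: "q\<^sup>2 \<le> \<rho>" and n: "1 \<le> n"
    and k: "k\<^sup>2 * (8 * q ^ 8 / (1 - inverse (q\<^sup>2))) \<le> 1"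
  shows "mean_weight (inverse (\<rho>\<^sup>2)) q n * (k * \<rho> * q ^ n)\<^sup>2 \<le> ell_weight \<rho> n"
proof -
  define \<kappa> where "\<kappa> = 1 / (1 - inverse (q\<^sup>2))"
  have q2: "1 < q\<^sup>2" using q by (simp add: one_less_power)
  then have \<rho>1: "1 < \<rho>" using \<rho> by simp
  have i1: "inverse (q\<^sup>2) < 1" "0 < inverse (q\<^sup>2)" using q2 q by (auto simp: inverse_less_1_iff)
  have \<kappa>1: "1 \<le> \<kappa>" using i1 by (simp add: \<kappa>_def)
  have k': "k\<^sup>2 * (8 * q ^ 8 * \<kappa>) \<le> 1" using k by (simp add: \<kappa>_def)
  have \<rho>2: "1 \<le> \<rho>\<^sup>2" using \<rho>1 by (simp add: one_le_power)
  have "mean_weight (inverse (\<rho>\<^sup>2)) q n * q ^ (2 * n) * \<rho>\<^sup>2 \<le> 2 * \<kappa> * q ^ 8 * \<rho> ^ (2 * n)"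
  proof (cases "n = 1")
    case True
    have "1 + inverse (\<rho>\<^sup>2) \<le> 2" using \<rho>2 by (simp add: inverse_le_1_iff)
    then have "(1 + inverse (\<rho>\<^sup>2)) * (q\<^sup>2 * \<rho>\<^sup>2) \<le> 2 * (q ^ 8 * \<rho>\<^sup>2)"
      using q by (intro mult_mono mult_right_mono power_increasing) auto
    also have "\<dots> \<le> \<kappa> * (2 * (q ^ 8 * \<rho>\<^sup>2))"
      using mult_right_mono[OF \<kappa>1, of "2 * (q ^ 8 * \<rho>\<^sup>2)"] q by simp
    finally show ?thesis using True by (simp add: mean_weight_def mult_ac)
  next
    case False
    then have "n = (n - 2) + 2" using n by simp
    then obtain m where m: "n = m + 2" by blast
    have "mean_weight (inverse (\<rho>\<^sup>2)) q n = (1 + \<rho>\<^sup>2) * (q ^ (2 * n) * \<kappa>)"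
      using False n \<rho>1 by (simp add: mean_weight_def \<kappa>_def inverse_eq_divide)
    also have "\<dots> \<le> (2 * \<rho>\<^sup>2) * (q ^ (2 * n) * \<kappa>)"
      using \<rho>2 \<kappa>1 q by (intro mult_right_mono) auto
    finally have "mean_weight (inverse (\<rho>\<^sup>2)) q n * q ^ (2 * n) * \<rho>\<^sup>2 \<le> (2 * \<rho>\<^sup>2) * (q ^ (2 * n) * \<kappa>) * q ^ (2 * n) * \<rho>\<^sup>2"
      using q by (intro mult_right_mono) auto
    also have "\<dots> = 2 * \<kappa> * q ^ 8 * (q ^ (4 * m) * \<rho> ^ 4)"
    proof -
      have 1: "q ^ (2 * n) * q ^ (2 * n) = q ^ 8 * q ^ (4 * m)"
        unfolding m power_add[symmetric] by (rule arg_cong[where f = "power q"]) simp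
      have 2: "\<rho>\<^sup>2 * \<rho>\<^sup>2 = \<rho> ^ 4" unfolding power_add[symmetric] by simp
      have "(2 * \<rho>\<^sup>2) * (q ^ (2 * n) * \<kappa>) * q ^ (2 * n) * \<rho>\<^sup>2 = 2 * \<kappa> * (q ^ (2 * n) * q ^ (2 * n)) * (\<rho>\<^sup>2 * \<rho>\<^sup>2)"
        by (simp only: mult_ac)
      then show ?thesis unfolding 1 2 by (simp only: mult_ac)
    qed
    also have "q ^ (4 * m) * \<rho> ^ 4 \<le> \<rho> ^ (2 * n)"
    proof -
      have "q ^ (4 * m) = (q\<^sup>2) ^ (2 * m)" by (simp add: power_mult[symmetric])
      also have "\<dots> \<le> \<rho> ^ (2 * m)" using \<rho> by (intro power_mono) auto
      finally have "q ^ (4 * m) * \<rho> ^ 4 \<le> \<rho> ^ (2 * m) * \<rho> ^ 4" using \<rho>1 by (intro mult_right_mono) auto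
      also have "\<dots> = \<rho> ^ (2 * n)"
        unfolding m power_add[symmetric] by (rule arg_cong[where f = "power \<rho>"]) simp
      finally show ?thesis .
    qed
    finally show ?thesis using \<kappa>1 q by (simp add: mult_left_mono)
  qed
  then have "k\<^sup>2 * (mean_weight (inverse (\<rho>\<^sup>2)) q n * q ^ (2 * n) * \<rho>\<^sup>2) \<le> k\<^sup>2 * (2 * \<kappa> * q ^ 8 * \<rho> ^ (2 * n))"
    by (intro mult_left_mono) auto
  also have "\<dots> = (k\<^sup>2 * (8 * q ^ 8 * \<kappa>)) * (\<rho> ^ (2 * n) / 4)" by simp
  also have "\<dots> \<le> 1 * (\<rho> ^ (2 * n) / 4)" using k' \<rho>1 by (intro mult_right_mono) auto
  also have "\<dots> \<le> ell_weight \<rho> n" using ell_weight_ge[OF n] \<rho>1 by simp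
  finally show ?thesis by (simp add: power_mult_distrib power_mult[symmetric] mult_ac)
qed

lemma prod_mean_weight_le:
  fixes \<rho> :: "nat \<Rightarrow> real"
  assumes q: "1 < q" and \<rho>: "\<And>i. q\<^sup>2 \<le> \<rho> i" and k0: "0 < k"
    and k: "k\<^sup>2 * (8 * q ^ 8 / (1 - inverse (q\<^sup>2))) \<le> 1"
    and s: "summable (\<lambda>i. inverse ((\<rho> i)\<^sup>2))"
  shows "(\<Prod>i<d. mean_weight (inverse ((\<rho> i)\<^sup>2)) q (\<kappa> i)) * (index_weight k \<rho> q d \<kappa>)\<^sup>2
    \<le> exp (\<Sum>i. inverse ((\<rho> i)\<^sup>2)) * (\<Prod>i<d. ell_weight (\<rho> i) (\<kappa> i))"
proof -
  have \<rho>0: "0 < \<rho> i" for i using \<rho>[of i] q zero_less_power[of q 2] by linarith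
  have "(\<Prod>i<d. mean_weight (inverse ((\<rho> i)\<^sup>2)) q (\<kappa> i)) * (index_weight k \<rho> q d \<kappa>)\<^sup>2
     = (\<Prod>i<d. mean_weight (inverse ((\<rho> i)\<^sup>2)) q (\<kappa> i) * (if \<kappa> i = 0 then 1 else k * \<rho> i * q ^ \<kappa> i)\<^sup>2)"
    unfolding index_weight_def prod_power_distrib[symmetric] prod.distrib ..
  also have "\<dots> \<le> (\<Prod>i<d. exp (inverse ((\<rho> i)\<^sup>2)) * ell_weight (\<rho> i) (\<kappa> i))"
  proof (intro prod_mono conjI)
    fix i
    let ?e = "inverse ((\<rho> i)\<^sup>2)"
    have e0: "0 < ?e" using \<rho>0[of i] by simp
    show "0 \<le> mean_weight ?e q (\<kappa> i) * (if \<kappa> i = 0 then 1 else k * \<rho> i * q ^ \<kappa> i)\<^sup>2"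
      using mean_weight_nonneg[OF e0 q] by simp
    show "mean_weight ?e q (\<kappa> i) * (if \<kappa> i = 0 then 1 else k * \<rho> i * q ^ \<kappa> i)\<^sup>2 \<le> exp ?e * ell_weight (\<rho> i) (\<kappa> i)"
    proof (cases "\<kappa> i = 0")
      case True
      then show ?thesis by (simp add: mean_weight_def ell_weight_def exp_ge_add_one_self)
    next
      case False
      have "mean_weight ?e q (\<kappa> i) * (k * \<rho> i * q ^ \<kappa> i)\<^sup>2 \<le> ell_weight (\<rho> i) (\<kappa> i)"
        using False by (intro mean_weight_le_ell_weight q \<rho> k) auto
      also have "\<dots> \<le> exp ?e * ell_weight (\<rho> i) (\<kappa> i)"
        using mult_right_mono[of 1 "exp ?e" "ell_weight (\<rho> i) (\<kappa> i)"] ell_weight_pos[OF \<rho>0[of i], of "\<kappa> i"] e0 by simp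
      finally show ?thesis using False by simp
    qed
  qed
  also have "\<dots> = exp (\<Sum>i<d. inverse ((\<rho> i)\<^sup>2)) * (\<Prod>i<d. ell_weight (\<rho> i) (\<kappa> i))"
    by (simp add: prod.distrib exp_sum)
  also have "\<dots> \<le> exp (\<Sum>i. inverse ((\<rho> i)\<^sup>2)) * (\<Prod>i<d. ell_weight (\<rho> i) (\<kappa> i))"
    using sum_le_suminf[OF s, of "{..<d}"] ell_weight_pos[OF \<rho>0]
    by (intro mult_right_mono prod_nonneg) (auto simp: less_imp_le)
  finally show ?thesis .
qed

lemma prod_mean_weight_ge_1:
  assumes "\<And>i. 0 < \<epsilon> i" "1 < q"
  shows "1 \<le> (\<Prod>i<d. mean_weight (\<epsilon> i) q (\<kappa> i))"
proof (rule prod_ge_1)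
  fix i
  have i1: "inverse (q\<^sup>2) < 1" "0 < inverse (q\<^sup>2)" using assms(2) by (auto simp: inverse_less_1_iff one_less_power)
  have "1 \<le> q ^ (2 * \<kappa> i)" using assms(2) by (intro one_le_power) auto
  then have "1 \<le> q ^ (2 * \<kappa> i) / (1 - inverse (q\<^sup>2))"
    using i1 by (subst le_divide_eq_1_pos) linarith+
  then have "1 * 1 \<le> (1 + 1 / \<epsilon> i) * (q ^ (2 * \<kappa> i) / (1 - inverse (q\<^sup>2)))"
    using assms(1)[of i] by (intro mult_mono) auto
  then show "1 \<le> mean_weight (\<epsilon> i) q (\<kappa> i)"
    using assms(1)[of i] by (auto simp: mean_weight_def)
qed

theorem sparse_cheb_approx:
  fixes \<rho> \<sigma> wt :: "nat \<Rightarrow> real" and M p q :: real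
  assumes q: "1 < q" and \<rho>: "\<And>i. q\<^sup>2 \<le> \<rho> i" "\<And>i. \<rho> i < \<sigma> i"
    and s2: "summable (\<lambda>i. inverse ((\<rho> i)\<^sup>2))"
    and p: "0 < p" and sp: "summable (\<lambda>i. \<rho> i powr (- p))"
    and wt: "\<And>j. 0 < wt j" "summable (\<lambda>j. wt j powr p)"
  shows "\<exists>C>0. \<forall>d J R \<epsilon>. \<forall>f :: nat \<Rightarrow> (nat \<Rightarrow> complex) \<Rightarrow> complex. 1 \<le> R \<longrightarrow> 0 < \<epsilon> \<longrightarrow>
      (\<forall>j<J. \<forall>z\<in>polyell \<sigma> d. \<forall>i<d. (\<lambda>x. f j (z(i := x))) holomorphic_on ell (\<sigma> i)) \<longrightarrow>
      (\<forall>z\<in>polyell \<sigma> d. (\<Sum>j<J. (cmod (f j z))\<^sup>2 / (wt j)\<^sup>2) \<le> M\<^sup>2) \<longrightarrow>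
      (\<exists>n c \<Lambda>. (\<forall>j<J. \<Lambda> j \<subseteq> PiE {..<d} (\<lambda>_. {..n}) \<and>
          (\<forall>\<kappa>\<in>\<Lambda> j. real (\<Sum>i<d. \<kappa> i) \<le> C * (1 + ln R) \<and> \<bar>c j \<kappa>\<bar> \<le> C)) \<and>
        real (\<Sum>j<J. card (\<Lambda> j)) \<le> C * R powr p \<and>
        (\<forall>j<J. \<forall>y\<in>param_cube. \<bar>Re (f j (\<lambda>i. if i < d then of_real (y i) else 0))
            - (\<Sum>\<kappa>\<in>PiE {..<d} (\<lambda>_. {..n}). c j \<kappa> * (\<Prod>i<d. cheb (\<kappa> i) (y i)))\<bar> \<le> \<epsilon>) \<and>
        (\<forall>j<J. integrable uniform_cube (\<lambda>y. (\<Sum>\<kappa>\<in>PiE {..<d} (\<lambda>_. {..n}) - \<Lambda> j. c j \<kappa> * (\<Prod>i<d. cheb (\<kappa> i) (y i)))\<^sup>2)) \<and>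
        (\<Sum>j<J. \<integral>y. (\<Sum>\<kappa>\<in>PiE {..<d} (\<lambda>_. {..n}) - \<Lambda> j. c j \<kappa> * (\<Prod>i<d. cheb (\<kappa> i) (y i)))\<^sup>2 \<partial>uniform_cube) \<le> C / R\<^sup>2)"
proof -
  have q2: "1 < q\<^sup>2" using q by (simp add: one_less_power)
  have \<rho>1: "1 < \<rho> i" for i using \<rho>(1)[of i] q2 by linarith
  have \<rho>0: "0 < \<rho> i" for i using \<rho>1[of i] by linarith
  have i1: "inverse (q\<^sup>2) < 1" using q2 by (auto simp: inverse_less_1_iff)
  define k where "k = sqrt ((1 - inverse (q\<^sup>2)) / (8 * q ^ 8))"
  have k0: "0 < k" using i1 q by (simp add: k_def)
  have "k\<^sup>2 = (1 - inverse (q\<^sup>2)) / (8 * q ^ 8)" using i1 q unfolding k_def by (intro real_sqrt_pow2) auto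
  then have k: "k\<^sup>2 * (8 * q ^ 8 / (1 - inverse (q\<^sup>2))) \<le> 1" using i1 q by simp
  obtain C1 where C1: "0 < C1" "\<And>d n. (\<Sum>\<kappa>\<in>PiE {..<d} (\<lambda>_. {..n}). index_weight k \<rho> q d \<kappa> powr (- p)) \<le> C1"
    using index_weight_summable[OF k0 \<rho>0 q p sp] by blast
  obtain c0 where c0: "0 < c0" "\<And>d \<kappa>. c0 * sqrt q ^ (\<Sum>i<d. \<kappa> i) \<le> index_weight k \<rho> q d \<kappa>"
    using index_weight_lower[OF k0 \<rho>0 q p sp] by blast
  define S0 where "S0 = exp (\<Sum>i. inverse ((\<rho> i)\<^sup>2))"
  define M2 where "M2 = 2 * M\<^sup>2 + 2"
  define Sw where "Sw = (\<Sum>j. wt j powr p)"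
  define W0 where "W0 = 1 + Sw powr (1 / p)"
  have S0: "0 < S0" and M2: "0 < M2" by (auto simp: S0_def M2_def add_nonneg_pos)
  have W0: "1 \<le> W0" "0 < W0" by (auto simp: W0_def add_pos_nonneg)
  have wtW: "wt j \<le> W0" for j
  proof -
    have "wt j powr p \<le> Sw" unfolding Sw_def using sum_le_suminf[OF wt(2), of "{j}"] by simp
    then have "(wt j powr p) powr (1 / p) \<le> Sw powr (1 / p)" using p by (intro powr_mono2) auto
    then show ?thesis using p wt(1)[of j] by (simp add: powr_powr W0_def)
  qed
  have Sw: "0 \<le> Sw" unfolding Sw_def using wt(2) by (intro suminf_nonneg) auto
  define lq where "lq = ln (sqrt q)"
  have lq: "0 < lq" using q by (simp add: lq_def)
  define Ca where "Ca = (1 + \<bar>ln (W0 / c0)\<bar>) / lq"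
  define Cb where "Cb = sqrt (S0 * M2 * W0\<^sup>2 / c0\<^sup>2)"
  define C where "C = Ca + Cb + C1 * Sw + S0 * M2 + 1"
  have Ca: "0 \<le> Ca" using lq by (simp add: Ca_def)
  have Cb: "0 \<le> Cb" using S0 M2 by (simp add: Cb_def)
  have Cge: "Ca \<le> C" "Cb \<le> C" "C1 * Sw \<le> C" "S0 * M2 \<le> C" "0 < C"
    using Ca Cb C1(1) Sw S0 M2 by (auto simp: C_def add_nonneg_pos intro!: add_nonneg_nonneg)
  show ?thesis
  proof (rule exI[of _ C], rule conjI[OF Cge(5)], intro allI impI)
    fix d J R \<epsilon> and f :: "nat \<Rightarrow> (nat \<Rightarrow> complex) \<Rightarrow> complex"
    assume R: "1 \<le> (R::real)" and \<epsilon>: "0 < (\<epsilon>::real)"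
      and hol': "\<forall>j<J. \<forall>z\<in>polyell \<sigma> d. \<forall>i<d. (\<lambda>x. f j (z(i := x))) holomorphic_on ell (\<sigma> i)"
      and bnd': "\<forall>z\<in>polyell \<sigma> d. (\<Sum>j<J. (cmod (f j z))\<^sup>2 / (wt j)\<^sup>2) \<le> M\<^sup>2"
    note hol = hol'[rule_format] and bnd = bnd'[rule_format]
    define e where "e = min \<epsilon> (1 / sqrt (1 + (\<Sum>j<J. 1 / (wt j)\<^sup>2)))"
    have sw0: "0 \<le> (\<Sum>j<J. 1 / (wt j)\<^sup>2)" by (intro sum_nonneg) auto
    have e: "0 < e" "e \<le> \<epsilon>" using \<epsilon> sw0 by (auto simp: e_def add_pos_nonneg)
    have e2: "e\<^sup>2 * (\<Sum>j<J. 1 / (wt j)\<^sup>2) \<le> 1"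
    proof -
      have "e\<^sup>2 \<le> (1 / sqrt (1 + (\<Sum>j<J. 1 / (wt j)\<^sup>2)))\<^sup>2"
        using e by (intro power_mono) (auto simp: e_def)
      also have "\<dots> = 1 / (1 + (\<Sum>j<J. 1 / (wt j)\<^sup>2))" using sw0 by (simp add: power_divide)
      finally have "e\<^sup>2 * (\<Sum>j<J. 1 / (wt j)\<^sup>2) \<le> 1 / (1 + (\<Sum>j<J. 1 / (wt j)\<^sup>2)) * (\<Sum>j<J. 1 / (wt j)\<^sup>2)"
        using sw0 by (intro mult_right_mono) auto
      also have "\<dots> \<le> 1" using sw0 by (simp add: divide_le_eq add_pos_nonneg)
      finally show ?thesis .
    qed
    have fB: "cmod (f j z) \<le> \<bar>M\<bar> * wt j" if "j < J" "z \<in> polyell \<sigma> d" for j z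
    proof -
      have "(cmod (f j z))\<^sup>2 / (wt j)\<^sup>2 \<le> (\<Sum>j<J. (cmod (f j z))\<^sup>2 / (wt j)\<^sup>2)"
        using that by (intro member_le_sum) auto
      also have "\<dots> \<le> M\<^sup>2" using that by (intro bnd)
      finally have "(cmod (f j z) / wt j)\<^sup>2 \<le> \<bar>M\<bar>\<^sup>2" by (simp add: power_divide)
      then have "cmod (f j z) / wt j \<le> \<bar>M\<bar>" by (rule power2_le_imp_le) simp
      then show ?thesis using wt(1)[of j] by (simp add: divide_le_eq)
    qed
    have "\<exists>n0. \<forall>n\<ge>n0. \<exists>c. \<forall>z\<in>polycell \<rho> d.
        cmod (f j z - (\<Sum>\<kappa>\<in>PiE {..<d} (\<lambda>_. {..n}). c \<kappa> * (\<Prod>i<d. cheb (\<kappa> i) (z i)))) \<le> e"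
      if j: "j < J" for j
    proof (rule cheb_tensor_approx[where \<sigma> = \<sigma> and B = "\<bar>M\<bar> * wt j"])
      show "0 \<le> \<bar>M\<bar> * wt j" using wt(1)[of j] by simp
    qed (fact \<rho>1 \<rho>(2) fB[OF j] hol[OF j] e(1))+
    then have "\<forall>j. \<exists>n0. j < J \<longrightarrow> (\<forall>n\<ge>n0. \<exists>c. \<forall>z\<in>polycell \<rho> d.
        cmod (f j z - (\<Sum>\<kappa>\<in>PiE {..<d} (\<lambda>_. {..n}). c \<kappa> * (\<Prod>i<d. cheb (\<kappa> i) (z i)))) \<le> e)"
      by blast
    from choice[OF this] obtain n0 where n0: "\<And>j n. j < J \<Longrightarrow> n0 j \<le> n \<Longrightarrow> \<exists>c. \<forall>z\<in>polycell \<rho> d.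
        cmod (f j z - (\<Sum>\<kappa>\<in>PiE {..<d} (\<lambda>_. {..n}). c \<kappa> * (\<Prod>i<d. cheb (\<kappa> i) (z i)))) \<le> e"
      by blast
    define n where "n = (\<Sum>j<J. n0 j)"
    have "n0 j \<le> n" if "j < J" for j unfolding n_def using that by (intro member_le_sum) auto
    then have "\<forall>j. \<exists>c. j < J \<longrightarrow> (\<forall>z\<in>polycell \<rho> d.
        cmod (f j z - (\<Sum>\<kappa>\<in>PiE {..<d} (\<lambda>_. {..n}). c \<kappa> * (\<Prod>i<d. cheb (\<kappa> i) (z i)))) \<le> e)"
      using n0 by blast
    from choice[OF this] obtain c where c: "\<And>j z. j < J \<Longrightarrow> z \<in> polycell \<rho> d \<Longrightarrow>
        cmod (f j z - (\<Sum>\<kappa>\<in>PiE {..<d} (\<lambda>_. {..n}). c j \<kappa> * (\<Prod>i<d. cheb (\<kappa> i) (z i)))) \<le> e"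
      by blast
    define K where "K = PiE {..<d} (\<lambda>_. {..n})"
    have finK: "finite K" unfolding K_def by (intro finite_PiE) auto
    define P where "P = (\<lambda>j z. \<Sum>\<kappa>\<in>K. c j \<kappa> * (\<Prod>i<d. cheb (\<kappa> i) (z i)))"
    define G where "G = (\<lambda>\<kappa>. \<Prod>i<d. ell_weight (\<rho> i) (\<kappa> i))"
    define V where "V = index_weight k \<rho> q d"
    define W where "W = (\<lambda>\<kappa>. \<Prod>i<d. mean_weight (inverse ((\<rho> i)\<^sup>2)) q (\<kappa> i))"
    have G0: "0 < G \<kappa>" for \<kappa> unfolding G_def using ell_weight_pos[OF \<rho>0] by (intro prod_pos) auto
    have V0: "0 < V \<kappa>" for \<kappa> unfolding V_def using k0 \<rho>0 q by (intro index_weight_pos) auto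
    have WV: "W \<kappa> * (V \<kappa>)\<^sup>2 \<le> S0 * G \<kappa>" for \<kappa>
      unfolding W_def V_def S0_def G_def by (rule prod_mean_weight_le[OF q \<rho>(1) k0 k s2])
    have eps: "0 < inverse ((\<rho> i)\<^sup>2)" for i using \<rho>0[of i] by simp
    have W1: "1 \<le> W \<kappa>" for \<kappa> unfolding W_def by (rule prod_mean_weight_ge_1[OF eps q])
    have par: "(\<Sum>j<J. (\<Sum>\<kappa>\<in>K. (cmod (c j \<kappa>))\<^sup>2 * G \<kappa>) / (wt j)\<^sup>2) \<le> M2"
    proof -
      define Q where "Q = 2 * n + 1"
      define X where "X = (\<lambda>m i. jouk (of_real (\<rho> i) * cis (2 * pi * real (m i) / real Q)))"
      define Gr where "Gr = PiE {..<d} (\<lambda>_. {..<Q})"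
      have cG: "card Gr = Q ^ d" unfolding Gr_def by (simp add: card_PiE)
      have fG: "finite Gr" unfolding Gr_def by (intro finite_PiE) auto
      have Pj: "(\<Sum>m\<in>Gr. (cmod (P j (X m)))\<^sup>2) = real (Q ^ d) * (\<Sum>\<kappa>\<in>K. (cmod (c j \<kappa>))\<^sup>2 * G \<kappa>)" for j
        unfolding Gr_def Q_def P_def X_def K_def G_def by (rule cheb_discrete_parseval[OF \<rho>0])
      have pt: "(\<Sum>j<J. (cmod (P j (X m)))\<^sup>2 / (wt j)\<^sup>2) \<le> M2" for m
      proof -
        define z where "z = (\<lambda>i. if i < d then X m i else 0)"
        have "X m i \<in> cell (\<rho> i)" for i
          unfolding X_def cell_def using \<rho>1[of i] by (intro imageI) (simp add: norm_mult)
        then have zc: "z \<in> polycell \<rho> d" by (simp add: z_def polycell_def)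
        then have ze: "z \<in> polyell \<sigma> d"
          using cell_subset_ell[OF \<rho>(2)] unfolding polycell_def polyell_def by blast
        have PX: "P j (X m) = P j z" for j unfolding P_def z_def by simp
        have "(cmod (P j z))\<^sup>2 \<le> 2 * (cmod (f j z))\<^sup>2 + 2 * e\<^sup>2" if "j < J" for j
        proof -
          have "cmod (P j z) \<le> cmod (f j z) + e"
            using norm_triangle_ineq3[of "P j z" "f j z"] c[OF that zc] unfolding P_def K_def
            by (simp add: norm_minus_commute)
          then have "(cmod (P j z))\<^sup>2 \<le> (cmod (f j z) + e)\<^sup>2" by (intro power_mono) auto
          also have "\<dots> \<le> 2 * (cmod (f j z))\<^sup>2 + 2 * e\<^sup>2"
            using sum_squares_bound[of "cmod (f j z)" e] by (simp add: power2_sum)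
          finally show ?thesis .
        qed
        then have "(\<Sum>j<J. (cmod (P j z))\<^sup>2 / (wt j)\<^sup>2) \<le> (\<Sum>j<J. (2 * (cmod (f j z))\<^sup>2 + 2 * e\<^sup>2) / (wt j)\<^sup>2)"
          by (intro sum_mono divide_right_mono) auto
        also have "\<dots> = 2 * (\<Sum>j<J. (cmod (f j z))\<^sup>2 / (wt j)\<^sup>2) + 2 * (e\<^sup>2 * (\<Sum>j<J. 1 / (wt j)\<^sup>2))"
          by (simp add: add_divide_distrib sum.distrib sum_distrib_left)
        also have "\<dots> \<le> M2" using bnd[OF ze] e2 by (simp add: M2_def)
        finally show ?thesis unfolding PX .
      qed
      have "real (Q ^ d) * (\<Sum>j<J. (\<Sum>\<kappa>\<in>K. (cmod (c j \<kappa>))\<^sup>2 * G \<kappa>) / (wt j)\<^sup>2)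
          = (\<Sum>j<J. (\<Sum>m\<in>Gr. (cmod (P j (X m)))\<^sup>2) / (wt j)\<^sup>2)"
        unfolding Pj sum_distrib_left[of "real (Q ^ d)" _ "{..<J}"] by (simp only: times_divide_eq_right)
      also have "\<dots> = (\<Sum>m\<in>Gr. \<Sum>j<J. (cmod (P j (X m)))\<^sup>2 / (wt j)\<^sup>2)"
        unfolding sum_divide_distrib by (rule sum.swap)
      also have "\<dots> \<le> (\<Sum>m\<in>Gr. M2)" by (intro sum_mono pt)
      also have "\<dots> = real (Q ^ d) * M2" by (simp add: cG)
      finally show ?thesis using Q_def by (simp add: mult_le_cancel_left_pos)
    qed
    have coef: "(cmod (c j \<kappa>))\<^sup>2 * G \<kappa> \<le> M2 * (wt j)\<^sup>2" if "j < J" "\<kappa> \<in> K" for j \<kappa>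
    proof -
      have "(cmod (c j \<kappa>))\<^sup>2 * G \<kappa> \<le> (\<Sum>\<kappa>\<in>K. (cmod (c j \<kappa>))\<^sup>2 * G \<kappa>)"
        using that finK G0 by (intro member_le_sum) (auto simp: less_imp_le)
      then have "(cmod (c j \<kappa>))\<^sup>2 * G \<kappa> / (wt j)\<^sup>2 \<le> (\<Sum>\<kappa>\<in>K. (cmod (c j \<kappa>))\<^sup>2 * G \<kappa>) / (wt j)\<^sup>2"
        by (intro divide_right_mono) auto
      also have "\<dots> \<le> (\<Sum>j<J. (\<Sum>\<kappa>\<in>K. (cmod (c j \<kappa>))\<^sup>2 * G \<kappa>) / (wt j)\<^sup>2)"
        using that G0 by (intro member_le_sum[where f = "\<lambda>j. (\<Sum>\<kappa>\<in>K. (cmod (c j \<kappa>))\<^sup>2 * G \<kappa>) / (wt j)\<^sup>2"])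
          (auto intro!: divide_nonneg_nonneg sum_nonneg mult_nonneg_nonneg simp: less_imp_le)
      also have "\<dots> \<le> M2" by (rule par)
      finally show ?thesis using wt(1)[of j] by (simp add: divide_le_eq)
    qed
    define \<Lambda> where "\<Lambda> = (\<lambda>j. {\<kappa>\<in>K. V \<kappa> \<le> R * wt j})"
    define cr where "cr = (\<lambda>j \<kappa>. Re (c j \<kappa>))"
    have cr: "(cr j \<kappa>)\<^sup>2 \<le> (cmod (c j \<kappa>))\<^sup>2" for j \<kappa>
      unfolding cr_def using abs_Re_le_cmod[of "c j \<kappa>"] by (simp add: abs_le_square_iff[symmetric])
    have deg: "real (\<Sum>i<d. \<kappa> i) \<le> C * (1 + ln R)" if "j < J" "\<kappa> \<in> \<Lambda> j" for j \<kappa>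
    proof -
      let ?s = "\<Sum>i<d. \<kappa> i"
      have "c0 * sqrt q ^ ?s \<le> R * wt j" using c0(2)[where d = d and \<kappa> = \<kappa>] that unfolding \<Lambda>_def V_def by (auto intro: order_trans)
      also have "\<dots> \<le> R * W0" using wtW R by (intro mult_left_mono) auto
      finally have "sqrt q ^ ?s \<le> R * (W0 / c0)" using c0(1) by (simp add: field_simps)
      then have "ln (sqrt q ^ ?s) \<le> ln (R * (W0 / c0))"
        using q R W0 c0(1) by (subst ln_le_cancel_iff) auto
      also have "\<dots> = ln R + ln (W0 / c0)" using R W0 c0(1) by (intro ln_mult_pos) auto
      also have "ln (sqrt q ^ ?s) = real ?s * lq" using q by (simp add: ln_realpow lq_def)
      finally have "real ?s * lq \<le> ln R + \<bar>ln (W0 / c0)\<bar>" by linarith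
      also have "\<dots> \<le> (1 + \<bar>ln (W0 / c0)\<bar>) * (1 + ln R)"
        using ln_ge_zero[OF R] by (simp add: algebra_simps mult_nonneg_nonneg)
      finally have "real ?s \<le> Ca * (1 + ln R)" unfolding Ca_def using lq by (simp add: field_simps)
      also have "\<dots> \<le> C * (1 + ln R)" using Cge ln_ge_zero[OF R] by (intro mult_right_mono) auto
      finally show ?thesis .
    qed
    have cb: "\<bar>cr j \<kappa>\<bar> \<le> C" if "j < J" "\<kappa> \<in> \<Lambda> j" for j \<kappa>
    proof -
      have K: "\<kappa> \<in> K" using that by (simp add: \<Lambda>_def)
      have "1 \<le> sqrt q ^ (\<Sum>i<d. \<kappa> i)" using q by (intro one_le_power) simp
      then have "c0 * 1 \<le> c0 * sqrt q ^ (\<Sum>i<d. \<kappa> i)" using c0(1) by (intro mult_left_mono) auto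
      then have "c0 \<le> V \<kappa>" using c0(2)[where d = d and \<kappa> = \<kappa>] unfolding V_def by linarith
      then have "c0\<^sup>2 \<le> (V \<kappa>)\<^sup>2" using c0(1) by (intro power_mono) auto
      also have "\<dots> \<le> W \<kappa> * (V \<kappa>)\<^sup>2" using mult_right_mono[OF W1[of \<kappa>], of "(V \<kappa>)\<^sup>2"] by simp
      also have "\<dots> \<le> S0 * G \<kappa>" by (rule WV)
      finally have "(cmod (c j \<kappa>))\<^sup>2 * c0\<^sup>2 \<le> (cmod (c j \<kappa>))\<^sup>2 * (S0 * G \<kappa>)" by (intro mult_left_mono) auto
      also have "\<dots> = S0 * ((cmod (c j \<kappa>))\<^sup>2 * G \<kappa>)" by simp
      also have "\<dots> \<le> S0 * (M2 * (wt j)\<^sup>2)" using S0 coef[OF that(1) K] by (intro mult_left_mono) auto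
      also have "\<dots> \<le> S0 * (M2 * W0\<^sup>2)" using S0 M2 wtW[of j] wt(1)[of j] by (intro mult_left_mono power_mono) auto
      finally have "(cmod (c j \<kappa>))\<^sup>2 \<le> S0 * M2 * W0\<^sup>2 / c0\<^sup>2" using c0(1) by (simp add: le_divide_eq mult.assoc)
      then have "(cr j \<kappa>)\<^sup>2 \<le> S0 * M2 * W0\<^sup>2 / c0\<^sup>2" using cr[of j \<kappa>] by linarith
      then have "\<bar>cr j \<kappa>\<bar> \<le> Cb" unfolding Cb_def by (metis real_sqrt_abs real_sqrt_le_mono)
      then show ?thesis using Cge(2) by linarith
    qed
    have cnt: "real (\<Sum>j<J. card (\<Lambda> j)) \<le> C * R powr p"
    proof -
      have cj: "real (card (\<Lambda> j)) \<le> R powr p * wt j powr p * C1" for j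
      proof -
        have "real (card (\<Lambda> j)) = (\<Sum>\<kappa>\<in>\<Lambda> j. 1)" by simp
        also have "\<dots> \<le> (\<Sum>\<kappa>\<in>\<Lambda> j. (R * wt j) powr p * V \<kappa> powr (- p))"
        proof (rule sum_mono)
          fix \<kappa> assume "\<kappa> \<in> \<Lambda> j"
          then have "V \<kappa> powr p \<le> (R * wt j) powr p" using p V0[of \<kappa>] by (intro powr_mono2) (auto simp: \<Lambda>_def)
          then show "1 \<le> (R * wt j) powr p * V \<kappa> powr (- p)"
            using V0[of \<kappa>] by (simp add: powr_minus field_simps)
        qed
        also have "\<dots> \<le> (\<Sum>\<kappa>\<in>K. (R * wt j) powr p * V \<kappa> powr (- p))"
          using finK by (intro sum_mono2) (auto simp: \<Lambda>_def)
        also have "\<dots> = (R * wt j) powr p * (\<Sum>\<kappa>\<in>K. V \<kappa> powr (- p))" by (simp add: sum_distrib_left)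
        also have "\<dots> \<le> (R * wt j) powr p * C1" unfolding V_def K_def by (intro mult_left_mono C1) auto
        also have "(R * wt j) powr p = R powr p * wt j powr p" by (rule powr_mult)
        finally show ?thesis .
      qed
      have "real (\<Sum>j<J. card (\<Lambda> j)) \<le> (\<Sum>j<J. R powr p * wt j powr p * C1)"
        unfolding of_nat_sum by (intro sum_mono cj)
      also have "\<dots> = R powr p * C1 * (\<Sum>j<J. wt j powr p)" by (simp add: sum_distrib_left mult_ac)
      also have "\<dots> \<le> R powr p * C1 * Sw"
        unfolding Sw_def using C1(1) by (intro mult_left_mono sum_le_suminf wt) auto
      also have "\<dots> = C1 * Sw * R powr p" by simp
      also have "\<dots> \<le> C * R powr p" using Cge(3) by (intro mult_right_mono) auto
      finally show ?thesis .
    qed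
    have app: "\<bar>Re (f j (\<lambda>i. if i < d then of_real (y i) else 0)) - (\<Sum>\<kappa>\<in>K. cr j \<kappa> * (\<Prod>i<d. cheb (\<kappa> i) (y i)))\<bar> \<le> \<epsilon>"
      if "j < J" "y \<in> param_cube" for j y
    proof -
      define z where "z = (\<lambda>i. if i < d then complex_of_real (y i) else 0)"
      have "of_real (y i) \<in> cell (\<rho> i)" for i
        using that(2) \<rho>1[of i] by (intro of_real_in_cell) (auto simp: param_cube_def abs_le_iff)
      then have zc: "z \<in> polycell \<rho> d" by (simp add: z_def polycell_def)
      have "(\<Prod>i<d. cheb (\<kappa> i) (z i)) = of_real (\<Prod>i<d. cheb (\<kappa> i) (y i))" for \<kappa>
        by (simp add: z_def cheb_of_real)
      then have "Re (\<Sum>\<kappa>\<in>K. c j \<kappa> * (\<Prod>i<d. cheb (\<kappa> i) (z i))) = (\<Sum>\<kappa>\<in>K. cr j \<kappa> * (\<Prod>i<d. cheb (\<kappa> i) (y i)))"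
        by (simp add: cr_def del: of_real_prod)
      then have "\<bar>Re (f j z) - (\<Sum>\<kappa>\<in>K. cr j \<kappa> * (\<Prod>i<d. cheb (\<kappa> i) (y i)))\<bar>
          \<le> cmod (f j z - (\<Sum>\<kappa>\<in>K. c j \<kappa> * (\<Prod>i<d. cheb (\<kappa> i) (z i))))"
        using abs_Re_le_cmod[of "f j z - (\<Sum>\<kappa>\<in>K. c j \<kappa> * (\<Prod>i<d. cheb (\<kappa> i) (z i)))"] by simp
      also have "\<dots> \<le> e" unfolding K_def by (rule c[OF that(1) zc])
      finally show ?thesis using e by (simp add: z_def)
    qed
    have trunc: "(\<Sum>\<kappa>\<in>K - \<Lambda> j. cr j \<kappa> * T \<kappa>) = (\<Sum>\<kappa>\<in>K. (if \<kappa> \<in> \<Lambda> j then 0 else cr j \<kappa>) * T \<kappa>)" for j and T :: "(nat \<Rightarrow> nat) \<Rightarrow> real"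
      using finK by (intro sum.mono_neutral_cong_left) auto
    note ms = cheb_mean_square[where d = d and N = n and \<epsilon> = "\<lambda>i. inverse ((\<rho> i)\<^sup>2)" and q = "\<lambda>_. q", OF eps q, folded K_def]
    have tail: "(\<Sum>j<J. \<integral>y. (\<Sum>\<kappa>\<in>K - \<Lambda> j. cr j \<kappa> * (\<Prod>i<d. cheb (\<kappa> i) (y i)))\<^sup>2 \<partial>uniform_cube) \<le> C / R\<^sup>2"
    proof -
      have tj: "(\<integral>y. (\<Sum>\<kappa>\<in>K - \<Lambda> j. cr j \<kappa> * (\<Prod>i<d. cheb (\<kappa> i) (y i)))\<^sup>2 \<partial>uniform_cube)
          \<le> S0 / R\<^sup>2 * ((\<Sum>\<kappa>\<in>K. (cmod (c j \<kappa>))\<^sup>2 * G \<kappa>) / (wt j)\<^sup>2)" for j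
      proof -
        have "(\<integral>y. (\<Sum>\<kappa>\<in>K - \<Lambda> j. cr j \<kappa> * (\<Prod>i<d. cheb (\<kappa> i) (y i)))\<^sup>2 \<partial>uniform_cube)
          \<le> (\<Sum>\<kappa>\<in>K. (if \<kappa> \<in> \<Lambda> j then 0 else cr j \<kappa>)\<^sup>2 * W \<kappa>)"
          unfolding trunc W_def by (rule ms(2))
        also have "\<dots> \<le> (\<Sum>\<kappa>\<in>K. S0 / (R * wt j)\<^sup>2 * ((cmod (c j \<kappa>))\<^sup>2 * G \<kappa>))"
        proof (rule sum_mono)
          fix \<kappa> assume K: "\<kappa> \<in> K"
          show "(if \<kappa> \<in> \<Lambda> j then 0 else cr j \<kappa>)\<^sup>2 * W \<kappa> \<le> S0 / (R * wt j)\<^sup>2 * ((cmod (c j \<kappa>))\<^sup>2 * G \<kappa>)"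
          proof (cases "\<kappa> \<in> \<Lambda> j")
            case True
            then show ?thesis using S0 G0[of \<kappa>] by simp
          next
            case False
            have rw: "0 < R * wt j" using R wt(1)[of j] by simp
            have "(R * wt j)\<^sup>2 \<le> (V \<kappa>)\<^sup>2" using False K rw by (intro power_mono) (auto simp: \<Lambda>_def)
            then have "W \<kappa> * (R * wt j)\<^sup>2 \<le> W \<kappa> * (V \<kappa>)\<^sup>2" using W1[of \<kappa>] by (intro mult_left_mono) auto
            also have "\<dots> \<le> S0 * G \<kappa>" by (rule WV)
            finally have "W \<kappa> \<le> S0 * G \<kappa> / (R * wt j)\<^sup>2" using zero_less_power[OF rw, of 2] by (simp only: pos_le_divide_eq)
            then have "(cr j \<kappa>)\<^sup>2 * W \<kappa> \<le> (cmod (c j \<kappa>))\<^sup>2 * (S0 * G \<kappa> / (R * wt j)\<^sup>2)"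
              using W1[of \<kappa>] cr by (intro mult_mono) auto
            then show ?thesis using False by (simp add: mult_ac)
          qed
        qed
        also have "\<dots> = S0 / R\<^sup>2 * ((\<Sum>\<kappa>\<in>K. (cmod (c j \<kappa>))\<^sup>2 * G \<kappa>) / (wt j)\<^sup>2)"
          unfolding sum_distrib_left[symmetric] by (simp add: power_mult_distrib)
        finally show ?thesis .
      qed
      have "(\<Sum>j<J. \<integral>y. (\<Sum>\<kappa>\<in>K - \<Lambda> j. cr j \<kappa> * (\<Prod>i<d. cheb (\<kappa> i) (y i)))\<^sup>2 \<partial>uniform_cube)
         \<le> (\<Sum>j<J. S0 / R\<^sup>2 * ((\<Sum>\<kappa>\<in>K. (cmod (c j \<kappa>))\<^sup>2 * G \<kappa>) / (wt j)\<^sup>2))"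
        by (intro sum_mono tj)
      also have "\<dots> \<le> S0 / R\<^sup>2 * M2"
        unfolding sum_distrib_left[symmetric] using S0 by (intro mult_left_mono par) auto
      also have "\<dots> \<le> C / R\<^sup>2" using Cge(4) by (simp add: divide_right_mono)
      finally show ?thesis .
    qed
    show "\<exists>n c \<Lambda>. (\<forall>j<J. \<Lambda> j \<subseteq> PiE {..<d} (\<lambda>_. {..n}) \<and>
          (\<forall>\<kappa>\<in>\<Lambda> j. real (\<Sum>i<d. \<kappa> i) \<le> C * (1 + ln R) \<and> \<bar>c j \<kappa>\<bar> \<le> C)) \<and>
        real (\<Sum>j<J. card (\<Lambda> j)) \<le> C * R powr p \<and>
        (\<forall>j<J. \<forall>y\<in>param_cube. \<bar>Re (f j (\<lambda>i. if i < d then of_real (y i) else 0))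
            - (\<Sum>\<kappa>\<in>PiE {..<d} (\<lambda>_. {..n}). c j \<kappa> * (\<Prod>i<d. cheb (\<kappa> i) (y i)))\<bar> \<le> \<epsilon>) \<and>
        (\<forall>j<J. integrable uniform_cube (\<lambda>y. (\<Sum>\<kappa>\<in>PiE {..<d} (\<lambda>_. {..n}) - \<Lambda> j. c j \<kappa> * (\<Prod>i<d. cheb (\<kappa> i) (y i)))\<^sup>2)) \<and>
        (\<Sum>j<J. \<integral>y. (\<Sum>\<kappa>\<in>PiE {..<d} (\<lambda>_. {..n}) - \<Lambda> j. c j \<kappa> * (\<Prod>i<d. cheb (\<kappa> i) (y i)))\<^sup>2 \<partial>uniform_cube) \<le> C / R\<^sup>2"
    proof (intro exI[of _ n] exI[of _ cr] exI[of _ \<Lambda>], fold K_def, intro conjI)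
      show "\<forall>j<J. \<Lambda> j \<subseteq> K \<and> (\<forall>\<kappa>\<in>\<Lambda> j. real (\<Sum>i<d. \<kappa> i) \<le> C * (1 + ln R) \<and> \<bar>cr j \<kappa>\<bar> \<le> C)"
        using deg cb by (auto simp: \<Lambda>_def)
      show "\<forall>j<J. integrable uniform_cube (\<lambda>y. (\<Sum>\<kappa>\<in>K - \<Lambda> j. cr j \<kappa> * (\<Prod>i<d. cheb (\<kappa> i) (y i)))\<^sup>2)"
        unfolding trunc by (intro allI impI ms(1))
    qed (use cnt app tail in blast)+
  qed
qed

subsection \<open>The parametrisation of the input set\<close>

text \<open>The sort \<^class>\<open>banach\<close> is not inferred from \<^class>\<open>real_normed_vector\<close> and \<^class>\<open>complete_space\<close>.\<close>

lemma summable_complete_comparison: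
  fixes f :: "nat \<Rightarrow> 'a::{real_normed_vector, complete_space}"
  assumes le: "\<And>n. norm (f n) \<le> g n" and g: "summable g"
  shows "summable f" "norm (suminf f) \<le> suminf g"
proof -
  have "Cauchy (\<lambda>n. \<Sum>j<n. f j)"
  proof (rule CauchyI')
    fix e :: real assume "0 < e"
    with g obtain N where N: "\<And>m n. m \<ge> N \<Longrightarrow> norm (\<Sum>j\<in>{m..<n}. g j) < e"
      unfolding summable_Cauchy by blast
    show "\<exists>M. \<forall>m\<ge>M. \<forall>n>m. dist (\<Sum>j<m. f j) (\<Sum>j<n. f j) < e"
    proof (intro exI[of _ N] allI impI)
      fix m n :: nat assume mn: "N \<le> m" "m < n"
      have "(\<Sum>j<n. f j) - (\<Sum>j<m. f j) = (\<Sum>j\<in>{m..<n}. f j)"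
        using mn sum_diff_nat_ivl[of 0 m n f] by (simp add: atLeast0LessThan)
      then have "dist (\<Sum>j<m. f j) (\<Sum>j<n. f j) = norm (\<Sum>j\<in>{m..<n}. f j)"
        by (metis dist_commute dist_norm)
      also have "\<dots> \<le> (\<Sum>j\<in>{m..<n}. g j)" by (rule sum_norm_le) (rule le)
      also have "\<dots> < e" using N[OF mn(1), of n] by simp
      finally show "dist (\<Sum>j<m. f j) (\<Sum>j<n. f j) < e" .
    qed
  qed
  then show f: "summable f" by (simp add: summable_iff_convergent Cauchy_convergent)
  have "norm (\<Sum>j<n. f j) \<le> suminf g" for n
  proof -
    have "norm (\<Sum>j<n. f j) \<le> (\<Sum>j<n. g j)" by (rule sum_norm_le) (rule le)
    also have "\<dots> \<le> suminf g" using order_trans[OF norm_ge_zero le] by (intro sum_le_suminf g) auto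
    finally show ?thesis .
  qed
  then show "norm (suminf f) \<le> suminf g"
    by (intro Lim_bounded[OF tendsto_norm[OF summable_LIMSEQ[OF f]], of 0]) auto
qed

locale riesz_weights =
  fixes w :: "nat \<Rightarrow> real" and \<psi> \<psi>d :: "nat \<Rightarrow> 'x::{real_inner, complete_space, second_countable_topology}"
    and r s :: real
  assumes riesz: "riesz_basis \<psi>" and dual: "dual_basis \<psi> \<psi>d"
    and w_pos: "\<And>j. 0 < w j" and w_summable: "\<And>\<epsilon>. 0 < \<epsilon> \<Longrightarrow> summable (\<lambda>j. w j powr (1 + \<epsilon>))"
    and r_pos: "0 < r" and s_gt_1: "1 < s"
begin

lemma w_powr_summable: "1 < a \<Longrightarrow> summable (\<lambda>j. w j powr a)"
  using w_summable[of "a - 1"] by simp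

lemma w_powr_mult_summable:
  assumes "\<And>j. \<bar>y j\<bar> \<le> 1"
  shows "summable (\<lambda>j. norm ((w j powr s * y j) *\<^sub>R \<psi> j))"
proof -
  obtain B where B: "0 < B" "\<And>A c. finite A \<Longrightarrow> norm (\<Sum>j\<in>A. c j *\<^sub>R \<psi> j) \<le> B * sqrt (\<Sum>j\<in>A. (c j)\<^sup>2)"
    using riesz_basis_sum_bound[OF riesz] by blast
  have n: "norm (\<psi> j) \<le> B" for j using B(2)[of "{j}" "\<lambda>_. 1"] by simp
  show ?thesis
  proof (rule summable_comparison_test'[of "\<lambda>j. w j powr s * B" 0])
    show "summable (\<lambda>j. w j powr s * B)" by (intro summable_mult2 w_powr_summable s_gt_1)
    fix j
    have "\<bar>w j powr s * y j\<bar> * norm (\<psi> j) \<le> (w j powr s * 1) * B"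
      unfolding abs_mult using assms[of j] n[of j] by (intro mult_mono) auto
    then show "norm (norm ((w j powr s * y j) *\<^sub>R \<psi> j)) \<le> w j powr s * B" by simp
  qed
qed

lemma param_cube_abs: "y \<in> param_cube \<Longrightarrow> \<bar>y j\<bar> \<le> 1"
  by (simp add: param_cube_def abs_le_iff minus_le_iff)

lemma param_map_sums:
  assumes "y \<in> param_cube"
  shows "(\<lambda>j. (r * (w j powr s * y j)) *\<^sub>R \<psi> j) sums param_map w \<psi> r s y"
proof -
  have "summable (\<lambda>j. (w j powr s * y j) *\<^sub>R \<psi> j)"
    by (rule summable_complete_comparison(1)[OF order_refl w_powr_mult_summable[OF param_cube_abs[OF assms]]])
  then have "(\<lambda>j. r *\<^sub>R ((w j powr s * y j) *\<^sub>R \<psi> j)) sums (r *\<^sub>R (\<Sum>j. (w j powr s * y j) *\<^sub>R \<psi> j))"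
    by (intro sums_scaleR_right summable_sums)
  then show ?thesis by (simp add: param_map_def)
qed

lemma param_map_coeff:
  assumes "y \<in> param_cube"
  shows "inner (param_map w \<psi> r s y) (\<psi>d j) = r * (w j powr s * y j)"
proof -
  have "(\<lambda>i. inner ((r * (w i powr s * y i)) *\<^sub>R \<psi> i) (\<psi>d j)) sums inner (param_map w \<psi> r s y) (\<psi>d j)"
    by (rule bounded_linear.sums[OF bounded_linear_inner_left param_map_sums[OF assms]])
  moreover have "(\<lambda>i. inner ((r * (w i powr s * y i)) *\<^sub>R \<psi> i) (\<psi>d j)) = (\<lambda>i. if i = j then r * (w i powr s * y i) else 0)"
    using dual by (auto simp: dual_basis_def fun_eq_iff)
  moreover have "(\<lambda>i. if i = j then r * (w i powr s * y i) else 0) sums (r * (w j powr s * y j))"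
    by (rule sums_single)
  ultimately show ?thesis by (simp only: sums_iff)
qed

lemma C_tilde_eq_C_set: "C_tilde w \<psi> r s = C_set w \<psi>d r s"
proof (intro equalityI subsetI)
  fix a assume "a \<in> C_tilde w \<psi> r s"
  then obtain y where y: "y \<in> param_cube" "a = param_map w \<psi> r s y" by (auto simp: C_tilde_def)
  show "a \<in> C_set w \<psi>d r s"
    unfolding C_set_def y(2) mem_Collect_eq param_map_coeff[OF y(1)]
  proof
    fix j
    have "\<bar>r * (w j powr s * y j)\<bar> * w j powr - s = r * \<bar>y j\<bar> * (w j powr s * w j powr - s)"
      using r_pos by (simp add: abs_mult)
    also have "w j powr s * w j powr - s = 1" using w_pos[of j] by (simp add: powr_minus)
    finally show "\<bar>r * (w j powr s * y j)\<bar> * w j powr - s \<le> r"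
      using param_cube_abs[OF y(1), of j] r_pos by (simp add: mult_left_le)
  qed
next
  fix a assume a: "a \<in> C_set w \<psi>d r s"
  define y where "y = (\<lambda>j. inner a (\<psi>d j) * w j powr - s / r)"
  have "\<bar>y j\<bar> \<le> 1" for j
    using a r_pos by (simp add: C_set_def y_def abs_mult)
  then have y: "y \<in> param_cube" by (simp add: param_cube_def abs_le_iff minus_le_iff)
  have "inner (a - param_map w \<psi> r s y) (\<psi>d j) = 0" for j
    unfolding inner_diff_left param_map_coeff[OF y] using r_pos w_pos[of j] by (simp add: y_def powr_minus)
  then have "a - param_map w \<psi> r s y = 0" by (rule riesz_basis_total[OF riesz dual])
  then show "a \<in> C_tilde w \<psi> r s" using y by (auto simp: C_tilde_def)
qed

definition truncate_seq :: "nat \<Rightarrow> (nat \<Rightarrow> real) \<Rightarrow> nat \<Rightarrow> real" where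
  "truncate_seq d y = (\<lambda>i. if i < d then y i else 0)"

lemma truncate_seq_cube: "y \<in> param_cube \<Longrightarrow> truncate_seq d y \<in> param_cube"
  by (simp add: param_cube_def truncate_seq_def)

lemma param_map_truncate:
  "param_map w \<psi> r s (truncate_seq d y) = (\<Sum>i<d. (r * (w i powr s * y i)) *\<^sub>R \<psi> i)"
proof -
  have "(\<Sum>j. (w j powr s * truncate_seq d y j) *\<^sub>R \<psi> j) = (\<Sum>i<d. (w i powr s * truncate_seq d y i) *\<^sub>R \<psi> i)"
    by (rule suminf_finite) (auto simp: truncate_seq_def)
  then show ?thesis unfolding param_map_def
    by (simp add: scaleR_right.sum truncate_seq_def)
qed

lemma param_map_truncate_uniform:
  assumes "0 < e"
  obtains d0 where "\<And>d y. d0 \<le> d \<Longrightarrow> y \<in> param_cube \<Longrightarrow>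
    norm (param_map w \<psi> r s y - param_map w \<psi> r s (truncate_seq d y)) < e"
proof -
  obtain B where B: "0 < B" "\<And>A c. finite A \<Longrightarrow> norm (\<Sum>j\<in>A. c j *\<^sub>R \<psi> j) \<le> B * sqrt (\<Sum>j\<in>A. (c j)\<^sup>2)"
    using riesz_basis_sum_bound[OF riesz] by blast
  have n: "norm (\<psi> j) \<le> B" for j using B(2)[of "{j}" "\<lambda>_. 1"] by simp
  define g where "g = (\<lambda>j. r * B * w j powr s)"
  have g: "summable g" unfolding g_def by (intro summable_mult w_powr_summable s_gt_1)
  have g0: "0 \<le> g j" for j using r_pos B(1) by (simp add: g_def)
  obtain d0 where d0: "\<And>d. d0 \<le> d \<Longrightarrow> norm (\<Sum>i. g (i + d)) < e"
    using suminf_exist_split[OF assms g] by blast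
  show ?thesis
  proof (rule that[of d0])
    fix d y assume d: "d0 \<le> d" and y: "y \<in> param_cube"
    let ?h = "\<lambda>j. (r * (w j powr s * y j)) *\<^sub>R \<psi> j"
    have "(\<lambda>i. ?h (i + d)) sums (param_map w \<psi> r s y - (\<Sum>i<d. ?h i))"
      by (rule sums_split_initial_segment[OF param_map_sums[OF y]])
    then have eq: "param_map w \<psi> r s y - param_map w \<psi> r s (truncate_seq d y) = (\<Sum>i. ?h (i + d))"
      unfolding param_map_truncate by (simp add: sums_iff)
    have le: "norm (?h j) \<le> g j" for j
    proof -
      have "norm (?h j) = r * w j powr s * (\<bar>y j\<bar> * norm (\<psi> j))" using r_pos by (simp add: abs_mult)
      also have "\<dots> \<le> r * w j powr s * (1 * B)"
        using param_cube_abs[OF y, of j] n[of j] r_pos by (intro mult_left_mono mult_mono) auto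
      finally show ?thesis by (simp add: g_def mult_ac)
    qed
    have sg: "summable (\<lambda>i. g (i + d))" using g by (simp add: summable_iff_shift)
    have "norm (\<Sum>i. ?h (i + d)) \<le> (\<Sum>i. g (i + d))"
      by (rule summable_complete_comparison(2)[OF le sg])
    also have "\<dots> < e" using d0[OF d] by simp
    finally show "norm (param_map w \<psi> r s y - param_map w \<psi> r s (truncate_seq d y)) < e" unfolding eq .
  qed
qed

lemma compact_param_cube: "compact param_cube"
proof -
  have "compactin (product_topology (\<lambda>_::nat. euclideanreal) UNIV) (PiE UNIV (\<lambda>_. {-1..1}))"
    by (simp add: compactin_PiE)
  moreover have "PiE UNIV (\<lambda>_::nat. {-1..1::real}) = param_cube"
    by (auto simp: param_cube_def PiE_def)
  ultimately show ?thesis by (simp add: euclidean_product_topology)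
qed

lemma compact_C_tilde: "compact (C_tilde w \<psi> r s)"
  unfolding C_tilde_def
proof (rule compact_continuous_image[OF _ compact_param_cube])
  show "continuous_on param_cube (param_map w \<psi> r s)"
  proof (rule uniform_limit_theorem[where F = sequentially and f = "\<lambda>d y. \<Sum>i<d. (r * (w i powr s * y i)) *\<^sub>R \<psi> i"])
    show "\<forall>\<^sub>F n in sequentially. continuous_on param_cube (\<lambda>y. \<Sum>i<n. (r * (w i powr s * y i)) *\<^sub>R \<psi> i)"
      by (intro always_eventually allI continuous_intros continuous_on_product_then_coordinatewise continuous_on_id)
    show "uniform_limit param_cube (\<lambda>d y. \<Sum>i<d. (r * (w i powr s * y i)) *\<^sub>R \<psi> i) (param_map w \<psi> r s) sequentially"
    proof (rule uniform_limitI)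
      fix e :: real assume "0 < e"
      then obtain d0 where "\<And>d y. d0 \<le> d \<Longrightarrow> y \<in> param_cube \<Longrightarrow>
          norm (param_map w \<psi> r s y - param_map w \<psi> r s (truncate_seq d y)) < e"
        using param_map_truncate_uniform by blast
      then show "\<forall>\<^sub>F n in sequentially. \<forall>y\<in>param_cube. dist (\<Sum>i<n. (r * (w i powr s * y i)) *\<^sub>R \<psi> i) (param_map w \<psi> r s y) < e"
        unfolding eventually_sequentially by (auto simp: dist_norm norm_minus_commute param_map_truncate)
    qed
  qed simp
qed

lemma param_map_measurable:
  "param_map w \<psi> r s \<in> measurable uniform_cube (restrict_space borel (C_set w \<psi>d r s))"
proof (rule measurable_restrict_space2)
  show "param_map w \<psi> r s \<in> space uniform_cube \<rightarrow> C_set w \<psi>d r s"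
    by (auto simp: space_uniform_cube C_tilde_eq_C_set[symmetric] C_tilde_def)
  show "param_map w \<psi> r s \<in> borel_measurable uniform_cube"
  proof (rule borel_measurable_LIMSEQ_metric)
    fix d
    show "(\<lambda>y. \<Sum>i<d. (r * (w i powr s * y i)) *\<^sub>R \<psi> i) \<in> borel_measurable uniform_cube"
    proof (intro borel_measurable_sum borel_measurable_scaleR borel_measurable_const)
      fix i
      have "continuous_on UNIV (\<lambda>x. r * (w i powr s * x))"
        by (intro continuous_on_mult continuous_on_const continuous_on_id)
      then show "(\<lambda>y. r * (w i powr s * y i)) \<in> borel_measurable uniform_cube"
        by (rule coordinate_measurable)
    qed
  next
    fix y assume "y \<in> space uniform_cube"
    then show "(\<lambda>d. \<Sum>i<d. (r * (w i powr s * y i)) *\<^sub>R \<psi> i) \<longlonglongrightarrow> param_map w \<psi> r s y"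
      using param_map_sums[of y] by (simp add: space_uniform_cube sums_def)
  qed
qed

subsection \<open>Complex parameters\<close>

definition param_map_C :: "nat \<Rightarrow> (nat \<Rightarrow> complex) \<Rightarrow> 'x \<times> 'x" where
  "param_map_C d z = (\<Sum>i<d. (r * (w i powr s * Re (z i))) *\<^sub>R \<psi> i, \<Sum>i<d. (r * (w i powr s * Im (z i))) *\<^sub>R \<psi> i)"

lemma param_map_C_real:
  "param_map_C d (\<lambda>i. if i < d then of_real (y i) else 0) = (param_map w \<psi> r s (truncate_seq d y), 0)"
  by (simp add: param_map_C_def param_map_truncate)

lemma param_map_C_in_open:
  assumes "open OC" "(\<lambda>a. (a, 0)) ` C_tilde w \<psi> r s \<subseteq> OC" and a: "2 * (s - a) > 1"
  obtains c where "0 < c"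
    "\<And>d z. z \<in> polyell (\<lambda>i. 1 + c * w i powr (- a)) d \<Longrightarrow> param_map_C d z \<in> OC"
proof -
  obtain B where B: "0 < B" "\<And>A c. finite A \<Longrightarrow> norm (\<Sum>j\<in>A. c j *\<^sub>R \<psi> j) \<le> B * sqrt (\<Sum>j\<in>A. (c j)\<^sup>2)"
    using riesz_basis_sum_bound[OF riesz] by blast
  have "compact ((\<lambda>a. (a, 0::'x)) ` C_tilde w \<psi> r s)"
    by (rule compact_continuous_image[OF continuous_on_Pair[OF continuous_on_id continuous_on_const] compact_C_tilde])
  then obtain e where e: "0 < e" "(\<Union>x\<in>(\<lambda>a. (a, 0)) ` C_tilde w \<psi> r s. ball x e) \<subseteq> OC"
    using compact_subset_open_imp_ball_epsilon_subset[OF _ assms(1,2)] by metis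
  define S where "S = (\<Sum>i. w i powr (2 * (s - a)))"
  have sS: "summable (\<lambda>i. w i powr (2 * (s - a)))" by (rule w_powr_summable[OF a])
  have S: "0 \<le> S" unfolding S_def by (intro suminf_nonneg sS) auto
  define c where "c = e / (2 * (r * B * sqrt S + 1))"
  have D: "0 < r * B * sqrt S + 1" using r_pos B(1) S by (intro add_nonneg_pos mult_nonneg_nonneg) auto
  have c: "0 < c" using e D by (simp add: c_def)
  show ?thesis
  proof (rule that[OF c])
    fix d z assume z: "z \<in> polyell (\<lambda>i. 1 + c * w i powr (- a)) d"
    have "\<exists>x. \<bar>x\<bar> \<le> 1 \<and> (i < d \<longrightarrow> cmod (z i - of_real x) \<le> c * w i powr (- a))" for i
    proof (cases "i < d")
      case True
      have "1 \<le> 1 + c * w i powr (- a)" using c by simp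
      moreover have "z i \<in> ell (1 + c * w i powr (- a))" using z True by (simp add: polyell_def)
      ultimately obtain v where v: "1 \<le> cmod v" "cmod v < 1 + c * w i powr (- a)" "z i = jouk v"
        using ell_obtain by blast
      obtain x where "\<bar>x\<bar> \<le> 1" "cmod (jouk v - of_real x) \<le> cmod v - 1" using dist_cell_interval[OF v(1)] by blast
      with v True show ?thesis by (intro exI[of _ x]) auto
    qed (auto intro: exI[of _ 0])
    then obtain x where x: "\<And>i. \<bar>x i\<bar> \<le> 1" "\<And>i. i < d \<Longrightarrow> cmod (z i - of_real (x i)) \<le> c * w i powr (- a)"
      by metis
    have xc: "x \<in> param_cube" using x(1) by (simp add: param_cube_def abs_le_iff minus_le_iff)
    let ?p = "param_map w \<psi> r s (truncate_seq d x)"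
    have p: "?p \<in> C_tilde w \<psi> r s" using truncate_seq_cube[OF xc] by (auto simp: C_tilde_def)
    have bound: "norm (\<Sum>i<d. (r * (w i powr s * g i)) *\<^sub>R \<psi> i) \<le> B * (r * c * sqrt S)"
      if g: "\<And>i. i < d \<Longrightarrow> \<bar>g i\<bar> \<le> c * w i powr (- a)" for g
    proof -
      have "(\<Sum>i<d. (r * (w i powr s * g i))\<^sup>2) \<le> (\<Sum>i<d. (r * c)\<^sup>2 * w i powr (2 * (s - a)))"
      proof (rule sum_mono)
        fix i assume "i \<in> {..<d}"
        then have "(r * (w i powr s * g i))\<^sup>2 \<le> (r * (w i powr s * (c * w i powr (- a))))\<^sup>2"
          using g[of i] r_pos c by (intro abs_le_square_iff[THEN iffD1]) (auto simp: abs_mult intro!: mult_left_mono)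
        also have "\<dots> = (r * c)\<^sup>2 * (w i powr s * w i powr (- a))\<^sup>2" by (simp add: power_mult_distrib mult_ac)
        also have "(w i powr s * w i powr (- a))\<^sup>2 = w i powr (2 * (s - a))"
          by (simp add: powr_add[symmetric] power2_eq_square)
        finally show "(r * (w i powr s * g i))\<^sup>2 \<le> (r * c)\<^sup>2 * w i powr (2 * (s - a))" .
      qed
      also have "\<dots> = (r * c)\<^sup>2 * (\<Sum>i<d. w i powr (2 * (s - a)))" by (simp add: sum_distrib_left)
      also have "\<dots> \<le> (r * c)\<^sup>2 * S"
        unfolding S_def by (intro mult_left_mono sum_le_suminf sS) auto
      finally have "sqrt (\<Sum>i<d. (r * (w i powr s * g i))\<^sup>2) \<le> sqrt ((r * c)\<^sup>2 * S)" by (rule real_sqrt_le_mono)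
      also have "\<dots> = r * c * sqrt S" using r_pos c by (simp add: real_sqrt_mult)
      finally have "B * sqrt (\<Sum>i<d. (r * (w i powr s * g i))\<^sup>2) \<le> B * (r * c * sqrt S)"
        using B(1) by (intro mult_left_mono) auto
      with B(2)[of "{..<d}" "\<lambda>i. r * (w i powr s * g i)"] show ?thesis by simp
    qed
    have "param_map_C d z - (?p, 0) = (\<Sum>i<d. (r * (w i powr s * (Re (z i) - x i))) *\<^sub>R \<psi> i, \<Sum>i<d. (r * (w i powr s * Im (z i))) *\<^sub>R \<psi> i)"
      unfolding param_map_C_def param_map_truncate diff_Pair diff_zero sum_subtractf[symmetric]
        scaleR_diff_left[symmetric] right_diff_distrib[symmetric] ..
    then have "norm (param_map_C d z - (?p, 0)) \<le> norm (\<Sum>i<d. (r * (w i powr s * (Re (z i) - x i))) *\<^sub>R \<psi> i) + norm (\<Sum>i<d. (r * (w i powr s * Im (z i))) *\<^sub>R \<psi> i)"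
      by (simp only: norm_Pair_le)
    also have "\<dots> \<le> B * (r * c * sqrt S) + B * (r * c * sqrt S)"
    proof (intro add_mono bound)
      fix i assume i: "i < d"
      show "\<bar>Re (z i) - x i\<bar> \<le> c * w i powr (- a)"
        using abs_Re_le_cmod[of "z i - of_real (x i)"] x(2)[OF i] by simp
      show "\<bar>Im (z i)\<bar> \<le> c * w i powr (- a)"
        using abs_Im_le_cmod[of "z i - of_real (x i)"] x(2)[OF i] by simp
    qed
    also have "\<dots> = 2 * c * (r * B * sqrt S)" by simp
    also have "\<dots> < 2 * c * (r * B * sqrt S + 1)" using c by simp
    also have "\<dots> = e"
    proof -
      have "2 * (e / (2 * X)) * X = e" if "0 < X" for X using that by simp
      then show ?thesis unfolding c_def using D .
    qed
    finally have "param_map_C d z \<in> ball (?p, 0) e" by (simp add: dist_norm norm_minus_commute)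
    then show "param_map_C d z \<in> OC" using e(2) p by blast
  qed
qed

lemma param_map_C_derivative:
  assumes "i < d"
  shows "((\<lambda>x. param_map_C d (z(i := x))) has_derivative (\<lambda>h. cscale h ((r * w i powr s) *\<^sub>R \<psi> i, 0))) (at x)"
proof -
  define a where "a = param_map_C d (z(i := 0))"
  have "param_map_C d (z(i := x)) = a + cscale x ((r * w i powr s) *\<^sub>R \<psi> i, 0)" for x
  proof -
    have split: "(\<Sum>k<d. (r * (w k powr s * g ((z(i := x)) k))) *\<^sub>R \<psi> k)
        = (\<Sum>k\<in>{..<d} - {i}. (r * (w k powr s * g (z k))) *\<^sub>R \<psi> k) + (r * (w i powr s * g x)) *\<^sub>R \<psi> i"
      for g :: "complex \<Rightarrow> real" and x
      using assms by (subst sum.remove[of _ i]) (auto intro!: sum.cong)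
    show ?thesis unfolding a_def param_map_C_def split cscale_def by (simp add: mult_ac)
  qed
  moreover have "((\<lambda>x. a + cscale x ((r * w i powr s) *\<^sub>R \<psi> i, 0)) has_derivative (\<lambda>h. cscale h ((r * w i powr s) *\<^sub>R \<psi> i, 0))) (at x)"
    unfolding cscale_def by (auto intro!: derivative_eq_intros)
  ultimately show ?thesis by simp
qed

lemma holomorphic_coeff:
  fixes H :: "'x \<times> 'x \<Rightarrow> 'y::real_inner \<times> 'y"
  assumes "holomorphic_map_on H OC" and "open S" and i: "i < d"
    and S: "\<And>x. x \<in> S \<Longrightarrow> param_map_C d (z(i := x)) \<in> OC"
  shows "(\<lambda>x. complex_coeff (H (param_map_C d (z(i := x)))) v) holomorphic_on S"
proof (rule holomorphic_onI)
  fix x assume x: "x \<in> S"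
  obtain D where D: "(H has_derivative D) (at (param_map_C d (z(i := x))))" "\<And>c h. D (cscale c h) = cscale c (D h)"
    using assms(1) S[OF x] unfolding holomorphic_map_on_def by blast
  let ?e = "((r * w i powr s) *\<^sub>R \<psi> i, 0::'x)"
  have cc: "complex_coeff u v = of_real (inner (fst u) v) + \<i> * of_real (inner (snd u) v)" for u
    by (simp add: complex_coeff_def complex_eq_iff)
  have "((\<lambda>x. H (param_map_C d (z(i := x)))) has_derivative (\<lambda>h. D (cscale h ?e))) (at x)"
    by (rule has_derivative_compose[OF param_map_C_derivative[OF i] D(1)])
  then have "((\<lambda>x. complex_coeff (H (param_map_C d (z(i := x)))) v) has_derivative (\<lambda>h. complex_coeff (D (cscale h ?e)) v)) (at x)"
    unfolding cc by (auto intro!: derivative_eq_intros)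
  moreover have "complex_coeff (D (cscale h ?e)) v = complex_coeff (D ?e) v * h" for h
    unfolding D(2) by (simp add: complex_coeff_def cscale_def complex_eq_iff inner_diff_left inner_add_left mult_ac)
  ultimately have "((\<lambda>x. complex_coeff (H (param_map_C d (z(i := x)))) v) has_field_derivative complex_coeff (D ?e) v) (at x)"
    by (simp add: has_field_derivative_def)
  then show "(\<lambda>x. complex_coeff (H (param_map_C d (z(i := x)))) v) field_differentiable at x within S"
    by (meson field_differentiable_at_within field_differentiable_def)
qed

end

lemma Yt_partial_bound:
  assumes "z \<in> Yt_space_C w \<eta> t" "Yt_norm_C w \<eta> t z \<le> M" "\<And>j. 0 < w j" "finite A"
  shows "(\<Sum>j\<in>A. (cmod (complex_coeff z (canonical_dual_frame \<eta> j)))\<^sup>2 / (w j powr t)\<^sup>2) \<le> M\<^sup>2"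
proof -
  let ?g = "\<lambda>j. (cmod (complex_coeff z (canonical_dual_frame \<eta> j)))\<^sup>2 * w j powr (- 2 * t)"
  have s: "summable ?g" using assms(1) by (simp add: Yt_space_C_def)
  have g: "?g j = (cmod (complex_coeff z (canonical_dual_frame \<eta> j)))\<^sup>2 / (w j powr t)\<^sup>2" for j
  proof -
    have "w j powr (- 2 * t) = inverse ((w j powr t) * (w j powr t))"
      using assms(3)[of j] by (simp add: powr_add[symmetric] powr_minus[symmetric])
    then show ?thesis by (simp add: power2_eq_square divide_inverse)
  qed
  have "(\<Sum>j\<in>A. (cmod (complex_coeff z (canonical_dual_frame \<eta> j)))\<^sup>2 / (w j powr t)\<^sup>2) = (\<Sum>j\<in>A. ?g j)"
    by (rule sum.cong[OF refl g[symmetric]])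
  also have "\<dots> \<le> suminf ?g" by (rule sum_le_suminf[OF s assms(4)]) auto
  also have "\<dots> = (sqrt (suminf ?g))\<^sup>2" using suminf_nonneg[OF s] by simp
  also have "\<dots> \<le> M\<^sup>2" using assms(2) suminf_nonneg[OF s] unfolding Yt_norm_C_def by (intro power_mono) auto
  finally show ?thesis .
qed

subsection \<open>Chebyshev products by networks\<close>

lemma prod_list_upt: "prod_list (map f [0..<n]) = (\<Prod>l<n. f l :: real)"
  by (induction n) simp_all

lemma cheb_half_factor:
  fixes x :: real
  shows "\<exists>T. 0 < T \<and> T \<le> 4 ^ n \<and> (\<forall>x. cheb n x = T * (\<Prod>l<n. x / 2 - cheb_node n l / 2))"
proof (cases n)
  case 0
  then show ?thesis by (intro exI[of _ 1]) simp
next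
  case (Suc m)
  have "cheb n x = 2 ^ (2 * m + 1) * (\<Prod>l<n. x / 2 - cheb_node n l / 2)" for x :: real
  proof -
    have "(\<Prod>l<n. x - cheb_node n l) = (\<Prod>l<n. 2 * (x / 2 - cheb_node n l / 2))"
      by (intro prod.cong) auto
    also have "\<dots> = 2 ^ n * (\<Prod>l<n. x / 2 - cheb_node n l / 2)"
      by (simp only: prod.distrib prod_constant card_lessThan)
    finally have p: "(\<Prod>l<n. x - cheb_node n l) = 2 ^ n * (\<Prod>l<n. x / 2 - cheb_node n l / 2)" .
    have "cheb n x = 2 ^ m * (\<Prod>l<n. x - cheb_node n l)"
      using cheb_factor[of m x] unfolding Suc[symmetric] by simp
    also have "\<dots> = 2 ^ m * 2 ^ n * (\<Prod>l<n. x / 2 - cheb_node n l / 2)" unfolding p by simp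
    also have "(2::real) ^ m * 2 ^ n = 2 ^ (2 * m + 1)" unfolding power_add[symmetric] Suc by (rule arg_cong[where f = "power 2"]) simp
    finally show ?thesis .
  qed
  moreover have "(2::real) ^ (2 * m + 1) \<le> 4 ^ n"
  proof -
    have "(2::real) ^ (2 * m + 1) \<le> 2 ^ (2 * n)" by (intro power_increasing) (auto simp: Suc)
    also have "\<dots> = 4 ^ n" by (simp add: power_mult)
    finally show ?thesis .
  qed
  ultimately show ?thesis by (intro exI[of _ "2 ^ (2 * m + 1)"]) auto
qed

lemma cheb_factor_list:
  fixes \<kappa> :: "nat \<Rightarrow> nat" and d :: nat
  shows
  "\<exists>fl T. length fl = (\<Sum>i<d. \<kappa> i) \<and> 0 < T \<and> T \<le> 4 ^ (\<Sum>i<d. \<kappa> i) \<and>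
     (\<forall>(i, b)\<in>set fl. i < d \<and> \<bar>b\<bar> \<le> 1/2) \<and>
     (\<forall>y. (\<Prod>i<d. cheb (\<kappa> i) (y i)) = T * prod_list (map (\<lambda>(i, b). y i / 2 - b :: real) fl))"
proof (induction d)
  case 0
  show ?case by (intro exI[of _ "[]"] exI[of _ 1]) simp
next
  case (Suc d)
  then obtain fl T where fl: "length fl = (\<Sum>i<d. \<kappa> i)" "0 < T" "T \<le> 4 ^ (\<Sum>i<d. \<kappa> i)"
    "\<forall>(i, b)\<in>set fl. i < d \<and> \<bar>b\<bar> \<le> 1/2"
    "\<And>y. (\<Prod>i<d. cheb (\<kappa> i) (y i)) = T * prod_list (map (\<lambda>(i, b). y i / 2 - b :: real) fl)" by blast
  obtain S where S: "0 < S" "S \<le> 4 ^ \<kappa> d" "\<And>x::real. cheb (\<kappa> d) x = S * (\<Prod>l<\<kappa> d. x / 2 - cheb_node (\<kappa> d) l / 2)"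
    using cheb_half_factor by blast
  let ?fl = "fl @ map (\<lambda>l. (d, cheb_node (\<kappa> d) l / 2)) [0..<\<kappa> d]"
  show ?case
  proof (intro exI[of _ ?fl] exI[of _ "T * S"] conjI allI)
    show "length ?fl = (\<Sum>i<Suc d. \<kappa> i)" using fl(1) by simp
    show "0 < T * S" using fl S by simp
    show "T * S \<le> 4 ^ (\<Sum>i<Suc d. \<kappa> i)"
      using mult_mono[OF fl(3) S(2)] S(1) by (simp add: power_add)
    show "\<forall>(i, b)\<in>set ?fl. i < Suc d \<and> \<bar>b\<bar> \<le> 1/2"
      using fl(4) cheb_node_bounds[of "\<kappa> d"] by (fastforce simp: abs_divide)
    fix y :: "nat \<Rightarrow> real"
    show "(\<Prod>i<Suc d. cheb (\<kappa> i) (y i)) = T * S * prod_list (map (\<lambda>(i, b). y i / 2 - b) ?fl)"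
      by (simp add: fl(5) S(3) prod_list_upt comp_def)
  qed
qed

lemma cheb_padded_factors:
  fixes \<kappa> :: "nat \<Rightarrow> nat" and d K :: nat
  assumes "0 < d" "(\<Sum>i<d. \<kappa> i) \<le> K"
  shows "\<exists>iv a b T. 0 \<le> T \<and> T \<le> 4 ^ K \<and> (\<forall>k. iv k < d) \<and>
    (\<forall>y. (\<Prod>i<d. cheb (\<kappa> i) (y i)) = T * (\<Prod>k<K. a k * y (iv k) + b k)) \<and>
    (\<forall>y k. (\<forall>i. \<bar>y i\<bar> \<le> (1::real)) \<longrightarrow> \<bar>a k * y (iv k) + b k\<bar> \<le> 1)"
proof -
  obtain fl T where fl: "length fl = (\<Sum>i<d. \<kappa> i)" "0 < T" "T \<le> 4 ^ (\<Sum>i<d. \<kappa> i)"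
    "\<forall>(i, b)\<in>set fl. i < d \<and> \<bar>b\<bar> \<le> 1/2"
    "\<And>y. (\<Prod>i<d. cheb (\<kappa> i) (y i)) = T * prod_list (map (\<lambda>(i, b). y i / 2 - b :: real) fl)"
    using cheb_factor_list by blast
  define n where "n = length fl"
  have nK: "n \<le> K" using fl(1) assms by (simp add: n_def)
  define iv where "iv = (\<lambda>k. if k < n then fst (fl ! k) else 0)"
  define a where "a = (\<lambda>k. if k < n then 1/2 else 0 :: real)"
  define b where "b = (\<lambda>k. if k < n then - snd (fl ! k) else 1 :: real)"
  have mem: "fst (fl ! k) < d \<and> \<bar>snd (fl ! k)\<bar> \<le> 1/2" if "k < n" for k
    using fl(4) nth_mem[of k fl] that by (auto simp: n_def case_prod_unfold)
  show ?thesis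
  proof (rule exI[of _ iv], rule exI[of _ a], rule exI[of _ b], rule exI[of _ T], intro conjI allI impI)
    show "0 \<le> T" using fl by simp
    have "(4::real) ^ (\<Sum>i<d. \<kappa> i) \<le> 4 ^ K" using assms by (intro power_increasing) auto
    with fl(3) show "T \<le> 4 ^ K" by linarith
    show "iv k < d" for k using mem assms by (simp add: iv_def)
    fix y :: "nat \<Rightarrow> real"
    have "map (\<lambda>(i, b). y i / 2 - b) fl = map (\<lambda>k. y (fst (fl ! k)) / 2 - snd (fl ! k)) [0..<n]"
      by (rule nth_equalityI) (simp_all add: n_def case_prod_unfold)
    then have "prod_list (map (\<lambda>(i, b). y i / 2 - b) fl) = (\<Prod>k<n. y (fst (fl ! k)) / 2 - snd (fl ! k))"
      by (simp only: prod_list_upt)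
    also have "\<dots> = (\<Prod>k<n. a k * y (iv k) + b k)"
      by (intro prod.cong) (auto simp: a_def b_def iv_def)
    also have "\<dots> = (\<Prod>k<K. a k * y (iv k) + b k)"
      using nK by (intro prod.mono_neutral_left) (auto simp: a_def b_def)
    finally show "(\<Prod>i<d. cheb (\<kappa> i) (y i)) = T * (\<Prod>k<K. a k * y (iv k) + b k)" by (simp add: fl(5))
    fix k assume y: "\<forall>i. \<bar>y i\<bar> \<le> 1"
    show "\<bar>a k * y (iv k) + b k\<bar> \<le> 1"
    proof (cases "k < n")
      case True
      have "\<bar>y (fst (fl ! k)) / 2 - snd (fl ! k)\<bar> \<le> 1"
        using mem[OF True] spec[OF y, of "fst (fl ! k)"] by linarith
      then show ?thesis using True by (simp add: a_def b_def iv_def)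
    qed (simp add: a_def b_def)
  qed
qed

theorem sparse_cheb_network:
  fixes d J K m :: nat and c :: "nat \<Rightarrow> (nat \<Rightarrow> nat) \<Rightarrow> real" and u :: "nat \<Rightarrow> real"
  assumes d: "0 < d" and J: "0 < J" and fin: "\<And>j. j < J \<Longrightarrow> finite (\<Lambda> j)"
    and deg: "\<And>j \<kappa>. j < J \<Longrightarrow> \<kappa> \<in> \<Lambda> j \<Longrightarrow> (\<Sum>i<d. \<kappa> i) \<le> K"
    and C: "0 \<le> C" "\<And>j \<kappa>. j < J \<Longrightarrow> \<kappa> \<in> \<Lambda> j \<Longrightarrow> \<bar>c j \<kappa>\<bar> \<le> C"
    and u: "\<And>i. 0 < u i"
  defines "P \<equiv> \<Sum>j<J. card (\<Lambda> j)"
  shows "\<exists>net. is_network net \<and> input_dim net = d \<and> output_dim net = J \<and>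
    network_size net \<le> 2 * ((P + 1) * (5 + K)) + K * (m + 2) * (6 * ((P + 1) * (5 + K))) + 2 * P \<and>
    (\<forall>x y. (\<forall>i. \<bar>y i\<bar> \<le> 1) \<longrightarrow> (\<forall>i<d. x i = u i * y i) \<longrightarrow>
      (\<Sum>j<J. \<bar>vec_index (realization net (Matrix.vec d x)) j - (\<Sum>\<kappa>\<in>\<Lambda> j. c j \<kappa> * (\<Prod>i<d. cheb (\<kappa> i) (y i)))\<bar>)
        \<le> real P * (C * 4 ^ K) * (real K * (1/4) ^ m)) \<and>
    (\<forall>(M :: 'a measure) g j. (\<forall>i. (\<lambda>a. g a i) \<in> borel_measurable M) \<longrightarrow> j < J \<longrightarrow>
      (\<lambda>a. vec_index (realization net (Matrix.vec d (g a))) j) \<in> borel_measurable M)"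
proof -
  define \<K> where "\<K> = insert (\<lambda>_. 0) (\<Union>j<J. \<Lambda> j)"
  have finK: "finite \<K>" using fin by (auto simp: \<K>_def)
  define nb where "nb = card \<K>"
  have nb0: "0 < nb" using finK by (auto simp: nb_def \<K>_def card_gt_0_iff)
  have nbP: "nb \<le> P + 1"
  proof -
    have "nb \<le> Suc (card (\<Union>j<J. \<Lambda> j))" unfolding nb_def \<K>_def by (rule card_insert_le_m1) auto
    also have "card (\<Union>j<J. \<Lambda> j) \<le> P" unfolding P_def by (rule card_UN_le) simp
    finally show ?thesis by simp
  qed
  obtain en where en: "bij_betw en {0..<nb} \<K>" using ex_bij_betw_nat_finite[OF finK] by (auto simp: nb_def)
  have enK: "en b \<in> \<K>" if "b < nb" for b using en that by (auto simp: bij_betw_def)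
  have degK: "(\<Sum>i<d. \<kappa> i) \<le> K" if "\<kappa> \<in> \<K>" for \<kappa> using that deg by (auto simp: \<K>_def)
  have "\<forall>b. \<exists>iv a \<beta> T. b < nb \<longrightarrow> 0 \<le> T \<and> T \<le> 4 ^ K \<and> (\<forall>k. iv k < d) \<and>
    (\<forall>y. (\<Prod>i<d. cheb (en b i) (y i)) = T * (\<Prod>k<K. a k * y (iv k) + \<beta> k)) \<and>
    (\<forall>y k. (\<forall>i. \<bar>y i\<bar> \<le> (1::real)) \<longrightarrow> \<bar>a k * y (iv k) + \<beta> k\<bar> \<le> 1)"
    using cheb_padded_factors[OF d degK[OF enK]] by blast
  then obtain iv a \<beta> T where F: "\<And>b. b < nb \<Longrightarrow> 0 \<le> T b \<and> T b \<le> 4 ^ K \<and> (\<forall>k. iv b k < d) \<and>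
    (\<forall>y. (\<Prod>i<d. cheb (en b i) (y i)) = T b * (\<Prod>k<K. a b k * y (iv b k) + \<beta> b k)) \<and>
    (\<forall>y k. (\<forall>i. \<bar>y i\<bar> \<le> (1::real)) \<longrightarrow> \<bar>a b k * y (iv b k) + \<beta> b k\<bar> \<le> 1)"
    unfolding choice_iff by blast
  define A where "A = (\<lambda>j b. if en b \<in> \<Lambda> j then c j (en b) * T b else 0)"
  define \<alpha> where "\<alpha> = (\<lambda>b k. a b k / u (iv b k))"
  have iv: "iv b k < d" if "b < nb" "k < K" for b k using F that by blast
  obtain net where net: "is_network net" "input_dim net = d" "output_dim net = J"
    and size: "network_size net \<le> 2 * (nb * (5 + K)) + K * (m + 2) * (6 * (nb * (5 + K)))
      + 2 * card {(j, b). j < J \<and> b < nb \<and> A j b \<noteq> 0}"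
    and err: "\<And>x j. (\<And>b k. b < nb \<Longrightarrow> k < K \<Longrightarrow> \<bar>\<alpha> b k * x (iv b k) + \<beta> b k\<bar> \<le> 1) \<Longrightarrow> j < J \<Longrightarrow>
      \<bar>vec_index (realization net (Matrix.vec d x)) j - (\<Sum>b<nb. A j b * (\<Prod>k<K. \<alpha> b k * x (iv b k) + \<beta> b k))\<bar>
      \<le> (\<Sum>b<nb. \<bar>A j b\<bar>) * (real K * (1/4) ^ m)"
    and meas: "\<And>(M :: 'a measure) g j. (\<And>i. (\<lambda>a. g a i) \<in> borel_measurable M) \<Longrightarrow> j < J \<Longrightarrow>
      (\<lambda>a. vec_index (realization net (Matrix.vec d (g a))) j) \<in> borel_measurable M"
    using product_network[where d = d and J = J and nb = nb and K = K and iv = iv and \<alpha> = \<alpha> and \<beta> = \<beta> and A = A and m = m, OF d J nb0 iv]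
    by blast
  have reindex: "(\<Sum>b<nb. if en b \<in> \<Lambda> j then f (en b) else 0) = (\<Sum>\<kappa>\<in>\<Lambda> j. f \<kappa>)" if "j < J" for j and f :: "(nat \<Rightarrow> nat) \<Rightarrow> real"
  proof -
    have "(\<Sum>b<nb. if en b \<in> \<Lambda> j then f (en b) else 0) = (\<Sum>\<kappa>\<in>\<K>. if \<kappa> \<in> \<Lambda> j then f \<kappa> else 0)"
      using sum.reindex_bij_betw[OF en, of "\<lambda>\<kappa>. if \<kappa> \<in> \<Lambda> j then f \<kappa> else 0"] by (simp add: atLeast0LessThan)
    also have "\<dots> = (\<Sum>\<kappa>\<in>\<Lambda> j. f \<kappa>)"
      using finK that by (intro sum.mono_neutral_cong_right) (auto simp: \<K>_def)
    finally show ?thesis .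
  qed
  have cardA: "card {(j, b). j < J \<and> b < nb \<and> A j b \<noteq> 0} \<le> P"
  proof -
    let ?S = "{(j, b). j < J \<and> b < nb \<and> A j b \<noteq> 0}"
    have eninj: "inj_on en {0..<nb}" using en by (simp add: bij_betw_def)
    have "card ?S \<le> card (SIGMA j:{..<J}. \<Lambda> j)"
    proof (rule card_inj_on_le[where f = "\<lambda>(j, b). (j, en b)"])
      show "inj_on (\<lambda>(j, b). (j, en b)) ?S" using eninj by (auto simp: inj_on_def)
      show "(\<lambda>(j, b). (j, en b)) ` ?S \<subseteq> (SIGMA j:{..<J}. \<Lambda> j)" by (auto simp: A_def split: if_splits)
      show "finite (SIGMA j:{..<J}. \<Lambda> j)" using fin by auto
    qed
    also have "\<dots> = P" unfolding P_def by (rule card_SigmaI) (use fin in auto)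
    finally show ?thesis .
  qed
  show ?thesis
  proof (rule exI[of _ net], intro conjI allI impI)
    show "is_network net" "input_dim net = d" "output_dim net = J" by (fact net)+
    have "network_size net \<le> 2 * (nb * (5 + K)) + K * (m + 2) * (6 * (nb * (5 + K))) + 2 * P"
      using size cardA by linarith
    also have "\<dots> \<le> 2 * ((P + 1) * (5 + K)) + K * (m + 2) * (6 * ((P + 1) * (5 + K))) + 2 * P"
      by (intro add_mono mult_le_mono nbP order_refl)
    finally show "network_size net \<le> 2 * ((P + 1) * (5 + K)) + K * (m + 2) * (6 * ((P + 1) * (5 + K))) + 2 * P" .
    show "(\<lambda>a. vec_index (realization net (Matrix.vec d (g a))) j) \<in> borel_measurable M"
      if "\<forall>i. (\<lambda>a. g a i) \<in> borel_measurable M" "j < J" for M :: "'a measure" and g j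
      using that by (intro meas) auto
    fix x y :: "nat \<Rightarrow> real" assume y': "\<forall>i. \<bar>y i\<bar> \<le> 1" and x': "\<forall>i<d. x i = u i * y i"
    note y = y'[rule_format] and x = x'[rule_format]
    have fac: "\<alpha> b k * x (iv b k) + \<beta> b k = a b k * y (iv b k) + \<beta> b k" if "b < nb" "k < K" for b k
      using x[OF iv[OF that]] u[of "iv b k"] by (simp add: \<alpha>_def)
    have le1: "\<bar>\<alpha> b k * x (iv b k) + \<beta> b k\<bar> \<le> 1" if "b < nb" "k < K" for b k
      unfolding fac[OF that] using F[OF that(1)] y by blast
    have sumA: "(\<Sum>b<nb. A j b * (\<Prod>k<K. \<alpha> b k * x (iv b k) + \<beta> b k)) = (\<Sum>\<kappa>\<in>\<Lambda> j. c j \<kappa> * (\<Prod>i<d. cheb (\<kappa> i) (y i)))"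
      if j: "j < J" for j
    proof -
      have "(\<Sum>b<nb. A j b * (\<Prod>k<K. \<alpha> b k * x (iv b k) + \<beta> b k))
        = (\<Sum>b<nb. if en b \<in> \<Lambda> j then c j (en b) * (\<Prod>i<d. cheb (en b i) (y i)) else 0)"
      proof (rule sum.cong[OF refl])
        fix b assume "b \<in> {..<nb}"
        then have b: "b < nb" by simp
        have "(\<Prod>k<K. \<alpha> b k * x (iv b k) + \<beta> b k) = (\<Prod>k<K. a b k * y (iv b k) + \<beta> b k)"
          using fac[OF b] by (intro prod.cong) auto
        moreover have "(\<Prod>i<d. cheb (en b i) (y i)) = T b * (\<Prod>k<K. a b k * y (iv b k) + \<beta> b k)" using F[OF b] by blast
        ultimately show "A j b * (\<Prod>k<K. \<alpha> b k * x (iv b k) + \<beta> b k) = (if en b \<in> \<Lambda> j then c j (en b) * (\<Prod>i<d. cheb (en b i) (y i)) else 0)"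
          by (simp add: A_def)
      qed
      also have "\<dots> = (\<Sum>\<kappa>\<in>\<Lambda> j. c j \<kappa> * (\<Prod>i<d. cheb (\<kappa> i) (y i)))" by (rule reindex[OF j])
      finally show ?thesis .
    qed
    have absA: "(\<Sum>b<nb. \<bar>A j b\<bar>) \<le> real (card (\<Lambda> j)) * (C * 4 ^ K)" if j: "j < J" for j
    proof -
      have "(\<Sum>b<nb. \<bar>A j b\<bar>) \<le> (\<Sum>b<nb. if en b \<in> \<Lambda> j then C * 4 ^ K else 0)"
      proof (rule sum_mono)
        fix b assume "b \<in> {..<nb}"
        then have b: "b < nb" by simp
        have "\<bar>c j (en b)\<bar> * T b \<le> C * 4 ^ K" if "en b \<in> \<Lambda> j"
          using F[OF b] C(2)[OF j that] C(1) by (intro mult_mono) auto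
        then show "\<bar>A j b\<bar> \<le> (if en b \<in> \<Lambda> j then C * 4 ^ K else 0)"
          using F[OF b] by (simp add: A_def abs_mult)
      qed
      also have "\<dots> = (\<Sum>\<kappa>\<in>\<Lambda> j. C * 4 ^ K)" by (rule reindex[OF j])
      finally show ?thesis by simp
    qed
    have "(\<Sum>j<J. \<bar>vec_index (realization net (Matrix.vec d x)) j - (\<Sum>\<kappa>\<in>\<Lambda> j. c j \<kappa> * (\<Prod>i<d. cheb (\<kappa> i) (y i)))\<bar>)
       \<le> (\<Sum>j<J. real (card (\<Lambda> j)) * (C * 4 ^ K) * (real K * (1/4) ^ m))"
    proof (rule sum_mono)
      fix j assume "j \<in> {..<J}"
      then have j: "j < J" by simp
      have "\<bar>vec_index (realization net (Matrix.vec d x)) j - (\<Sum>\<kappa>\<in>\<Lambda> j. c j \<kappa> * (\<Prod>i<d. cheb (\<kappa> i) (y i)))\<bar>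
         \<le> (\<Sum>b<nb. \<bar>A j b\<bar>) * (real K * (1/4) ^ m)"
        using err[OF le1 j] unfolding sumA[OF j] by blast
      also have "\<dots> \<le> real (card (\<Lambda> j)) * (C * 4 ^ K) * (real K * (1/4) ^ m)"
        by (intro mult_right_mono absA[OF j]) simp
      finally show "\<bar>vec_index (realization net (Matrix.vec d x)) j - (\<Sum>\<kappa>\<in>\<Lambda> j. c j \<kappa> * (\<Prod>i<d. cheb (\<kappa> i) (y i)))\<bar>
         \<le> real (card (\<Lambda> j)) * (C * 4 ^ K) * (real K * (1/4) ^ m)" .
    qed
    also have "\<dots> = real P * (C * 4 ^ K) * (real K * (1/4) ^ m)"
      by (simp add: P_def sum_distrib_right)
    finally show "(\<Sum>j<J. \<bar>vec_index (realization net (Matrix.vec d x)) j - (\<Sum>\<kappa>\<in>\<Lambda> j. c j \<kappa> * (\<Prod>i<d. cheb (\<kappa> i) (y i)))\<bar>)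
        \<le> real P * (C * 4 ^ K) * (real K * (1/4) ^ m)" .
  qed
qed

subsection \<open>Decoding\<close>

lemma decoder_network_map:
  "decoder \<eta> (network_map net z)
    = (\<Sum>j<output_dim net. vec_index (realization net (Matrix.vec (input_dim net) (ell2_nth z))) j *\<^sub>R \<eta> j)"
proof -
  let ?f = "\<lambda>j. if j < output_dim net then vec_index (realization net (Matrix.vec (input_dim net) (ell2_nth z))) j else 0"
  have "summable (\<lambda>j. (?f j)\<^sup>2)" by (rule summable_finite[of "{..<output_dim net}"]) auto
  then have "ell2_nth (network_map net z) = ?f" by (simp add: network_map_def Abs_ell2_inverse)
  then have "decoder \<eta> (network_map net z) = (\<Sum>j. ?f j *\<^sub>R \<eta> j)" by (simp add: decoder_def)
  also have "\<dots> = (\<Sum>j<output_dim net. ?f j *\<^sub>R \<eta> j)" by (rule suminf_finite) auto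
  finally show ?thesis by simp
qed

lemma frame_tail:
  fixes \<eta> :: "nat \<Rightarrow> 'a::{real_inner, complete_space}"
  assumes fr: "is_frame \<eta>" and B: "0 < B" "\<And>A c. finite A \<Longrightarrow> norm (\<Sum>j\<in>A. c j *\<^sub>R \<eta> j) \<le> B * sqrt (\<Sum>j\<in>A. (c j)\<^sup>2)"
    and w: "\<And>j. 0 < w j" "decseq w" and t: "0 < t"
    and v: "\<And>A. finite A \<Longrightarrow> (\<Sum>j\<in>A. (inner v (canonical_dual_frame \<eta> j))\<^sup>2 / (w j powr t)\<^sup>2) \<le> M\<^sup>2"
  shows "norm (v - (\<Sum>j<J. inner v (canonical_dual_frame \<eta> j) *\<^sub>R \<eta> j)) \<le> B * (w J powr t * \<bar>M\<bar>)"
proof -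
  let ?c = "\<lambda>j. inner v (canonical_dual_frame \<eta> j)"
  have lim: "(\<lambda>n. \<Sum>j<n. ?c j *\<^sub>R \<eta> j) \<longlonglongrightarrow> v" using frame_expansion[OF fr] by (simp add: sums_def)
  have bound: "norm ((\<Sum>j<n. ?c j *\<^sub>R \<eta> j) - (\<Sum>j<J. ?c j *\<^sub>R \<eta> j)) \<le> B * (w J powr t * \<bar>M\<bar>)" if "J \<le> n" for n
  proof -
    have "(\<Sum>j<n. ?c j *\<^sub>R \<eta> j) - (\<Sum>j<J. ?c j *\<^sub>R \<eta> j) = (\<Sum>j\<in>{J..<n}. ?c j *\<^sub>R \<eta> j)"
      using that sum_diff_nat_ivl[of 0 J n "\<lambda>j. ?c j *\<^sub>R \<eta> j"] by (simp add: atLeast0LessThan)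
    then have "norm ((\<Sum>j<n. ?c j *\<^sub>R \<eta> j) - (\<Sum>j<J. ?c j *\<^sub>R \<eta> j)) \<le> B * sqrt (\<Sum>j\<in>{J..<n}. (?c j)\<^sup>2)"
      using B(2)[of "{J..<n}" ?c] by simp
    also have "(\<Sum>j\<in>{J..<n}. (?c j)\<^sup>2) \<le> (\<Sum>j\<in>{J..<n}. (w J powr t)\<^sup>2 * ((?c j)\<^sup>2 / (w j powr t)\<^sup>2))"
    proof (rule sum_mono)
      fix j assume "j \<in> {J..<n}"
      then have "w j \<le> w J" using w(2) by (auto simp: decseq_def)
      then have "w j powr t \<le> w J powr t" using w(1)[of j] t by (intro powr_mono2) auto
      then have "(w j powr t)\<^sup>2 \<le> (w J powr t)\<^sup>2" by (intro power_mono) auto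
      then have "(w j powr t)\<^sup>2 * ((?c j)\<^sup>2 / (w j powr t)\<^sup>2) \<le> (w J powr t)\<^sup>2 * ((?c j)\<^sup>2 / (w j powr t)\<^sup>2)"
        by (intro mult_right_mono) auto
      then show "(?c j)\<^sup>2 \<le> (w J powr t)\<^sup>2 * ((?c j)\<^sup>2 / (w j powr t)\<^sup>2)" using w(1)[of j] by simp
    qed
    also have "\<dots> = (w J powr t)\<^sup>2 * (\<Sum>j\<in>{J..<n}. (?c j)\<^sup>2 / (w j powr t)\<^sup>2)" by (simp add: sum_distrib_left)
    also have "\<dots> \<le> (w J powr t)\<^sup>2 * M\<^sup>2" by (intro mult_left_mono v) auto
    also have "sqrt ((w J powr t)\<^sup>2 * M\<^sup>2) = w J powr t * \<bar>M\<bar>" by (simp add: real_sqrt_mult)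
    finally show ?thesis using B(1) by simp
  qed
  have "(\<lambda>n. norm ((\<Sum>j<n. ?c j *\<^sub>R \<eta> j) - (\<Sum>j<J. ?c j *\<^sub>R \<eta> j))) \<longlonglongrightarrow> norm (v - (\<Sum>j<J. ?c j *\<^sub>R \<eta> j))"
    by (intro tendsto_norm tendsto_diff lim tendsto_const)
  then show ?thesis by (rule Lim_bounded[of _ _ J]) (use bound in auto)
qed

subsection \<open>Numerical estimates\<close>

lemma real_nat_ceiling_le: "0 \<le> x \<Longrightarrow> real (nat \<lceil>x\<rceil>) \<le> x + 1"
  using ceiling_correct[of x] by (simp add: of_nat_nat)

lemma norm_sum_five:
  "norm (a + b + c + d + e) \<le> norm a + norm b + norm c + norm d + norm (e :: 'a::real_normed_vector)"
  using norm_triangle_ineq[of "a + b + c + d" e] norm_triangle_ineq[of "a + b + c" d]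
    norm_triangle_ineq[of "a + b" c] norm_triangle_ineq[of a b] by linarith

lemma size_estimate:
  fixes P K m X Q C k1 k2 :: real
  assumes "0 \<le> P" "0 \<le> K" "0 \<le> m" "1 \<le> X" "1 \<le> Q" "0 \<le> C" "P \<le> C * Q" "K \<le> k1 * X" "m + 2 \<le> k2 * X"
  shows "2 * ((P + 1) * (5 + K)) + K * (m + 2) * (6 * ((P + 1) * (5 + K))) + 2 * P
    \<le> (C + 1) * (2 * (5 + k1) + 6 * k1 * k2 * (5 + k1) + 2) * (Q * X ^ 3)"
proof -
  define Z where "Z = (C + 1) * Q"
  have Z: "P + 1 \<le> Z" "P \<le> Z" "0 \<le> Z" using assms by (auto simp: Z_def algebra_simps)
  have k: "0 \<le> k1" "0 \<le> k2"
    using order_trans[OF assms(2,8)] assms(3,4,9) by (auto simp: zero_le_mult_iff) (smt (verit) mult_neg_pos)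
  have X1: "X \<le> X ^ 3" "1 \<le> X ^ 3" using assms(4) power_increasing[of 1 3 X] one_le_power[of X 3] by auto
  have K5: "5 + K \<le> (5 + k1) * X" using assms by (simp add: algebra_simps)
  have PK: "(P + 1) * (5 + K) \<le> Z * ((5 + k1) * X)"
    using assms Z K5 by (intro mult_mono) auto
  have "2 * ((P + 1) * (5 + K)) \<le> 2 * (Z * ((5 + k1) * X))" using PK by simp
  also have "\<dots> = (Z * (2 * (5 + k1))) * X" by (simp only: mult_ac)
  also have "\<dots> \<le> (Z * (2 * (5 + k1))) * X ^ 3" using Z k X1 by (intro mult_left_mono) auto
  finally have 1: "2 * ((P + 1) * (5 + K)) \<le> (Z * (2 * (5 + k1))) * X ^ 3" .
  have KM: "K * (m + 2) \<le> (k1 * X) * (k2 * X)" using assms k by (intro mult_mono) auto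
  have "6 * ((P + 1) * (5 + K)) \<le> 6 * (Z * ((5 + k1) * X))" using PK by simp
  then have "K * (m + 2) * (6 * ((P + 1) * (5 + K))) \<le> (k1 * X) * (k2 * X) * (6 * (Z * ((5 + k1) * X)))"
    using assms k by (intro mult_mono[OF KM]) auto
  also have "\<dots> = (Z * (6 * k1 * k2 * (5 + k1))) * X ^ 3" by (simp add: power3_eq_cube mult_ac)
  finally have 2: "K * (m + 2) * (6 * ((P + 1) * (5 + K))) \<le> (Z * (6 * k1 * k2 * (5 + k1))) * X ^ 3" .
  have "2 * P \<le> 2 * Z" using Z by simp
  also have "2 * Z \<le> Z * 2 * X ^ 3" using mult_left_mono[OF X1(2), of "Z * 2"] Z by simp
  finally have 3: "2 * P \<le> Z * 2 * X ^ 3" .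
  have "2 * ((P + 1) * (5 + K)) + K * (m + 2) * (6 * ((P + 1) * (5 + K))) + 2 * P
     \<le> (Z * (2 * (5 + k1))) * X ^ 3 + (Z * (6 * k1 * k2 * (5 + k1))) * X ^ 3 + Z * 2 * X ^ 3"
    using 1 2 3 by linarith
  also have "\<dots> = (C + 1) * (2 * (5 + k1) + 6 * k1 * k2 * (5 + k1) + 2) * (Q * X ^ 3)"
    unfolding Z_def by (simp only: distrib_left distrib_right mult_ac)
  finally show ?thesis .
qed

lemma accuracy_estimate:
  fixes P C Q E :: real
  assumes "0 \<le> P" "0 \<le> C" "P \<le> C * Q" "0 \<le> Q" "(1/4) ^ n \<le> E" "0 \<le> E"
  shows "P * (C * 4 ^ K) * (real K * (1/4) ^ (2 * K + n)) \<le> C\<^sup>2 * (Q * E)"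
proof -
  have "real K \<le> 4 ^ K"
  proof -
    have "K < 2 ^ K" by simp
    then have "real K \<le> 2 ^ K" by (metis less_imp_le of_nat_le_iff of_nat_numeral of_nat_power)
    also have "\<dots> \<le> (4::real) ^ K" by (intro power_mono) auto
    finally show ?thesis .
  qed
  then have k: "real K * (1/4) ^ K \<le> 1" by (simp add: power_divide)
  have "P * (C * 4 ^ K) * (real K * (1/4) ^ (2 * K + n)) = P * C * (real K * (1/4) ^ K) * (1/4) ^ n"
    by (simp add: power_add mult_2 power_divide)
  also have "\<dots> \<le> (C * Q) * C * 1 * E"
    using assms k by (intro mult_mono) auto
  finally show ?thesis by (simp add: power2_eq_square mult_ac)
qed

theorem theorem3p10:
  fixes \<psi> \<psi>d :: "nat \<Rightarrow> 'x::{real_inner, complete_space, second_countable_topology}"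
    and \<eta> :: "nat \<Rightarrow> 'y::{real_inner, complete_space, second_countable_topology}"
    and w :: "nat \<Rightarrow> real"
    and r s t M \<delta> :: real
    and A :: "'x set" and G :: "'x \<Rightarrow> 'y"
    and O\<^sub>C :: "('x \<times> 'x) set" and H :: "'x \<times> 'x \<Rightarrow> 'y \<times> 'y"
  assumes "riesz_basis \<psi>" and "dual_basis \<psi> \<psi>d"
    and "is_frame \<eta>"
    and "\<forall>j. 0 < w j" and "decseq w" and "\<forall>\<epsilon>>0. summable (\<lambda>j. w j powr (1 + \<epsilon>))"
    and "0 < r" and "1 < s" and "0 < t"
    and "C_tilde w \<psi> r s \<subseteq> A"
    and "open O\<^sub>C" and "(\<lambda>a. (a, 0)) ` C_tilde w \<psi> r s \<subseteq> O\<^sub>C"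
    and "holomorphic_map_on H O\<^sub>C"
    and "\<forall>a\<in>A. (a, 0) \<in> O\<^sub>C \<longrightarrow> H (a, 0) = (G a, 0)"
    and "\<forall>a\<in>O\<^sub>C. H a \<in> Yt_space_C w \<eta> t \<and> Yt_norm_C w \<eta> t (H a) \<le> M"
    and "0 < \<delta>"
  shows "\<exists>C>0. \<exists>K>0. \<forall>N::nat. 1 \<le> N \<longrightarrow>
    (\<exists>net. is_network net \<and> real (network_size net) \<le> K * real N \<and>
       (\<lambda>a. G a - (decoder \<eta> \<circ> network_map net \<circ> encoder \<psi>d) a)
         \<in> L2_space (input_measure w \<psi> \<psi>d r s) \<and>
       L2_norm (input_measure w \<psi> \<psi>d r s)
         (\<lambda>a. G a - (decoder \<eta> \<circ> network_map net \<circ> encoder \<psi>d) a)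
         \<le> C * real N powr (- min (s - 1/2) t + \<delta>))"
proof -
  interpret riesz_weights w \<psi> \<psi>d r s
    using assms(1,2,4,6-8) by unfold_locales auto
  txt \<open>
    The exponents leave room for \<open>a p > 1\<close> and \<open>t p > 1\<close>, the summability of the weights, and for
    \<open>p \<tau> < 1\<close>, which absorbs the polylogarithmic size of the product networks.
  \<close>
  define m0 where "m0 = min (s - 1/2) t"
  define dl where "dl = min \<delta> (min (s - 1) (m0 / 2))"
  define a where "a = s - 1/2 - dl / 2"
  define tau where "tau = m0 - dl"
  define p where "p = 1 / (m0 - 3 * dl / 4)"
  have m0: "0 < m0" "m0 \<le> s - 1/2" "m0 \<le> t" using assms(8,9) by (auto simp: m0_def)
  have dl: "0 < dl" "dl \<le> \<delta>" "dl \<le> s - 1" "dl \<le> m0 / 2"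
    unfolding dl_def using assms(8,16) m0(1) by linarith+
  have tau: "0 < tau" using m0 dl by (simp add: tau_def)
  have den: "0 < m0 - 3 * dl / 4" using m0 dl by simp
  have p: "0 < p" using den by (simp add: p_def)
  have ap: "1 < a * p" using den m0 dl by (simp add: p_def a_def less_divide_eq)
  have tp: "1 < t * p" using den m0 dl by (simp add: p_def less_divide_eq)
  have ptau: "p * tau < 1" using den dl by (simp add: p_def tau_def divide_less_eq)
  have a0: "0 < a" using m0 dl by (simp add: a_def)
  have "2 * (s - a) > 1" using dl by (simp add: a_def)
  from param_map_C_in_open[OF assms(11,12) this]
  obtain c0 where c0: "0 < c0"
    "\<And>d z. z \<in> polyell (\<lambda>i. 1 + c0 * w i powr (- a)) d \<Longrightarrow> param_map_C d z \<in> O\<^sub>C" by blast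
  define rho where "rho = (\<lambda>i. 1 + c0 / 2 * w i powr (- a))"
  define sig where "sig = (\<lambda>i. 1 + c0 * w i powr (- a))"
  define wt where "wt = (\<lambda>j. w j powr t)"
  define q where "q = sqrt (1 + c0 / 2 * w 0 powr (- a))"
  have wpa: "0 < w i powr (- a)" for i using w_pos[of i] by simp
  have q: "1 < q" using c0 wpa[of 0] by (simp add: q_def)
  have q_le: "q\<^sup>2 \<le> rho i" for i
  proof -
    have "w i \<le> w 0" using assms(5) by (auto simp: decseq_def)
    then have "w 0 powr (- a) \<le> w i powr (- a)" using w_pos[of i] a0 by (intro powr_mono2') auto
    then have "c0 / 2 * w 0 powr (- a) \<le> c0 / 2 * w i powr (- a)" using c0 by (intro mult_left_mono) auto
    then show ?thesis using c0 wpa[of 0] by (simp add: q_def rho_def add_nonneg_nonneg)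
  qed
  have rs: "rho i < sig i" for i using c0 wpa[of i] by (simp add: rho_def sig_def)
  have rho_ge: "c0 / 2 * w i powr (- a) \<le> rho i" for i by (simp add: rho_def)
  have rho_pos: "0 < c0 / 2 * w i powr (- a)" for i using c0 wpa[of i] by simp
  have s2: "summable (\<lambda>i. inverse ((rho i)\<^sup>2))"
  proof (rule summable_comparison_test'[of "\<lambda>i. (2 / c0)\<^sup>2 * w i powr (2 * a)" 0])
    show "summable (\<lambda>i. (2 / c0)\<^sup>2 * w i powr (2 * a))"
      using dl assms(8) by (intro summable_mult w_powr_summable) (simp add: a_def)
    fix i
    have "(c0 / 2 * w i powr (- a))\<^sup>2 \<le> (rho i)\<^sup>2" using rho_ge rho_pos[of i] by (intro power_mono) auto
    then have "inverse ((rho i)\<^sup>2) \<le> inverse ((c0 / 2 * w i powr (- a))\<^sup>2)"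
      using rho_pos[of i] by (intro le_imp_inverse_le) auto
    also have "\<dots> = (2 / c0)\<^sup>2 * (inverse (w i powr (- a)))\<^sup>2"
      by (simp only: power_mult_distrib inverse_mult_distrib power_inverse[symmetric] inverse_divide)
    also have "(inverse (w i powr (- a)))\<^sup>2 = w i powr (2 * a)"
      using w_pos[of i] by (simp add: powr_minus power2_eq_square powr_add[symmetric])
    finally show "norm (inverse ((rho i)\<^sup>2)) \<le> (2 / c0)\<^sup>2 * w i powr (2 * a)" by simp
  qed
  have sp: "summable (\<lambda>i. rho i powr (- p))"
  proof (rule summable_comparison_test'[of "\<lambda>i. (c0 / 2) powr (- p) * w i powr (a * p)" 0])
    show "summable (\<lambda>i. (c0 / 2) powr (- p) * w i powr (a * p))"
      using ap by (intro summable_mult w_powr_summable)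
    fix i
    have "rho i powr (- p) \<le> (c0 / 2 * w i powr (- a)) powr (- p)"
      using rho_ge rho_pos[of i] p by (intro powr_mono2') auto
    also have "\<dots> = (c0 / 2) powr (- p) * w i powr (a * p)" unfolding powr_mult powr_powr by simp
    finally show "norm (rho i powr (- p)) \<le> (c0 / 2) powr (- p) * w i powr (a * p)" by simp
  qed
  have wt: "0 < wt j" for j using w_pos[of j] by (simp add: wt_def)
  have wts: "summable (\<lambda>j. wt j powr p)" unfolding wt_def powr_powr using tp by (rule w_powr_summable)
  obtain C where C: "0 < C" and approx: "\<forall>d J R \<epsilon>. \<forall>f :: nat \<Rightarrow> (nat \<Rightarrow> complex) \<Rightarrow> complex. 1 \<le> R \<longrightarrow> 0 < \<epsilon> \<longrightarrow>
      (\<forall>j<J. \<forall>z\<in>polyell sig d. \<forall>i<d. (\<lambda>x. f j (z(i := x))) holomorphic_on ell (sig i)) \<longrightarrow>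
      (\<forall>z\<in>polyell sig d. (\<Sum>j<J. (cmod (f j z))\<^sup>2 / (wt j)\<^sup>2) \<le> M\<^sup>2) \<longrightarrow>
      (\<exists>n c \<Lambda>. (\<forall>j<J. \<Lambda> j \<subseteq> PiE {..<d} (\<lambda>_. {..n}) \<and>
          (\<forall>\<kappa>\<in>\<Lambda> j. real (\<Sum>i<d. \<kappa> i) \<le> C * (1 + ln R) \<and> \<bar>c j \<kappa>\<bar> \<le> C)) \<and>
        real (\<Sum>j<J. card (\<Lambda> j)) \<le> C * R powr p \<and>
        (\<forall>j<J. \<forall>y\<in>param_cube. \<bar>Re (f j (\<lambda>i. if i < d then of_real (y i) else 0))
            - (\<Sum>\<kappa>\<in>PiE {..<d} (\<lambda>_. {..n}). c j \<kappa> * (\<Prod>i<d. cheb (\<kappa> i) (y i)))\<bar> \<le> \<epsilon>) \<and>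
        (\<forall>j<J. integrable uniform_cube (\<lambda>y. (\<Sum>\<kappa>\<in>PiE {..<d} (\<lambda>_. {..n}) - \<Lambda> j. c j \<kappa> * (\<Prod>i<d. cheb (\<kappa> i) (y i)))\<^sup>2)) \<and>
        (\<Sum>j<J. \<integral>y. (\<Sum>\<kappa>\<in>PiE {..<d} (\<lambda>_. {..n}) - \<Lambda> j. c j \<kappa> * (\<Prod>i<d. cheb (\<kappa> i) (y i)))\<^sup>2 \<partial>uniform_cube) \<le> C / R\<^sup>2)"
    using sparse_cheb_approx[where \<rho> = rho and \<sigma> = sig and wt = wt and M = M and p = p and q = q, OF q q_le rs s2 p sp wt wts]
    by (elim exE conjE) (rule that)
  obtain B where B: "0 < B" "\<And>A c. finite A \<Longrightarrow> norm (\<Sum>j\<in>A. c j *\<^sub>R \<eta> j) \<le> B * sqrt (\<Sum>j\<in>A. (c j)\<^sup>2)"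
    using frame_sum_bound[OF assms(3)] by blast
  let ?ed = "canonical_dual_frame \<eta>"
  let ?Ct = "C_tilde w \<psi> r s"
  have aO: "(x, 0) \<in> O\<^sub>C" if "x \<in> ?Ct" for x using assms(12) that by auto
  have HG: "H (x, 0) = (G x, 0)" if "x \<in> ?Ct" for x using assms(10,14) aO[OF that] that by auto
  have Gv: "(\<Sum>j\<in>A. (inner (G x) (?ed j))\<^sup>2 / (w j powr t)\<^sup>2) \<le> M\<^sup>2" if "x \<in> ?Ct" "finite A" for x A
  proof -
    have "(cmod (complex_coeff (H (x, 0)) (?ed j)))\<^sup>2 = (inner (G x) (?ed j))\<^sup>2" for j
      unfolding HG[OF that(1)] complex_coeff_def by (simp add: cmod_def)
    then show ?thesis
      using Yt_partial_bound[of "H (x, 0)" w \<eta> t M A] assms(15) aO[OF that(1)] w_pos that(2) by simp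
  qed
  have Gc: "continuous_on ?Ct G"
  proof -
    have "continuous_on O\<^sub>C H"
    proof (rule continuous_at_imp_continuous_on, rule ballI)
      fix x assume "x \<in> O\<^sub>C"
      then obtain D where "(H has_derivative D) (at x)" using assms(13) unfolding holomorphic_map_on_def by blast
      then show "isCont H x" by (rule has_derivative_continuous)
    qed
    moreover have "continuous_on ?Ct (\<lambda>x. (x, 0::'x))" by (intro continuous_on_Pair continuous_on_id continuous_on_const)
    ultimately have "continuous_on ?Ct (\<lambda>x. H (x, 0))"
      by (rule continuous_on_compose2) (use aO in auto)
    then have "continuous_on ?Ct (\<lambda>x. fst (H (x, 0)))" by (rule continuous_on_fst)
    then show ?thesis by (rule continuous_on_eq) (simp add: HG)
  qed
  define \<theta> where "\<theta> = (1 - p * tau) / 3"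
  have \<theta>: "0 < \<theta>" using ptau by (simp add: \<theta>_def)
  define k1 where "k1 = C * (1 + tau) + 1"
  define k2 where "k2 = 2 * k1 + (1 + tau) + 3"
  define KK where "KK = (C + 1) * (2 * (5 + k1) + 6 * k1 * k2 * (5 + k1) + 2) * (1 + 1 / \<theta>) ^ 3"
  define A1 where "A1 = 3 + B * C\<^sup>2"
  define CC where "CC = sqrt (2 * A1\<^sup>2 + 2 * B\<^sup>2 * C)"
  have k1: "1 \<le> k1" using C tau by (simp add: k1_def)
  have k2: "3 \<le> k2" using k1 tau by (simp add: k2_def)
  have KK: "0 < KK" unfolding KK_def using C k1 k2 \<theta> by (intro mult_pos_pos add_pos_pos zero_less_power) auto
  have A1: "0 < A1" using B(1) C by (simp add: A1_def add_pos_nonneg)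
  have CC: "0 < CC" unfolding CC_def using A1 C by (auto intro!: add_pos_nonneg)
  show ?thesis
  proof (rule exI[of _ CC], rule conjI[OF CC], rule exI[of _ KK], rule conjI[OF KK], intro allI impI)
    fix N :: nat assume N: "1 \<le> N"
    define R where "R = real N powr tau"
    define e where "e = real N powr (- tau)"
    have R: "1 \<le> R" using N tau by (simp add: R_def ge_one_powr_ge_zero)
    have e: "0 < e" using N by (simp add: e_def)
    have eR: "e = 1 / R" by (simp add: e_def R_def powr_minus_divide)
    have lnR: "ln R = tau * ln (real N)" using N by (simp add: R_def ln_powr)
    have L0: "0 \<le> ln (real N)" using N by simp
    have "uniformly_continuous_on ?Ct G" by (rule compact_uniformly_continuous[OF Gc compact_C_tilde])
    then obtain h where h: "0 < h" "\<And>x x'. x \<in> ?Ct \<Longrightarrow> x' \<in> ?Ct \<Longrightarrow> dist x' x < h \<Longrightarrow> dist (G x') (G x) < e"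
      using e unfolding uniformly_continuous_on_def by metis
    obtain d0 where d0: "\<And>d y. d0 \<le> d \<Longrightarrow> y \<in> param_cube \<Longrightarrow>
        norm (param_map w \<psi> r s y - param_map w \<psi> r s (truncate_seq d y)) < h"
      using param_map_truncate_uniform[OF h(1)] by blast
    define d where "d = Suc d0"
    have d: "0 < d" by (simp add: d_def)
    let ?y = "truncate_seq d"
    let ?\<sigma> = "param_map w \<psi> r s"
    have Ct: "?\<sigma> y \<in> ?Ct" if "y \<in> param_cube" for y using that by (auto simp: C_tilde_def)
    have trunc_err: "norm (G (?\<sigma> y) - G (?\<sigma> (?y y))) \<le> e" if y: "y \<in> param_cube" for y
    proof -
      have "norm (?\<sigma> y - ?\<sigma> (?y y)) < h" by (rule d0[OF _ y]) (simp add: d_def)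
      then have "dist (G (?\<sigma> y)) (G (?\<sigma> (?y y))) < e"
        by (intro h(2)[OF Ct[OF truncate_seq_cube[OF y]] Ct[OF y]]) (simp add: dist_norm)
      then show ?thesis by (simp add: dist_norm)
    qed
    define e' where "e' = e / (B * (\<bar>M\<bar> + 1))"
    have e': "0 < e'" using e B(1) by (simp add: e'_def)
    have "(\<lambda>j. wt j powr p) \<longlonglongrightarrow> 0" by (rule summable_LIMSEQ_zero[OF wts])
    then have "eventually (\<lambda>j. wt j powr p < e' powr p) sequentially"
      by (rule order_tendstoD) (use e' in simp)
    then obtain J0 where J0: "\<And>j. J0 \<le> j \<Longrightarrow> wt j powr p < e' powr p" by (auto simp: eventually_sequentially)
    define J where "J = Suc J0"
    have J: "0 < J" by (simp add: J_def)
    have wtJ: "wt J < e'"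
    proof (rule ccontr)
      assume "\<not> wt J < e'"
      then have "e' powr p \<le> wt J powr p" using e' p by (intro powr_mono2) auto
      with J0[of J] show False by (simp add: J_def)
    qed
    have tail_err: "norm (G x - (\<Sum>j<J. inner (G x) (?ed j) *\<^sub>R \<eta> j)) \<le> e" if x: "x \<in> ?Ct" for x
    proof -
      have "norm (G x - (\<Sum>j<J. inner (G x) (?ed j) *\<^sub>R \<eta> j)) \<le> B * (w J powr t * \<bar>M\<bar>)"
        by (rule frame_tail[OF assms(3) B w_pos assms(5,9) Gv[OF x]])
      also have "\<dots> \<le> B * (e' * (\<bar>M\<bar> + 1))"
        using wtJ wt[of J] B(1) e' by (intro mult_left_mono mult_mono) (auto simp: wt_def)
      also have "\<dots> = e"
      proof -
        have "B * (\<bar>M\<bar> + 1) \<noteq> 0" using B(1) by simp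
        then show ?thesis by (simp add: e'_def)
      qed
      finally show ?thesis .
    qed
    define f where "f = (\<lambda>j z. complex_coeff (H (param_map_C d z)) (?ed j))"
    define ep where "ep = e / (B * sqrt (real J))"
    have ep: "0 < ep" using e B(1) J by (simp add: ep_def)
    have inO: "param_map_C d z \<in> O\<^sub>C" if "z \<in> polyell sig d" for z
      using that unfolding sig_def by (rule c0(2))
    have hol: "(\<lambda>x. f j (z(i := x))) holomorphic_on ell (sig i)" if "z \<in> polyell sig d" "i < d" for j z i
      unfolding f_def
    proof (rule holomorphic_coeff[OF assms(13) open_ell that(2)])
      fix x assume "x \<in> ell (sig i)"
      then have "z(i := x) \<in> polyell sig d" using that by (auto simp: polyell_def)
      then show "param_map_C d (z(i := x)) \<in> O\<^sub>C" by (rule inO)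
    qed
    have fbd: "(\<Sum>j<J. (cmod (f j z))\<^sup>2 / (wt j)\<^sup>2) \<le> M\<^sup>2" if "z \<in> polyell sig d" for z
      unfolding f_def wt_def using assms(15) inO[OF that] w_pos by (intro Yt_partial_bound) auto
    obtain n c \<Lambda> where
      L1: "\<forall>j<J. \<Lambda> j \<subseteq> PiE {..<d} (\<lambda>_. {..n}) \<and> (\<forall>\<kappa>\<in>\<Lambda> j. real (\<Sum>i<d. \<kappa> i) \<le> C * (1 + ln R) \<and> \<bar>c j \<kappa>\<bar> \<le> C)"
      and L2: "real (\<Sum>j<J. card (\<Lambda> j)) \<le> C * R powr p"
      and L3: "\<forall>j<J. \<forall>y\<in>param_cube. \<bar>Re (f j (\<lambda>i. if i < d then of_real (y i) else 0))
            - (\<Sum>\<kappa>\<in>PiE {..<d} (\<lambda>_. {..n}). c j \<kappa> * (\<Prod>i<d. cheb (\<kappa> i) (y i)))\<bar> \<le> ep"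
      and L4: "\<forall>j<J. integrable uniform_cube (\<lambda>y. (\<Sum>\<kappa>\<in>PiE {..<d} (\<lambda>_. {..n}) - \<Lambda> j. c j \<kappa> * (\<Prod>i<d. cheb (\<kappa> i) (y i)))\<^sup>2)"
      and L5: "(\<Sum>j<J. \<integral>y. (\<Sum>\<kappa>\<in>PiE {..<d} (\<lambda>_. {..n}) - \<Lambda> j. c j \<kappa> * (\<Prod>i<d. cheb (\<kappa> i) (y i)))\<^sup>2 \<partial>uniform_cube) \<le> C / R\<^sup>2"
    proof -
      have "\<forall>j<J. \<forall>z\<in>polyell sig d. \<forall>i<d. (\<lambda>x. f j (z(i := x))) holomorphic_on ell (sig i)"
        "\<forall>z\<in>polyell sig d. (\<Sum>j<J. (cmod (f j z))\<^sup>2 / (wt j)\<^sup>2) \<le> M\<^sup>2"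
        by (intro allI impI ballI hol, assumption+) (intro ballI fbd)
      from approx[THEN spec, THEN spec, THEN spec, THEN spec, THEN spec, THEN mp, OF R, THEN mp, OF ep, THEN mp, OF this(1), THEN mp, OF this(2)]
      show ?thesis by (elim exE conjE) (rule that, assumption+)
    qed
    let ?K = "PiE {..<d} (\<lambda>_. {..n})"
    have finK: "finite ?K" by (intro finite_PiE) auto
    define K where "K = nat \<lceil>C * (1 + ln R)\<rceil>"
    define n1 where "n1 = nat \<lceil>(1 + tau) * ln (real N)\<rceil>"
    define m where "m = 2 * K + n1"
    define P where "P = (\<Sum>j<J. card (\<Lambda> j))"
    define u where "u = (\<lambda>i. r * w i powr s)"
    have u0: "0 < u i" for i using r_pos w_pos[of i] by (simp add: u_def)
    have fin: "finite (\<Lambda> j)" if "j < J" for j by (rule finite_subset[OF conjunct1[OF mp[OF spec[OF L1] that]] finK])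
    have deg: "(\<Sum>i<d. \<kappa> i) \<le> K" if "j < J" "\<kappa> \<in> \<Lambda> j" for j \<kappa>
    proof -
      have "real (\<Sum>i<d. \<kappa> i) \<le> C * (1 + ln R)" using L1 that by blast
      also have "\<dots> \<le> real K" unfolding K_def by (rule real_nat_ceiling_ge)
      finally show ?thesis by (simp only: of_nat_le_iff)
    qed
    have cb: "\<bar>c j \<kappa>\<bar> \<le> C" if "j < J" "\<kappa> \<in> \<Lambda> j" for j \<kappa> using L1 that by blast
    have "\<exists>net. is_network net \<and> input_dim net = d \<and> output_dim net = J \<and>
      network_size net \<le> 2 * ((P + 1) * (5 + K)) + K * (m + 2) * (6 * ((P + 1) * (5 + K))) + 2 * P \<and>
      (\<forall>x y. (\<forall>i. \<bar>y i\<bar> \<le> 1) \<longrightarrow> (\<forall>i<d. x i = u i * y i) \<longrightarrow>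
        (\<Sum>j<J. \<bar>vec_index (realization net (Matrix.vec d x)) j - (\<Sum>\<kappa>\<in>\<Lambda> j. c j \<kappa> * (\<Prod>i<d. cheb (\<kappa> i) (y i)))\<bar>)
          \<le> real P * (C * 4 ^ K) * (real K * (1/4) ^ m)) \<and>
      (\<forall>(M :: 'x measure) g j. (\<forall>i. (\<lambda>a. g a i) \<in> borel_measurable M) \<longrightarrow> j < J \<longrightarrow>
        (\<lambda>a. vec_index (realization net (Matrix.vec d (g a))) j) \<in> borel_measurable M)"
      unfolding P_def
    proof (rule sparse_cheb_network)
      show "0 \<le> C" using C by simp
    qed (fact d J fin deg cb u0)+
    then obtain net where net: "is_network net" "input_dim net = d" "output_dim net = J"
      and size: "network_size net \<le> 2 * ((P + 1) * (5 + K)) + K * (m + 2) * (6 * ((P + 1) * (5 + K))) + 2 * P"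
      and acc: "\<forall>x y. (\<forall>i. \<bar>y i\<bar> \<le> 1) \<longrightarrow> (\<forall>i<d. x i = u i * y i) \<longrightarrow>
        (\<Sum>j<J. \<bar>vec_index (realization net (Matrix.vec d x)) j - (\<Sum>\<kappa>\<in>\<Lambda> j. c j \<kappa> * (\<Prod>i<d. cheb (\<kappa> i) (y i)))\<bar>)
          \<le> real P * (C * 4 ^ K) * (real K * (1/4) ^ m)"
      and meas: "\<forall>(M :: 'x measure) g j. (\<forall>i. (\<lambda>a. g a i) \<in> borel_measurable M) \<longrightarrow> j < J \<longrightarrow>
        (\<lambda>a. vec_index (realization net (Matrix.vec d (g a))) j) \<in> borel_measurable M"
      by (elim exE conjE) (rule that, assumption+)
    define Q where "Q = real N powr (p * tau)"
    have Q: "1 \<le> Q" using N p tau by (simp add: Q_def ge_one_powr_ge_zero)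
    have PQ: "real P \<le> C * Q"
      using L2 by (simp add: P_def Q_def R_def powr_powr mult.commute)
    define X where "X = 1 + ln (real N)"
    have X: "1 \<le> X" using L0 by (simp add: X_def)
    have KX: "real K \<le> k1 * X"
    proof -
      have "real K \<le> C * (1 + ln R) + 1" unfolding K_def
        using C L0 tau by (intro real_nat_ceiling_le) (simp add: lnR)
      also have "\<dots> \<le> k1 * X"
        using C L0 tau by (simp add: lnR k1_def X_def algebra_simps)
      finally show ?thesis .
    qed
    have mX: "real m + 2 \<le> k2 * X"
    proof -
      have "real n1 \<le> (1 + tau) * ln (real N) + 1" unfolding n1_def
        using L0 tau by (intro real_nat_ceiling_le) simp
      also have "\<dots> \<le> (1 + tau) * X + X" using tau X L0 by (simp add: X_def algebra_simps)
      finally have "real m + 2 \<le> 2 * (k1 * X) + ((1 + tau) * X + X) + 2 * X"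
        using KX X by (simp add: m_def)
      also have "\<dots> = k2 * X" by (simp add: k2_def algebra_simps)
      finally show ?thesis .
    qed
    have size_fin: "real (network_size net) \<le> KK * real N"
    proof -
      have "real (network_size net) \<le> real (2 * ((P + 1) * (5 + K)) + K * (m + 2) * (6 * ((P + 1) * (5 + K))) + 2 * P)"
        using size by (simp only: of_nat_le_iff)
      also have "\<dots> = 2 * ((real P + 1) * (5 + real K)) + real K * (real m + 2) * (6 * ((real P + 1) * (5 + real K))) + 2 * real P"
        by (simp only: of_nat_add of_nat_mult of_nat_numeral of_nat_1)
      also have "\<dots> \<le> (C + 1) * (2 * (5 + k1) + 6 * k1 * k2 * (5 + k1) + 2) * (Q * X ^ 3)"
        using C by (intro size_estimate X Q PQ KX mX) auto
      also have "\<dots> \<le> (C + 1) * (2 * (5 + k1) + 6 * k1 * k2 * (5 + k1) + 2) * ((1 + 1 / \<theta>) ^ 3 * real N)"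
      proof (rule mult_left_mono)
        have NN: "1 \<le> real N" using N by simp
        have "1 \<le> real N powr \<theta>" using NN \<theta> by (simp add: ge_one_powr_ge_zero)
        moreover have "ln (real N) \<le> real N powr \<theta> / \<theta>" by (rule ln_powr_bound[OF NN \<theta>])
        ultimately have "X \<le> (1 + 1 / \<theta>) * real N powr \<theta>" by (simp add: X_def distrib_right)
        then have "X ^ 3 \<le> ((1 + 1 / \<theta>) * real N powr \<theta>) ^ 3" using X by (intro power_mono) auto
        also have "\<dots> = (1 + 1 / \<theta>) ^ 3 * real N powr (3 * \<theta>)"
          using NN by (simp add: power_mult_distrib powr_power mult.commute)
        finally have "Q * X ^ 3 \<le> Q * ((1 + 1 / \<theta>) ^ 3 * real N powr (3 * \<theta>))" using Q by (intro mult_left_mono) auto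
        also have "\<dots> = (1 + 1 / \<theta>) ^ 3 * (real N powr (p * tau) * real N powr (3 * \<theta>))" by (simp add: Q_def)
        also have "real N powr (p * tau) * real N powr (3 * \<theta>) = real N"
        proof -
          have "3 * (x / 3) = x" for x :: real by simp
          from this[of "1 - p * tau"] have "p * tau + 3 * \<theta> = 1" unfolding \<theta>_def by linarith
          then show ?thesis unfolding powr_add[symmetric] using NN by simp
        qed
        finally show "Q * X ^ 3 \<le> (1 + 1 / \<theta>) ^ 3 * real N" .
        show "0 \<le> (C + 1) * (2 * (5 + k1) + 6 * k1 * k2 * (5 + k1) + 2)"
          using C k1 k2 by (intro mult_nonneg_nonneg add_nonneg_nonneg) auto
      qed
      also have "\<dots> = KK * real N" by (simp only: KK_def mult.assoc)
      finally show ?thesis .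
    qed
    have acc_e: "real P * (C * 4 ^ K) * (real K * (1/4) ^ m) \<le> C\<^sup>2 * e"
    proof -
      have NN: "1 \<le> real N" using N by simp
      have q4: "(1/4) ^ n1 \<le> real N powr (- (1 + tau))"
      proof -
        have "(1 + tau) * ln (real N) \<le> real n1" unfolding n1_def by (rule real_nat_ceiling_ge)
        then have "exp ((1 + tau) * ln (real N)) \<le> exp (real n1)" by simp
        also have "exp (real n1) = exp 1 ^ n1" by (simp add: exp_of_nat_mult[symmetric])
        also have "\<dots> \<le> 4 ^ n1" using exp_le by (intro power_mono) auto
        finally have "real N powr (1 + tau) \<le> 4 ^ n1" using NN by (simp add: powr_def)
        then have "inverse (4 ^ n1) \<le> inverse (real N powr (1 + tau))" using NN by (intro le_imp_inverse_le) auto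
        then show ?thesis unfolding powr_minus[of "real N" "1 + tau"] by (simp add: power_divide inverse_eq_divide)
      qed
      have "real P * (C * 4 ^ K) * (real K * (1/4) ^ m) \<le> C\<^sup>2 * (Q * real N powr (- (1 + tau)))"
        unfolding m_def using C PQ Q q4 by (intro accuracy_estimate) auto
      also have "\<dots> \<le> C\<^sup>2 * (real N powr 1 * real N powr (- (1 + tau)))"
        unfolding Q_def using NN ptau by (intro mult_left_mono mult_right_mono powr_mono) auto
      also have "real N powr 1 * real N powr (- (1 + tau)) = e" unfolding powr_add[symmetric] e_def by simp
      finally show ?thesis .
    qed
    define outp where "outp = (\<lambda>j x. vec_index (realization net (Matrix.vec d (ell2_nth (encoder \<psi>d x)))) j)"
    define err where "err = (\<lambda>x. G x - (decoder \<eta> \<circ> network_map net \<circ> encoder \<psi>d) x)"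
    have err: "err x = G x - (\<Sum>j<J. outp j x *\<^sub>R \<eta> j)" for x
      by (simp add: err_def decoder_network_map net outp_def)
    define S where "S = (\<lambda>j y. \<Sum>\<kappa>\<in>\<Lambda> j. c j \<kappa> * (\<Prod>i<d. cheb (\<kappa> i) (y i)))"
    define E where "E = (\<lambda>j y. \<Sum>\<kappa>\<in>?K - \<Lambda> j. c j \<kappa> * (\<Prod>i<d. cheb (\<kappa> i) (y i)))"
    have SE: "(\<Sum>\<kappa>\<in>?K. c j \<kappa> * (\<Prod>i<d. cheb (\<kappa> i) (y i))) = S j y + E j y" if "j < J" for j and y :: "nat \<Rightarrow> real"
    proof -
      have sub: "\<Lambda> j \<subseteq> ?K" by (rule conjunct1[OF mp[OF spec[OF L1] that]])
      show ?thesis unfolding S_def E_def sum.subset_diff[OF sub finK] by (rule add.commute)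
    qed
    have err_bound: "norm (err (?\<sigma> y)) \<le> A1 * e + B * sqrt (\<Sum>j<J. (E j y)\<^sup>2)" if y: "y \<in> param_cube" for y
    proof -
      define v where "v = G (?\<sigma> (?y y))"
      define g where "g = (\<lambda>j. inner v (?ed j))"
      have yc: "?\<sigma> (?y y) \<in> ?Ct" using Ct[OF truncate_seq_cube[OF y]] .
      have fg: "Re (f j (\<lambda>i. if i < d then of_real (y i) else 0)) = g j" for j
        unfolding f_def param_map_C_real HG[OF yc] g_def v_def by (simp add: complex_coeff_def)
      have g3: "\<bar>g j - (S j y + E j y)\<bar> \<le> ep" if "j < J" for j
        using bspec[OF mp[OF spec[OF L3] that] y] unfolding fg SE[OF that] .
      have n3: "norm (\<Sum>j<J. (g j - (S j y + E j y)) *\<^sub>R \<eta> j) \<le> e"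
      proof -
        have "norm (\<Sum>j<J. (g j - (S j y + E j y)) *\<^sub>R \<eta> j) \<le> B * sqrt (\<Sum>j<J. (g j - (S j y + E j y))\<^sup>2)"
          by (rule B(2)) simp
        also have "(\<Sum>j<J. (g j - (S j y + E j y))\<^sup>2) \<le> (\<Sum>j<J. ep\<^sup>2)"
          using g3 ep by (intro sum_mono abs_le_square_iff[THEN iffD1]) auto
        also have "sqrt (\<Sum>j<J. ep\<^sup>2) = sqrt (real J) * ep" using ep by (simp add: real_sqrt_mult)
        also have "B * (sqrt (real J) * ep) = e"
        proof -
          have "B * sqrt (real J) \<noteq> 0" using B(1) J by simp
          then show ?thesis by (simp add: ep_def)
        qed
        finally show ?thesis using B(1) by simp
      qed
      have n4: "norm (\<Sum>j<J. E j y *\<^sub>R \<eta> j) \<le> B * sqrt (\<Sum>j<J. (E j y)\<^sup>2)" by (rule B(2)) simp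
      have n5: "norm (\<Sum>j<J. (S j y - outp j (?\<sigma> y)) *\<^sub>R \<eta> j) \<le> B * C\<^sup>2 * e"
      proof -
        have "norm (\<Sum>j<J. (S j y - outp j (?\<sigma> y)) *\<^sub>R \<eta> j) \<le> B * sqrt (\<Sum>j<J. (S j y - outp j (?\<sigma> y))\<^sup>2)"
          by (rule B(2)) simp
        also have "sqrt (\<Sum>j<J. (S j y - outp j (?\<sigma> y))\<^sup>2) \<le> (\<Sum>j<J. \<bar>S j y - outp j (?\<sigma> y)\<bar>)"
          using L2_set_le_sum_abs[of "\<lambda>j. S j y - outp j (?\<sigma> y)" "{..<J}"] by (simp add: L2_set_def)
        also have "(\<Sum>j<J. \<bar>S j y - outp j (?\<sigma> y)\<bar>) = (\<Sum>j<J. \<bar>outp j (?\<sigma> y) - S j y\<bar>)"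
          by (simp only: abs_minus_commute)
        also have "\<dots> \<le> real P * (C * 4 ^ K) * (real K * (1/4) ^ m)"
          unfolding outp_def S_def
        proof (rule acc[rule_format])
          show "\<bar>y i\<bar> \<le> 1" for i by (rule param_cube_abs[OF y])
          show "ell2_nth (encoder \<psi>d (?\<sigma> y)) i = u i * y i" for i
            by (simp add: encoder_nth[OF assms(1,2)] param_map_coeff[OF y] u_def)
        qed
        also have "\<dots> \<le> C\<^sup>2 * e" by (rule acc_e)
        finally show ?thesis using B(1) by (simp add: mult.assoc)
      qed
      define Sg where "Sg = (\<Sum>j<J. g j *\<^sub>R \<eta> j)"
      define D3 where "D3 = (\<Sum>j<J. (g j - (S j y + E j y)) *\<^sub>R \<eta> j)"
      define D4 where "D4 = (\<Sum>j<J. E j y *\<^sub>R \<eta> j)"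
      define D5 where "D5 = (\<Sum>j<J. (S j y - outp j (?\<sigma> y)) *\<^sub>R \<eta> j)"
      have n2: "norm (v - Sg) \<le> e" using tail_err[OF yc] unfolding Sg_def g_def v_def .
      have "D3 + D4 + D5 = Sg - (\<Sum>j<J. outp j (?\<sigma> y) *\<^sub>R \<eta> j)"
        unfolding D3_def D4_def D5_def Sg_def sum.distrib[symmetric] sum_subtractf[symmetric]
        by (intro sum.cong refl) (simp add: scaleR_diff_left scaleR_add_left)
      then have "err (?\<sigma> y) = (G (?\<sigma> y) - v) + (v - Sg) + D3 + D4 + D5"
        unfolding err by (simp add: algebra_simps)
      then have "norm (err (?\<sigma> y)) \<le> norm (G (?\<sigma> y) - v) + norm (v - Sg) + norm D3 + norm D4 + norm D5"
        by (simp only: norm_sum_five)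
      also have "\<dots> \<le> e + e + e + B * sqrt (\<Sum>j<J. (E j y)\<^sup>2) + B * C\<^sup>2 * e"
        using trunc_err[OF y, folded v_def] n2 n3[folded D3_def] n4[folded D4_def] n5[folded D5_def] by linarith
      also have "\<dots> = A1 * e + B * sqrt (\<Sum>j<J. (E j y)\<^sup>2)" by (simp add: A1_def algebra_simps)
      finally show ?thesis .
    qed
    define hb where "hb = (\<lambda>y. 2 * A1\<^sup>2 * e\<^sup>2 + 2 * B\<^sup>2 * (\<Sum>j<J. (E j y)\<^sup>2))"
    have err_sq: "(norm (err (?\<sigma> y)))\<^sup>2 \<le> hb y" if y: "y \<in> param_cube" for y
    proof -
      have "(norm (err (?\<sigma> y)))\<^sup>2 \<le> (A1 * e + B * sqrt (\<Sum>j<J. (E j y)\<^sup>2))\<^sup>2"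
        by (intro power_mono err_bound[OF y]) simp
      also have "\<dots> \<le> 2 * (A1 * e)\<^sup>2 + 2 * (B * sqrt (\<Sum>j<J. (E j y)\<^sup>2))\<^sup>2"
        using sum_squares_bound[of "A1 * e" "B * sqrt (\<Sum>j<J. (E j y)\<^sup>2)"] by (simp add: power2_sum)
      also have "\<dots> = hb y" by (simp add: hb_def power_mult_distrib sum_nonneg)
      finally show ?thesis .
    qed
    let ?R = "restrict_space borel (C_set w \<psi>d r s)"
    have err_meas: "err \<in> borel_measurable ?R"
    proof -
      have "G \<in> borel_measurable ?R"
        using Gc unfolding C_tilde_eq_C_set by (rule borel_measurable_continuous_on_restrict)
      moreover have "outp j \<in> borel_measurable ?R" if "j < J" for j
        unfolding outp_def
      proof (rule meas[rule_format, OF _ that])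
        fix i
        have "(\<lambda>x. inner x (\<psi>d i)) \<in> borel_measurable borel"
          by (intro borel_measurable_continuous_onI continuous_on_inner continuous_on_id continuous_on_const)
        then show "(\<lambda>x. ell2_nth (encoder \<psi>d x) i) \<in> borel_measurable ?R"
          unfolding encoder_nth[OF assms(1,2)] by (rule measurable_restrict_space1)
      qed
      ultimately show ?thesis unfolding err[abs_def]
        by (intro borel_measurable_diff borel_measurable_sum borel_measurable_scaleR borel_measurable_const) auto
    qed
    interpret U: prob_space uniform_cube by (rule prob_space_uniform_cube)
    have Ei: "integrable uniform_cube (\<lambda>y. (E j y)\<^sup>2)" if "j < J" for j using L4 that unfolding E_def by blast
    have hi: "integrable uniform_cube hb"
      unfolding hb_def by (intro Bochner_Integration.integrable_add integrable_mult_right Bochner_Integration.integrable_sum Ei U.integrable_const) auto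
    have sq_meas: "(\<lambda>x. (norm (err x))\<^sup>2) \<in> borel_measurable ?R"
    proof (rule measurable_compose[OF err_meas])
      show "(\<lambda>v::'y. (norm v)\<^sup>2) \<in> borel_measurable borel"
        by (intro borel_measurable_continuous_onI continuous_on_power continuous_on_norm continuous_on_id)
    qed
    have ei: "integrable uniform_cube (\<lambda>y. (norm (err (?\<sigma> y)))\<^sup>2)"
    proof (rule Bochner_Integration.integrable_bound[OF hi])
      show "(\<lambda>y. (norm (err (?\<sigma> y)))\<^sup>2) \<in> borel_measurable uniform_cube"
        by (rule measurable_compose[OF param_map_measurable sq_meas])
      show "AE y in uniform_cube. norm ((norm (err (?\<sigma> y)))\<^sup>2) \<le> norm (hb y)"
        by (rule AE_I2) (use err_sq in \<open>force simp: space_uniform_cube\<close>)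
    qed
    have L2s: "err \<in> L2_space (input_measure w \<psi> \<psi>d r s)"
      unfolding L2_space_def input_measure_def
      using err_meas ei by (simp add: integrable_distr_eq[OF param_map_measurable sq_meas])
    have "(\<integral>x. (norm (err x))\<^sup>2 \<partial>input_measure w \<psi> \<psi>d r s) = (\<integral>y. (norm (err (?\<sigma> y)))\<^sup>2 \<partial>uniform_cube)"
      unfolding input_measure_def by (rule integral_distr[OF param_map_measurable sq_meas])
    also have "\<dots> \<le> (\<integral>y. hb y \<partial>uniform_cube)"
      using ei hi err_sq by (intro integral_mono) (auto simp: space_uniform_cube)
    also have "\<dots> = 2 * A1\<^sup>2 * e\<^sup>2 + 2 * B\<^sup>2 * (\<Sum>j<J. \<integral>y. (E j y)\<^sup>2 \<partial>uniform_cube)"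
    proof -
      have "(\<integral>y. (\<Sum>j<J. (E j y)\<^sup>2) \<partial>uniform_cube) = (\<Sum>j<J. \<integral>y. (E j y)\<^sup>2 \<partial>uniform_cube)"
        by (rule Bochner_Integration.integral_sum) (use Ei in auto)
      moreover have "integrable uniform_cube (\<lambda>y. \<Sum>j<J. (E j y)\<^sup>2)"
        by (rule Bochner_Integration.integrable_sum) (use Ei in auto)
      ultimately show ?thesis unfolding hb_def by (simp add: U.prob_space)
    qed
    also have "\<dots> \<le> 2 * A1\<^sup>2 * e\<^sup>2 + 2 * B\<^sup>2 * (C / R\<^sup>2)"
      using L5 unfolding E_def by (intro add_left_mono mult_left_mono) auto
    also have "\<dots> = (2 * A1\<^sup>2 + 2 * B\<^sup>2 * C) * e\<^sup>2" by (simp add: eR power_divide algebra_simps)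
    finally have "L2_norm (input_measure w \<psi> \<psi>d r s) err \<le> sqrt ((2 * A1\<^sup>2 + 2 * B\<^sup>2 * C) * e\<^sup>2)"
      unfolding L2_norm_def by (rule real_sqrt_le_mono)
    also have "\<dots> = CC * e" using e by (simp add: real_sqrt_mult CC_def)
    also have "\<dots> \<le> CC * real N powr (- min (s - 1/2) t + \<delta>)"
      unfolding e_def tau_def using N CC dl(2) by (intro mult_left_mono powr_mono) (auto simp: m0_def)
    finally have L2n: "L2_norm (input_measure w \<psi> \<psi>d r s) err \<le> CC * real N powr (- min (s - 1/2) t + \<delta>)" .
    show "\<exists>net. is_network net \<and> real (network_size net) \<le> KK * real N \<and>
       (\<lambda>a. G a - (decoder \<eta> \<circ> network_map net \<circ> encoder \<psi>d) a)
         \<in> L2_space (input_measure w \<psi> \<psi>d r s) \<and>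
       L2_norm (input_measure w \<psi> \<psi>d r s)
         (\<lambda>a. G a - (decoder \<eta> \<circ> network_map net \<circ> encoder \<psi>d) a)
         \<le> CC * real N powr (- min (s - 1/2) t + \<delta>)"
      by (rule exI[of _ net]) (use net(1) size_fin L2s L2n in \<open>unfold err_def, blast\<close>)
  qed
qed

end
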